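(* There exist continuum many pairwise non-quasi-isometric solvable (actually (3-nilpotent)-by-abelian) finitely generated groups. Namely, for each prime $p$, there are continuum many pairwise non-quasi-isometric such groups that are quotients of $A_4(\mathbf{F}_p[t,t^{-1},(t-1)^{-1}])$ by central subgroups.
   Context: $\mathbf{F}_p$ is the field with $p$ elements. For a commutative ring $R$, $A_4(R)$ denotes the group of upper triangular $4\times 4$ matrices over $R$ with diagonal $(1,t_{22},t_{33},1)$, where $t_{22},t_{33}\in R^\times$, and with arbitrary entries $x_{ij}\in R$ for $i<j$. Finitely generated groups are endowed with word metrics with respect to finite generating subsets. (3-nilpotent)-by-abelian means having a normal subgroup that is nilpotent of class at most $3$ with abelian quotient. *)

theory Defs
  imports
    "HOL-Algebra.Solvable_Groups"
    "HOL-Computational_Algebra.Polynomial_Factorial"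
    "HOL-Library.Cardinality"
    "HOL-Library.Equipollence"
    "Jordan_Normal_Form.Matrix"
begin

section \<open>The group \<open>A\<^sub>4(R)\<close>\<close>

text \<open>The coefficient ring \<open>R\<close> is a subring of an ambient commutative ring. Rows and columns
  are numbered from \<open>0\<close>, so the diagonal entries required to be units of \<open>R\<close> have indices
  \<open>(1,1)\<close> and \<open>(2,2)\<close>.\<close>

definition A4 :: "'a::comm_ring_1 set \<Rightarrow> 'a mat monoid" where
  "A4 R = \<lparr> carrier = {M \<in> carrier_mat 4 4. upper_triangular M
              \<and> (\<forall>i<4. \<forall>j<4. M $$ (i, j) \<in> R)
              \<and> M $$ (0, 0) = 1 \<and> M $$ (3, 3) = 1
              \<and> (\<exists>u\<in>R. M $$ (1, 1) * u = 1) \<and> (\<exists>u\<in>R. M $$ (2, 2) * u = 1)},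
            monoid.mult = (*), one = 1\<^sub>m 4 \<rparr>"

text \<open>The subring \<open>k[t, t\<^sup>-\<^sup>1, (t-1)\<^sup>-\<^sup>1]\<close> of the field of rational functions \<open>k(t)\<close>: all
  \<open>f / (t\<^sup>m (t-1)\<^sup>n)\<close> with \<open>f\<close> a polynomial.\<close>

definition laurent_ring :: "'k::field poly fract set" where
  "laurent_ring = {to_fract f / (to_fract [:0, 1:] ^ m * to_fract [:-1, 1:] ^ n) | f m n. True}"


section \<open>Group-theoretic notions\<close>

definition group_center :: "('a, 'b) monoid_scheme \<Rightarrow> 'a set" where
  "group_center G = {z \<in> carrier G. \<forall>g\<in>carrier G. z \<otimes>\<^bsub>G\<^esub> g = g \<otimes>\<^bsub>G\<^esub> z}"

text \<open>The index is shifted: \<open>lower_central G n\<close> is the usual \<open>\<gamma>\<^sub>n\<^sub>+\<^sub>1(G)\<close>.\<close>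

primrec lower_central :: "('a, 'b) monoid_scheme \<Rightarrow> nat \<Rightarrow> 'a set" where
  "lower_central G 0 = carrier G"
| "lower_central G (Suc n) = generate G
     {x \<otimes>\<^bsub>G\<^esub> y \<otimes>\<^bsub>G\<^esub> inv\<^bsub>G\<^esub> x \<otimes>\<^bsub>G\<^esub> inv\<^bsub>G\<^esub> y | x y. x \<in> lower_central G n \<and> y \<in> carrier G}"

definition nilpotent_class_le :: "nat \<Rightarrow> ('a, 'b) monoid_scheme \<Rightarrow> bool" where
  "nilpotent_class_le c G \<longleftrightarrow> group G \<and> lower_central G c = {\<one>\<^bsub>G\<^esub>}"

definition nilpotent_by_abelian :: "nat \<Rightarrow> ('a, 'b) monoid_scheme \<Rightarrow> bool" where
  "nilpotent_by_abelian c G \<longleftrightarrow>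
     (\<exists>N. N \<lhd> G \<and> nilpotent_class_le c (G\<lparr>carrier := N\<rparr>) \<and> comm_group (G Mod N))"


section \<open>Word metrics and quasi-isometry\<close>

definition finite_generating_set :: "('a, 'b) monoid_scheme \<Rightarrow> 'a set \<Rightarrow> bool" where
  "finite_generating_set G S \<longleftrightarrow> finite S \<and> S \<subseteq> carrier G \<and> generate G S = carrier G"

definition finitely_generated :: "('a, 'b) monoid_scheme \<Rightarrow> bool" where
  "finitely_generated G \<longleftrightarrow> (\<exists>S. finite_generating_set G S)"

definition word_length :: "('a, 'b) monoid_scheme \<Rightarrow> 'a set \<Rightarrow> 'a \<Rightarrow> nat" where
  "word_length G S g =
     (LEAST n. \<exists>ws. length ws = n \<and> set ws \<subseteq> S \<union> (\<lambda>s. inv\<^bsub>G\<^esub> s) ` S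
                 \<and> foldr (\<lambda>x y. x \<otimes>\<^bsub>G\<^esub> y) ws \<one>\<^bsub>G\<^esub> = g)"

definition word_dist :: "('a, 'b) monoid_scheme \<Rightarrow> 'a set \<Rightarrow> 'a \<Rightarrow> 'a \<Rightarrow> real" where
  "word_dist G S g h = real (word_length G S (inv\<^bsub>G\<^esub> g \<otimes>\<^bsub>G\<^esub> h))"

definition quasi_isometric_spaces ::
    "'a set \<Rightarrow> ('a \<Rightarrow> 'a \<Rightarrow> real) \<Rightarrow> 'b set \<Rightarrow> ('b \<Rightarrow> 'b \<Rightarrow> real) \<Rightarrow> bool" where
  "quasi_isometric_spaces X dX Y dY \<longleftrightarrow>
     (\<exists>f \<in> X \<rightarrow> Y. \<exists>L\<ge>1. \<exists>C\<ge>0.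
        (\<forall>x\<in>X. \<forall>x'\<in>X. dX x x' / L - C \<le> dY (f x) (f x') \<and> dY (f x) (f x') \<le> L * dX x x' + C)
      \<and> (\<forall>y\<in>Y. \<exists>x\<in>X. dY (f x) y \<le> C))"

text \<open>For finitely generated groups, any two finite generating subsets give bi-Lipschitz
  equivalent word metrics, so it does not matter whether they are quantified existentially
  or universally.\<close>

definition quasi_isometric ::
    "('a, 'b) monoid_scheme \<Rightarrow> ('c, 'd) monoid_scheme \<Rightarrow> bool" where
  "quasi_isometric G H \<longleftrightarrow>
     (\<exists>S T. finite_generating_set G S \<and> finite_generating_set H T
        \<and> quasi_isometric_spaces (carrier G) (word_dist G S) (carrier H) (word_dist H T))"

end

theory Submission
  imports Defs
begin

text \<open>Let \<open>R = k[t, t\<^sup>-\<^sup>1, (t-1)\<^sup>-\<^sup>1]\<close> and \<open>G = A\<^sub>4(R)\<close>. The matrices \<open>e14 r\<close> that differ from the identity by the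
entry \<open>r\<close> in the upper right corner are central in \<open>G\<close>. For a set \<open>N\<close> of exponents let \<open>W\<^sub>N\<close> be the
central subgroup of all \<open>e14 f\<close> with \<open>f\<close> a combination of the powers \<open>t\<^sup>n\<close>, \<open>n \<in> N\<close>. The groups
\<open>G / W\<^sub>N\<close>, for suitable sparse sets \<open>N\<close>, are told apart by the lengths of those closed paths in their
Cayley graphs that cannot be filled by much shorter ones.

Filling is tested by functions \<open>c\<close> on pairs of points that are additive on all triangles of
diameter at most \<open>r\<close> (\<open>coarse_cocycle\<close>): if a closed path can be filled by such triangles, every such
\<open>c\<close> has sum \<open>0\<close> along it. A quasi-isometry transports cocycles and closed paths, and changes scales and
lengths only linearly (\<open>pull_back_loop\<close>). Two facts determine what happens in \<open>G / W\<^sub>N\<close>.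

First, every relation of \<open>G\<close> follows from its relations of length at most four
(\<open>relations_of_A4\<close>), so \<open>G\<close> is finitely presented. Hence, for \<open>r \<ge> 4\<close>, the sum of a
cocycle along a closed path of \<open>G / W\<^sub>N\<close> depends only on the element of \<open>W\<^sub>N\<close> obtained by lifting the
path to \<open>G\<close>, and it vanishes if this element is a product of monomials \<open>e14 (a t\<^sup>j)\<close> of length at most
\<open>r\<close> in \<open>W\<^sub>N\<close> (\<open>loop_sum_eq_0\<close>). Secondly, if \<open>q \<in> N\<close> and the coefficient at \<open>t\<^sup>q\<close> vanishes on all elements
of \<open>W\<^sub>N\<close> of length at most \<open>3r\<close>, then this coefficient defines a cocycle at scale \<open>r\<close> whose sum along the
closed path of \<open>e14 (t\<^sup>q)\<close> is \<open>1\<close> (\<open>ex_nontrivial_cocycle\<close>).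

Now let the exponents \<open>m 0 < m 1 < \<dots>\<close> grow so fast that elements \<open>e14 f\<close> whose length is at most about
\<open>i + 1\<close> times that of the monomials of degree up to \<open>m i\<close> have degree below \<open>m (i + 1)\<close> (\<open>ex_lacunary_degrees\<close>).
If \<open>k + 1\<close> lies in \<open>J\<close> but not in \<open>I\<close>, then the closed path of the monomial of degree \<open>m (k + 1)\<close> cannot be
filled in the quotient for \<open>m ` J\<close> even at a scale proportional to \<open>k\<close> times the length of the monomials of degree
up to \<open>m k\<close>, whereas all closed paths of comparable length in the quotient for \<open>m ` I\<close> are filled at a scale near
the length of these monomials. For large \<open>k\<close> this contradicts a quasi-isometry (\<open>not_quasi_isometric\<close>), so it suffices to index the groups by
continuum many sets any two of which have infinite differences.

The finite presentability of \<open>G\<close> comes from an argument of Baumslag and Abels. In any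
group in which the short relations hold, conjugation by lifts of diagonal matrices makes each
root subgroup a module over \<open>k[t, t\<^sup>-\<^sup>1, (t-1)\<^sup>-\<^sup>1]\<close>; because \<open>t = 1 + (t-1)\<close>, finitely many commutations force
all of its elements to commute. For two roots with independent weights the diagonal matrices
carry relations between constants to all elements. Only the pairs \<open>(12, 24)\<close> and \<open>(13, 34)\<close>, which
produce the corner entry, have dependent weights; the Hall-Witt identity shows that their
commutators agree, depend only on the product of the two ring elements and are central. This
gives a normal form for all elements, which can be read off from the matrix.\<close>

section \<open>The ring of coefficients\<close>

abbreviation tt :: "'k::field poly fract" where "tt \<equiv> to_fract [:0, 1:]"
abbreviation ss :: "'k::field poly fract" where "ss \<equiv> to_fract [:-1, 1:]"
abbreviation scalar :: "'k::field \<Rightarrow> 'k poly fract" where "scalar c \<equiv> to_fract [:c:]"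

abbreviation unit_gens :: "'k::field poly fract set" where
  "unit_gens \<equiv> {tt, ss, inverse tt, inverse ss}"

lemma tt_nonzero [simp]: "(tt :: 'k::field poly fract) \<noteq> 0"
  and ss_nonzero [simp]: "(ss :: 'k::field poly fract) \<noteq> 0"
  by simp_all

lemma to_fract_power [simp]: "to_fract (f ^ n) = to_fract f ^ n"
  by (induction n) simp_all

lemma one_plus_ss: "1 + ss = (tt :: 'k::field poly fract)"
proof -
  have "1 + [:-1, 1:] = [:0, 1 :: 'k:]" by (simp add: one_pCons)
  then show ?thesis by (metis to_fract_1 to_fract_add)
qed

lemma scalar_mult: "scalar c * scalar d = scalar (c * d)"
  by (simp add: to_fract_mult[symmetric] mult.commute del: to_fract_mult)

lemma scalar_add: "scalar c + scalar d = scalar (c + d)"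
  by (simp add: to_fract_add[symmetric] del: to_fract_add)

lemma scalar_minus: "- scalar c = scalar (- c)"
  by (metis add.left_inverse add.right_inverse add_eq_0_iff pCons_0_0 scalar_add to_fract_0)

lemma scalar_1 [simp]: "scalar 1 = 1"
  by (metis one_pCons to_fract_1)

lemma scalar_inverse: "c \<noteq> 0 \<Longrightarrow> inverse (scalar c) = scalar (inverse c)"
  using scalar_mult[of c "inverse c"] by (simp add: inverse_unique)

lemma laurent_ringI: "x = to_fract f / (tt ^ m * ss ^ n) \<Longrightarrow> x \<in> laurent_ring"
  unfolding laurent_ring_def by blast

lemma laurent_ringE:
  assumes "x \<in> laurent_ring"
  obtains f m n where "x = to_fract f / (tt ^ m * ss ^ n)"
  using assms unfolding laurent_ring_def by blast

lemma to_fract_in_laurent_ring [simp, intro]: "to_fract f \<in> laurent_ring"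
  by (rule laurent_ringI[of _ f 0 0]) simp

lemma zero_in_laurent_ring [simp, intro]: "0 \<in> laurent_ring"
  and one_in_laurent_ring [simp, intro]: "1 \<in> laurent_ring"
  using to_fract_in_laurent_ring[of 0] to_fract_in_laurent_ring[of 1] by simp_all

lemma add_in_laurent_ring [simp, intro]:
  assumes "x \<in> laurent_ring" "y \<in> laurent_ring" shows "x + y \<in> laurent_ring"
proof -
  obtain f m n where x: "x = to_fract f / (tt ^ m * ss ^ n)" by (rule laurent_ringE[OF assms(1)])
  obtain g m' n' where y: "y = to_fract g / (tt ^ m' * ss ^ n')" by (rule laurent_ringE[OF assms(2)])
  have "x + y = to_fract (f * [:0,1:] ^ m' * [:-1,1:] ^ n' + g * [:0,1:] ^ m * [:-1,1:] ^ n)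
      / (tt ^ (m + m') * ss ^ (n + n'))"
    unfolding x y by (simp add: field_simps power_add)
  then show ?thesis by (rule laurent_ringI)
qed

lemma mult_in_laurent_ring [simp, intro]:
  assumes "x \<in> laurent_ring" "y \<in> laurent_ring" shows "x * y \<in> laurent_ring"
proof -
  obtain f m n where x: "x = to_fract f / (tt ^ m * ss ^ n)" by (rule laurent_ringE[OF assms(1)])
  obtain g m' n' where y: "y = to_fract g / (tt ^ m' * ss ^ n')" by (rule laurent_ringE[OF assms(2)])
  have "x * y = to_fract (f * g) / (tt ^ (m + m') * ss ^ (n + n'))"
    unfolding x y by (simp add: field_simps power_add)
  then show ?thesis by (rule laurent_ringI)
qed

lemma uminus_in_laurent_ring [simp, intro]:
  assumes "x \<in> laurent_ring" shows "- x \<in> laurent_ring"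
proof -
  have "- 1 \<in> laurent_ring" using to_fract_in_laurent_ring[of "- 1"] by simp
  from mult_in_laurent_ring[OF this assms] show ?thesis by simp
qed

lemma inverse_tt_in_laurent_ring [simp, intro]: "inverse tt \<in> laurent_ring"
  by (rule laurent_ringI[of _ 1 1 0]) (simp add: inverse_eq_divide)

lemma inverse_ss_in_laurent_ring [simp, intro]: "inverse ss \<in> laurent_ring"
  by (rule laurent_ringI[of _ 1 0 1]) (simp add: inverse_eq_divide)

lemma to_fract_pCons: "to_fract (pCons c f) = scalar c + tt * to_fract f"
proof -
  have "pCons c f = [:c:] + [:0, 1:] * f" by simp
  then show ?thesis by (metis to_fract_add to_fract_mult)
qed

text \<open>Polynomials arise from constants by Horner's scheme, and the denominators are products of \<open>t\<close> and
  \<open>t - 1\<close>; so a property that is stable under sums and under four multiplications has to be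
  checked on constants only.\<close>
lemma laurent_ring_induct [consumes 1, case_names scalar add unit]:
  assumes "r \<in> laurent_ring"
    and scal: "\<And>c. P (scalar c)"
    and add: "\<And>x y. x \<in> laurent_ring \<Longrightarrow> y \<in> laurent_ring \<Longrightarrow> P x \<Longrightarrow> P y \<Longrightarrow> P (x + y)"
    and unit: "\<And>\<kappa> x. \<kappa> \<in> unit_gens \<Longrightarrow> x \<in> laurent_ring \<Longrightarrow> P x \<Longrightarrow> P (\<kappa> * x)"
  shows "P r"
proof -
  have poly: "P (to_fract f)" for f
  proof (induction f)
    case 0
    show ?case using scal[of 0] by simp
  next
    case (pCons c f)
    have "P (scalar c + tt * to_fract f)"
      by (rule add[OF _ _ scal unit[OF _ _ pCons.IH]]) auto
    then show ?case by (simp only: to_fract_pCons[of c f])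
  qed
  obtain f m n where r: "r = to_fract f / (tt ^ m * ss ^ n)" by (rule laurent_ringE[OF assms(1)])
  have 1: "to_fract f / (tt ^ m * ss ^ 0) \<in> laurent_ring \<and> P (to_fract f / (tt ^ m * ss ^ 0))" for m
  proof (induction m)
    case 0
    then show ?case using poly by simp
  next
    case (Suc m)
    have "to_fract f / (tt ^ Suc m * ss ^ 0) = inverse tt * (to_fract f / (tt ^ m * ss ^ 0))"
      by (simp add: field_simps)
    then show ?case using Suc unit[of "inverse tt"]
      by (metis inverse_tt_in_laurent_ring insert_iff mult_in_laurent_ring)
  qed
  have "to_fract f / (tt ^ m * ss ^ n) \<in> laurent_ring \<and> P (to_fract f / (tt ^ m * ss ^ n))"
  proof (induction n)
    case 0
    then show ?case using 1 .
  next
    case (Suc n)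
    have "to_fract f / (tt ^ m * ss ^ Suc n) = inverse ss * (to_fract f / (tt ^ m * ss ^ n))"
      by (simp add: field_simps)
    then show ?case using Suc unit[of "inverse ss"]
      by (metis inverse_ss_in_laurent_ring insert_iff mult_in_laurent_ring)
  qed
  then show ?thesis using r by simp
qed

section \<open>Commuting elements of a group\<close>

definition commutes :: "'g::group_add \<Rightarrow> 'g \<Rightarrow> bool" where
  "commutes a b \<longleftrightarrow> a + b = b + a"

lemma commutes_sym: "commutes a b \<Longrightarrow> commutes b a"
  by (simp add: commutes_def)

lemma commutes_0 [simp]: "commutes a 0" "commutes 0 a"
  by (simp_all add: commutes_def)

lemma commutes_add: "commutes a b \<Longrightarrow> commutes a c \<Longrightarrow> commutes a (b + c)"
  unfolding commutes_def by (metis add.assoc)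

lemma commutes_minus: "commutes a b \<Longrightarrow> commutes a (- b)"
  unfolding commutes_def by (metis add.assoc add.right_neutral add_minus_cancel left_minus)

lemma commutes_add_cancel: "commutes a b \<Longrightarrow> commutes a (b + c) \<Longrightarrow> commutes a c"
  using commutes_add[of a "- b" "b + c"] commutes_minus[of a b] by simp

lemma commutes_minus_iff [simp]: "commutes a (- b) \<longleftrightarrow> commutes a b" "commutes (- a) b \<longleftrightarrow> commutes a b"
  by (metis commutes_minus minus_minus, metis commutes_minus commutes_sym minus_minus)

section \<open>Baumslag's trick\<close>

text \<open>The maps \<open>\<alpha>\<close> and \<open>\<beta>\<close> play the role of multiplication by \<open>t\<close> and \<open>t - 1\<close> on the image \<open>e\<close> of the constants;
  \<open>e_one_plus\<close> is the equation \<open>1 + (t - 1) = t\<close>. Commutativity enters only between constants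
  and their first translates; this suffices for \<open>e\<close> to extend to an additive map \<open>ext\<close> on the whole ring.\<close>
locale laurent_module =
  fixes \<alpha> \<beta> \<alpha>' \<beta>' :: "'g::group_add \<Rightarrow> 'g" and e :: "'k::field \<Rightarrow> 'g"
  assumes \<alpha>_add: "\<alpha> (x + y) = \<alpha> x + \<alpha> y" and \<beta>_add: "\<beta> (x + y) = \<beta> x + \<beta> y"
    and inv [simp]: "\<alpha>' (\<alpha> x) = x" "\<alpha> (\<alpha>' x) = x" "\<beta>' (\<beta> x) = x" "\<beta> (\<beta>' x) = x"
    and \<alpha>_\<beta>: "\<alpha> (\<beta> x) = \<beta> (\<alpha> x)"
    and e_add: "e (c + d) = e c + e d"
    and e_one_plus: "e c + \<beta> (e c) = \<alpha> (e c)"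
    and e_comm_\<alpha>: "e c + \<alpha> (e d) = \<alpha> (e d) + e c"
begin

lemma zero [simp]: "\<alpha> 0 = 0" "\<beta> 0 = 0" "e 0 = 0"
  using \<alpha>_add[of 0 0] \<beta>_add[of 0 0] e_add[of 0 0] by (metis add.right_neutral add_left_cancel)+

lemma uminus: "\<alpha> (- x) = - \<alpha> x" "\<beta> (- x) = - \<beta> x"
  by (metis \<alpha>_add add.right_inverse add_eq_0_iff2 minus_unique zero(1))
     (metis \<beta>_add add.right_inverse add_eq_0_iff2 minus_unique zero(2))

lemma funpow_add_hom: "(\<alpha> ^^ n) (x + y) = (\<alpha> ^^ n) x + (\<alpha> ^^ n) y"
  by (induction n) (simp_all add: \<alpha>_add)

lemma funpow_minus_hom: "(\<alpha> ^^ n) (- x) = - (\<alpha> ^^ n) x"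
  by (induction n) (simp_all add: uminus)

lemma funpow_\<beta>: "\<beta> ((\<alpha> ^^ n) x) = (\<alpha> ^^ n) (\<beta> x)"
  by (induction n) (simp_all add: \<alpha>_\<beta>[symmetric])

lemma \<beta>_e: "\<beta> (e c) = - e c + \<alpha> (e c)"
  by (simp add: e_one_plus[symmetric])

text \<open>Baumslag's trick. Applying \<open>\<beta>\<close> to the commutation of \<open>e c\<close> with the translate by \<open>\<alpha>\<^sup>n\<close> replaces each element
  by minus itself plus its next translate; of the four commutations between these summands all but that of
  \<open>e c\<close> with the translate by \<open>\<alpha>\<^sup>n\<^sup>+\<^sup>1\<close> are already known.\<close>
lemma e_comm_funpow: "e c + (\<alpha> ^^ n) (e d) = (\<alpha> ^^ n) (e d) + e c"
proof (induction n arbitrary: c d rule: less_induct)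
  case (less n)
  consider "n = 0" | "n = 1" | m where "n = Suc (Suc m)"
    by (metis One_nat_def nat.exhaust)
  then show ?case
  proof cases
    case 1
    then show ?thesis using e_add[of c d] e_add[of d c] by (simp add: add.commute)
  next
    case 2
    then show ?thesis using e_comm_\<alpha> by simp
  next
    case (3 m)
    define a where "a = e c"
    define a1 where "a1 = \<alpha> (e c)"
    define b where "b = (\<alpha> ^^ Suc m) (e d)"
    define b1 where "b1 = (\<alpha> ^^ Suc (Suc m)) (e d)"
    have ab: "commutes a b" unfolding commutes_def a_def b_def using less 3 by blast
    have \<alpha>_commutes: "commutes (\<alpha> x) (\<alpha> y)" if "commutes x y" for x y
      using that unfolding commutes_def by (metis \<alpha>_add)
    have "commutes (e c) ((\<alpha> ^^ m) (e d))" "commutes (e c) ((\<alpha> ^^ Suc m) (e d))"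
      unfolding commutes_def using less(1)[of m c d] less(1)[of "Suc m" c d] 3 by simp_all
    from this[THEN \<alpha>_commutes] have a1b: "commutes a1 b" and a1b1: "commutes a1 b1"
      unfolding a1_def b_def b1_def by simp_all
    \<comment> \<open>\<open>\<beta>\<close> acts on \<open>a\<close> and \<open>b\<close> as \<open>\<alpha> - 1\<close>.\<close>
    have \<beta>a: "\<beta> a = - a + a1" unfolding a_def a1_def by (rule \<beta>_e)
    have \<beta>b: "\<beta> b = - b + b1" unfolding b_def b1_def funpow_\<beta> \<beta>_e
      by (simp only: funpow_add_hom funpow_minus_hom funpow_swap1 \<alpha>_add uminus funpow.simps o_apply)
    have "commutes (- a + a1) (- b + b1)"
      using ab unfolding commutes_def \<beta>a[symmetric] \<beta>b[symmetric] \<beta>_add[symmetric] by simp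
    moreover have "commutes a1 (- b + b1)" using a1b a1b1 by (simp add: commutes_add)
    ultimately have "commutes (- b + b1) (- a + a1)" "commutes (- b + b1) (- a1)"
      by (simp_all add: commutes_sym)
    then have "commutes (- b + b1) (- a + a1 + - a1)" by (rule commutes_add)
    then have "commutes a (- b + b1)" by (simp add: add.assoc commutes_sym)
    then have "commutes a b1" using ab commutes_add_cancel[of a "- b" b1] by simp
    then show ?thesis unfolding commutes_def a_def b1_def 3 .
  qed
qed

text \<open>Horner's scheme fixes an order of summation, which matters as long as the summands are not known to
  commute.\<close>
definition poly_ext :: "'k poly \<Rightarrow> 'g" where
  "poly_ext f = fold_coeffs (\<lambda>c \<gamma>. e c + \<alpha> \<gamma>) f 0"

lemma poly_ext_0 [simp]: "poly_ext 0 = 0"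
  by (simp add: poly_ext_def)

lemma poly_ext_pCons: "poly_ext (pCons c f) = e c + \<alpha> (poly_ext f)"
  by (cases "c = 0 \<and> f = 0")
     (auto simp: poly_ext_def fold_coeffs_pCons_coeff_not_0_eq fold_coeffs_pCons_not_0_0_eq)

lemma e_comm_poly_ext: "e c + (\<alpha> ^^ n) (poly_ext f) = (\<alpha> ^^ n) (poly_ext f) + e c"
proof (induction f arbitrary: n)
  case 0
  have "(\<alpha> ^^ n) 0 = 0" by (induction n) simp_all
  then show ?case by simp
next
  case (pCons d f)
  have 1: "(\<alpha> ^^ n) (poly_ext (pCons d f)) = (\<alpha> ^^ n) (e d) + (\<alpha> ^^ Suc n) (poly_ext f)"
    by (simp add: poly_ext_pCons funpow_add_hom funpow_swap1)
  show ?case unfolding 1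
    using e_comm_funpow[of c n d] pCons.IH[of "Suc n"] by (metis add.assoc)
qed

lemma poly_ext_add: "poly_ext (f + g) = poly_ext f + poly_ext g"
proof (induction f g rule: poly_induct2)
  case 0
  show ?case by simp
next
  case (pCons a f b g)
  have "\<alpha> (poly_ext f) + e b = e b + \<alpha> (poly_ext f)"
    using e_comm_poly_ext[of b 1 f] by simp
  with pCons show ?case
    by (simp add: poly_ext_pCons e_add \<alpha>_add) (metis add.assoc)
qed

lemma poly_ext_t: "poly_ext ([:0, 1:] * f) = \<alpha> (poly_ext f)"
  by (simp add: poly_ext_pCons)

lemma \<beta>_poly_ext: "poly_ext f + \<beta> (poly_ext f) = \<alpha> (poly_ext f)"
proof (induction f)
  case 0
  show ?case by simp
next
  case (pCons c f)
  let ?x = "\<alpha> (poly_ext f)"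
  have "commutes ?x (e c)" "commutes ?x (\<alpha> (e c))"
    using e_comm_poly_ext[of c 1 f] arg_cong[OF e_comm_poly_ext[of c 0 f], of \<alpha>]
    by (simp_all add: commutes_def \<alpha>_add)
  then have 1: "?x + \<beta> (e c) = \<beta> (e c) + ?x"
    unfolding \<beta>_e commutes_def[symmetric] by (simp add: commutes_add)
  have "poly_ext (pCons c f) + \<beta> (poly_ext (pCons c f)) = e c + (?x + \<beta> (e c)) + \<beta> ?x"
    by (simp add: poly_ext_pCons \<beta>_add add.assoc)
  also have "\<dots> = (e c + \<beta> (e c)) + (?x + \<beta> ?x)" unfolding 1 by (simp add: add.assoc)
  also have "?x + \<beta> ?x = \<alpha> ?x"
    using arg_cong[OF pCons.IH, of \<alpha>] by (simp add: \<alpha>_add \<alpha>_\<beta>)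
  also have "(e c + \<beta> (e c)) + \<alpha> ?x = \<alpha> (poly_ext (pCons c f))"
    by (simp add: poly_ext_pCons \<alpha>_add e_one_plus)
  finally show ?case .
qed

lemma poly_ext_s: "poly_ext ([:-1, 1:] * f) = \<beta> (poly_ext f)"
proof -
  have "f + [:-1, 1:] * f = [:0, 1:] * f" by simp
  then have "poly_ext f + poly_ext ([:-1, 1:] * f) = \<alpha> (poly_ext f)"
    by (metis poly_ext_add poly_ext_t)
  then show ?thesis using \<beta>_poly_ext by (metis add_left_cancel)
qed

lemma poly_ext_monomial: "poly_ext ([:0, 1:] ^ m * [:-1, 1:] ^ n * f) = (\<alpha> ^^ m) ((\<beta> ^^ n) (poly_ext f))"
proof (induction m)
  case 0
  show ?case
  proof (induction n)
    case (Suc n)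
    have "[:-1, 1:] ^ Suc n * f = [:-1, 1:] * ([:-1, 1:] ^ n * f)"
      by (simp only: power_Suc mult.assoc)
    then show ?case using Suc poly_ext_s by simp
  qed simp
next
  case (Suc m)
  have "[:0, 1:] ^ Suc m * [:-1, 1:] ^ n * f = [:0, 1:] * ([:0, 1:] ^ m * [:-1, 1:] ^ n * f)"
    by (simp only: power_Suc mult.assoc)
  then show ?case using Suc poly_ext_t by simp
qed

lemma funpow_inv:
  "(\<alpha> ^^ m) ((\<alpha>' ^^ m) x) = x" "(\<beta> ^^ m) ((\<beta>' ^^ m) x) = x"
  by (induction m arbitrary: x) (simp_all add: funpow_swap1)

lemma funpow_inj:
  assumes "(\<alpha> ^^ m) ((\<beta> ^^ n) x) = (\<alpha> ^^ m) ((\<beta> ^^ n) y)" shows "x = y"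
proof -
  have "inj \<alpha>" "inj \<beta>" by (metis injI inv(1), metis injI inv(3))
  then have "inj (\<alpha> ^^ m)" "inj (\<beta> ^^ n)" by (simp_all add: inj_fn)
  with assms show ?thesis by (simp add: inj_eq)
qed

lemma funpow_\<alpha>_\<beta>: "(\<alpha> ^^ m) ((\<beta> ^^ n) x) = (\<beta> ^^ n) ((\<alpha> ^^ m) x)"
  by (induction n arbitrary: x) (simp_all add: funpow_\<beta>[symmetric])

definition frac_ext :: "'k poly \<Rightarrow> nat \<Rightarrow> nat \<Rightarrow> 'g" where
  "frac_ext f m n = (\<beta>' ^^ n) ((\<alpha>' ^^ m) (poly_ext f))"

lemma frac_ext_eq: "(\<alpha> ^^ m) ((\<beta> ^^ n) (frac_ext f m n)) = poly_ext f"
  by (simp add: frac_ext_def funpow_inv)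

text \<open>Since \<open>\<alpha>\<close> and \<open>\<beta>\<close> are injective, an element is determined after clearing denominators.\<close>
lemma frac_ext_char:
  assumes "(\<alpha> ^^ m) ((\<beta> ^^ n) \<gamma>) = poly_ext f" shows "\<gamma> = frac_ext f m n"
  by (rule funpow_inj[of m n]) (simp add: assms frac_ext_eq)

lemma frac_ext_cancel:
  "frac_ext ([:0, 1:] ^ m' * [:-1, 1:] ^ n' * f) (m' + m) (n' + n) = frac_ext f m n"
proof (rule frac_ext_char[symmetric])
  show "(\<alpha> ^^ (m' + m)) ((\<beta> ^^ (n' + n)) (frac_ext f m n)) =
      poly_ext ([:0, 1:] ^ m' * [:-1, 1:] ^ n' * f)"
    unfolding poly_ext_monomial frac_ext_eq[of m n f, symmetric]
    by (simp add: funpow_add funpow_\<alpha>_\<beta>)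
qed

lemma frac_ext_cong:
  assumes "to_fract f / (tt ^ m * ss ^ n) = to_fract f' / (tt ^ m' * ss ^ n')"
  shows "frac_ext f m n = frac_ext f' m' n'"
proof -
  have "to_fract ([:0, 1:] ^ m' * [:-1, 1:] ^ n' * f) = to_fract ([:0, 1:] ^ m * [:-1, 1:] ^ n * f')"
    using assms by (simp add: field_simps)
  then have "[:0, 1:] ^ m' * [:-1, 1:] ^ n' * f = [:0, 1:] ^ m * [:-1, 1:] ^ n * f'"
    by (simp only: to_fract_eq_iff)
  then show ?thesis
    using frac_ext_cancel[of m' n' f m n] frac_ext_cancel[of m n f' m' n'] by (simp add: add.commute)
qed

definition ext :: "'k poly fract \<Rightarrow> 'g" where
  "ext r = (SOME \<gamma>. \<exists>f m n. r = to_fract f / (tt ^ m * ss ^ n) \<and> \<gamma> = frac_ext f m n)"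

lemma ext_fraction: "ext (to_fract f / (tt ^ m * ss ^ n)) = frac_ext f m n"
  unfolding ext_def by (rule some_equality) (auto intro: frac_ext_cong)

lemma ext_scalar: "ext (scalar c) = e c"
proof -
  have "ext (scalar c) = ext (to_fract [:c:] / (tt ^ 0 * ss ^ 0))" by simp
  also have "\<dots> = e c" unfolding ext_fraction by (simp add: frac_ext_def poly_ext_pCons)
  finally show ?thesis .
qed

lemma ext_t:
  assumes "r \<in> laurent_ring" shows "ext (tt * r) = \<alpha> (ext r)"
proof -
  obtain f m n where r: "r = to_fract f / (tt ^ m * ss ^ n)" by (rule laurent_ringE[OF assms])
  have "tt * r = to_fract ([:0, 1:] * f) / (tt ^ m * ss ^ n)" unfolding r to_fract_mult by simp
  then have "ext (tt * r) = frac_ext ([:0, 1:] * f) m n" by (simp only: ext_fraction)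
  also have "\<dots> = \<alpha> (frac_ext f m n)"
    by (rule frac_ext_char[symmetric])
       (simp only: poly_ext_t, simp add: frac_ext_eq[of m n f, symmetric]
          funpow_\<alpha>_\<beta>[of 1, simplified, symmetric] funpow_swap1)
  finally show ?thesis unfolding r ext_fraction .
qed

lemma ext_s:
  assumes "r \<in> laurent_ring" shows "ext (ss * r) = \<beta> (ext r)"
proof -
  obtain f m n where r: "r = to_fract f / (tt ^ m * ss ^ n)" by (rule laurent_ringE[OF assms])
  have "ss * r = to_fract ([:-1, 1:] * f) / (tt ^ m * ss ^ n)" unfolding r to_fract_mult by simp
  then have "ext (ss * r) = frac_ext ([:-1, 1:] * f) m n" by (simp only: ext_fraction)
  also have "\<dots> = \<beta> (frac_ext f m n)"
    by (rule frac_ext_char[symmetric])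
       (simp only: poly_ext_s, simp add: frac_ext_eq[of m n f, symmetric] funpow_\<beta> funpow_swap1)
  finally show ?thesis unfolding r ext_fraction .
qed

lemma ext_inverse_t:
  assumes "r \<in> laurent_ring" shows "ext (inverse tt * r) = \<alpha>' (ext r)"
proof -
  have 1: "tt * (inverse tt * r) = r" by (simp add: field_simps)
  have "ext (tt * (inverse tt * r)) = \<alpha> (ext (inverse tt * r))"
    using assms by (intro ext_t) auto
  then show ?thesis unfolding 1 by simp
qed

lemma ext_inverse_s:
  assumes "r \<in> laurent_ring" shows "ext (inverse ss * r) = \<beta>' (ext r)"
proof -
  have 1: "ss * (inverse ss * r) = r" by (simp add: field_simps)
  have "ext (ss * (inverse ss * r)) = \<beta> (ext (inverse ss * r))"
    using assms by (intro ext_s) auto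
  then show ?thesis unfolding 1 by simp
qed

lemma \<alpha>_\<beta>_funpow_add: "(\<alpha> ^^ m) ((\<beta> ^^ n) (x + y)) = (\<alpha> ^^ m) ((\<beta> ^^ n) x) + (\<alpha> ^^ m) ((\<beta> ^^ n) y)"
proof -
  have "(\<beta> ^^ n) (x + y) = (\<beta> ^^ n) x + (\<beta> ^^ n) y" by (induction n) (simp_all add: \<beta>_add)
  then show ?thesis by (simp add: funpow_add_hom)
qed

lemma ext_add:
  assumes "r \<in> laurent_ring" "r' \<in> laurent_ring" shows "ext (r + r') = ext r + ext r'"
proof -
  obtain f m n where r: "r = to_fract f / (tt ^ m * ss ^ n)" by (rule laurent_ringE[OF assms(1)])
  obtain f' m' n' where r': "r' = to_fract f' / (tt ^ m' * ss ^ n')" by (rule laurent_ringE[OF assms(2)])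
  let ?g = "[:0, 1:] ^ m' * [:-1, 1:] ^ n' * f" and ?g' = "[:0, 1:] ^ m * [:-1, 1:] ^ n * f'"
  have 1: "ext r = frac_ext ?g (m + m') (n + n')"
    unfolding r ext_fraction using frac_ext_cancel[of m' n' f m n] by (simp add: add.commute)
  have 2: "ext r' = frac_ext ?g' (m + m') (n + n')"
    unfolding r' ext_fraction using frac_ext_cancel[of m n f' m' n'] by simp
  have "r + r' = to_fract (?g + ?g') / (tt ^ (m + m') * ss ^ (n + n'))"
    unfolding r r' by (simp add: field_simps power_add)
  then have "ext (r + r') = frac_ext (?g + ?g') (m + m') (n + n')"
    by (simp only: ext_fraction)
  also have "\<dots> = frac_ext ?g (m + m') (n + n') + frac_ext ?g' (m + m') (n + n')"
    by (rule frac_ext_char[symmetric]) (simp only: \<alpha>_\<beta>_funpow_add frac_ext_eq poly_ext_add)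
  finally show ?thesis using 1 2 by simp
qed

end

section \<open>Matrices in \<open>A\<^sub>4\<close>\<close>

definition m4 :: "'a \<Rightarrow> 'a \<Rightarrow> 'a \<Rightarrow> 'a \<Rightarrow> 'a \<Rightarrow> 'a \<Rightarrow> 'a \<Rightarrow> 'a \<Rightarrow> 'a::comm_ring_1 mat" where
  "m4 u v a12 a13 a14 a23 a24 a34 = mat 4 4 (\<lambda>(i, j).
     [[1, a12, a13, a14], [0, u, a23, a24], [0, 0, v, a34], [0, 0, 0, 1]] ! i ! j)"

lemma less_4_cases: "(i::nat) < 4 \<longleftrightarrow> i = 0 \<or> i = 1 \<or> i = 2 \<or> i = 3"
  by auto

lemma m4_carrier [simp]: "m4 u v a12 a13 a14 a23 a24 a34 \<in> carrier_mat 4 4"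
  "dim_row (m4 u v a12 a13 a14 a23 a24 a34) = 4" "dim_col (m4 u v a12 a13 a14 a23 a24 a34) = 4"
  by (simp_all add: m4_def)

lemma m4_mult:
  "m4 u v a12 a13 a14 a23 a24 a34 * m4 u' v' b12 b13 b14 b23 b24 b34 =
   m4 (u * u') (v * v') (b12 + a12 * u') (b13 + a12 * b23 + a13 * v')
     (b14 + a12 * b24 + a13 * b34 + a14) (u * b23 + a23 * v') (u * b24 + a23 * b34 + a24)
     (v * b34 + a34)"
proof (rule eq_matI, goal_cases)
  case (1 i j)
  then have "i < 4" "j < 4" by simp_all
  moreover have "{0..<4} = {0, 1, 2, 3::nat}" by auto
  ultimately show ?case
    unfolding less_4_cases by (elim disjE; simp add: m4_def scalar_prod_def)
qed simp_all

lemma one_mat_4: "1\<^sub>m 4 = m4 1 1 0 0 0 0 0 0"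
proof (rule eq_matI, goal_cases)
  case (1 i j)
  then have "i < 4" "j < 4" by simp_all
  then show ?case unfolding less_4_cases by (elim disjE; simp add: m4_def)
qed simp_all

lemma m4_entries:
  "m4 u v a12 a13 a14 a23 a24 a34 $$ (0, 0) = 1" "m4 u v a12 a13 a14 a23 a24 a34 $$ (0, 1) = a12"
  "m4 u v a12 a13 a14 a23 a24 a34 $$ (0, 2) = a13" "m4 u v a12 a13 a14 a23 a24 a34 $$ (0, 3) = a14"
  "m4 u v a12 a13 a14 a23 a24 a34 $$ (1, 0) = 0" "m4 u v a12 a13 a14 a23 a24 a34 $$ (1, 1) = u"
  "m4 u v a12 a13 a14 a23 a24 a34 $$ (1, 2) = a23" "m4 u v a12 a13 a14 a23 a24 a34 $$ (1, 3) = a24"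
  "m4 u v a12 a13 a14 a23 a24 a34 $$ (2, 0) = 0" "m4 u v a12 a13 a14 a23 a24 a34 $$ (2, 1) = 0"
  "m4 u v a12 a13 a14 a23 a24 a34 $$ (2, 2) = v" "m4 u v a12 a13 a14 a23 a24 a34 $$ (2, 3) = a34"
  "m4 u v a12 a13 a14 a23 a24 a34 $$ (3, 0) = 0" "m4 u v a12 a13 a14 a23 a24 a34 $$ (3, 1) = 0"
  "m4 u v a12 a13 a14 a23 a24 a34 $$ (3, 2) = 0" "m4 u v a12 a13 a14 a23 a24 a34 $$ (3, 3) = 1"
  by (simp_all add: m4_def)

lemma m4_eq_iff:
  "m4 u v a12 a13 a14 a23 a24 a34 = m4 u' v' b12 b13 b14 b23 b24 b34 \<longleftrightarrow>
   u = u' \<and> v = v' \<and> a12 = b12 \<and> a13 = b13 \<and> a14 = b14 \<and> a23 = b23 \<and> a24 = b24 \<and> a34 = b34"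
  by (metis m4_entries)

text \<open>The names count rows and columns from \<open>1\<close>. The position \<open>(1, 4)\<close> is missing because its elements
  are obtained as commutators.\<close>
datatype root = R12 | R13 | R23 | R24 | R34

primrec root_mat :: "root \<Rightarrow> 'a::comm_ring_1 \<Rightarrow> 'a mat" where
  "root_mat R12 r = m4 1 1 r 0 0 0 0 0"
| "root_mat R13 r = m4 1 1 0 r 0 0 0 0"
| "root_mat R23 r = m4 1 1 0 0 0 r 0 0"
| "root_mat R24 r = m4 1 1 0 0 0 0 r 0"
| "root_mat R34 r = m4 1 1 0 0 0 0 0 r"

definition diag4 :: "'a \<Rightarrow> 'a \<Rightarrow> 'a::comm_ring_1 mat" where
  "diag4 u v = m4 u v 0 0 0 0 0 0"

definition e14 :: "'a::comm_ring_1 \<Rightarrow> 'a mat" where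
  "e14 r = m4 1 1 0 0 r 0 0 0"

text \<open>The factor by which conjugation by \<open>diag(1, u, v, 1)\<close> multiplies the entry at the given position.\<close>
primrec weight :: "root \<Rightarrow> 'a \<Rightarrow> 'a \<Rightarrow> 'a::field" where
  "weight R12 u v = inverse u"
| "weight R13 u v = inverse v"
| "weight R23 u v = u * inverse v"
| "weight R24 u v = u"
| "weight R34 u v = v"

lemma weight_mult: "weight \<rho> (u * u') (v * v') = weight \<rho> u v * weight \<rho> u' v'"
  by (cases \<rho>) (simp_all add: field_simps)

lemma diag4_root_mat:
  "u \<noteq> 0 \<Longrightarrow> v \<noteq> 0 \<Longrightarrow> diag4 u v * root_mat \<rho> r = root_mat \<rho> (weight \<rho> u v * r) * diag4 u v"
  by (cases \<rho>) (simp_all add: diag4_def m4_mult m4_eq_iff)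

lemma diag4_mult: "diag4 u v * diag4 u' v' = diag4 (u * u') (v * v')"
  by (simp add: diag4_def m4_mult)

lemma root_mat_add: "root_mat \<rho> r * root_mat \<rho> r' = root_mat \<rho> (r + r')"
  by (cases \<rho>) (simp_all add: m4_mult m4_eq_iff add.commute)

section \<open>Generators of \<open>A\<^sub>4\<close>\<close>

definition torus_letters :: "'k::field poly fract mat set" where
  "torus_letters = {diag4 (scalar c) (scalar d) | c d. c \<noteq> 0 \<and> d \<noteq> 0}
     \<union> {diag4 \<kappa> 1 | \<kappa>. \<kappa> \<in> unit_gens} \<union> {diag4 1 \<kappa> | \<kappa>. \<kappa> \<in> unit_gens}"

definition letters :: "'k::field poly fract mat set" where
  "letters = torus_letters \<union> {root_mat \<rho> (scalar c) | \<rho> c. True}"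

definition mprod :: "'k::field poly fract mat list \<Rightarrow> 'k poly fract mat" where
  "mprod ws = foldr (*) ws (1\<^sub>m 4)"

lemma mprod_simps [simp]:
  "mprod [] = 1\<^sub>m 4" "mprod (a # ws) = a * mprod ws"
  by (simp_all add: mprod_def)

definition gconj :: "'g::group_add \<Rightarrow> 'g \<Rightarrow> 'g" where
  "gconj g x = g + x + - g"

lemmas group_norm = add.assoc minus_add minus_minus add_minus_cancel minus_add_cancel
  left_minus right_minus add_0_left add_0_right minus_zero

lemma gconj_add: "gconj g (x + y) = gconj g x + gconj g y"
  by (simp only: gconj_def group_norm)

lemma gconj_minus: "gconj g (- x) = - gconj g x"
  by (simp only: gconj_def group_norm)

lemma gconj_gconj: "gconj g (gconj h x) = gconj (g + h) x"
  by (simp only: gconj_def group_norm)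

lemma gconj_0 [simp]: "gconj 0 x = x" "gconj g 0 = 0"
  by (simp_all add: gconj_def)

lemma gconj_commutes: "commutes x y \<Longrightarrow> commutes (gconj g x) (gconj g y)"
  unfolding commutes_def by (metis gconj_add)

lemma gconj_eq_iff_commutes: "gconj g x = x \<longleftrightarrow> commutes g x"
proof -
  have "g + x + - g = x \<longleftrightarrow> g + x + - g + g = x + g" by (simp only: add_right_cancel)
  then show ?thesis by (simp only: gconj_def commutes_def group_norm)
qed

text \<open>Integer multiples in a group that need not be commutative.\<close>
definition zpow :: "int \<Rightarrow> 'g::group_add \<Rightarrow> 'g" where
  "zpow a g = (if a \<ge> 0 then ((+) g ^^ nat a) 0 else ((+) (- g) ^^ nat (- a)) 0)"

lemma zpow_succ: "g + zpow a g = zpow (a + 1) g"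
proof (cases "a \<ge> 0")
  case True
  then have "nat (a + 1) = Suc (nat a)" by simp
  with True show ?thesis by (simp add: zpow_def)
next
  case False
  then have "nat (- a) = Suc (nat (- (a + 1)))" by simp
  with False show ?thesis by (auto simp: zpow_def)
qed

lemma zpow_pred: "- g + zpow a g = zpow (a - 1) g"
  using zpow_succ[of g "a - 1"] by (metis diff_add_cancel minus_add_cancel)

lemma zpow_0 [simp]: "zpow 0 g = 0"
  by (simp add: zpow_def)

lemma commutes_zpow: "commutes h g \<Longrightarrow> commutes h (zpow a g)"
proof -
  assume h: "commutes h g"
  have "commutes h (((+) g ^^ n) 0)" "commutes h (((+) (- g) ^^ n) 0)" for n
    by (induction n) (simp_all add: h commutes_add)
  then show ?thesis by (simp add: zpow_def)
qed

text \<open>A diagonal matrix that acts by \<open>\<kappa>\<close> on the given root.\<close>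
primrec unit_root :: "root \<Rightarrow> 'a \<Rightarrow> 'a::field mat" where
  "unit_root R12 \<kappa> = diag4 (inverse \<kappa>) 1"
| "unit_root R13 \<kappa> = diag4 1 (inverse \<kappa>)"
| "unit_root R23 \<kappa> = diag4 \<kappa> 1"
| "unit_root R24 \<kappa> = diag4 \<kappa> 1"
| "unit_root R34 \<kappa> = diag4 1 \<kappa>"

lemma unit_root_root_mat: "\<kappa> \<noteq> 0 \<Longrightarrow> unit_root \<rho> \<kappa> * root_mat \<rho> r = root_mat \<rho> (\<kappa> * r) * unit_root \<rho> \<kappa>"
  by (cases \<rho>) (simp_all add: diag4_def m4_mult m4_eq_iff)

lemma unit_root_mult: "unit_root \<rho> \<kappa> * unit_root \<rho> \<kappa>' = unit_root \<rho> (\<kappa> * \<kappa>')"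
  by (cases \<rho>) (simp_all add: diag4_mult)

lemma unit_root_1: "unit_root \<rho> 1 = 1\<^sub>m 4"
  by (cases \<rho>) (simp_all add: diag4_def one_mat_4)

lemma unit_root_in: "\<kappa> \<in> unit_gens \<Longrightarrow> unit_root \<rho> \<kappa> \<in> torus_letters"
  by (cases \<rho>) (auto simp: torus_letters_def)

lemma torus_letters_commute: "d \<in> torus_letters \<Longrightarrow> d' \<in> torus_letters \<Longrightarrow> d * d' = d' * d"
  unfolding torus_letters_def by (auto simp: diag4_mult mult.commute)

lemma root_mat_carrier [simp]: "root_mat \<rho> r \<in> carrier_mat 4 4"
  by (cases \<rho>) simp_all

lemma diag4_carrier [simp]: "diag4 u v \<in> carrier_mat 4 4"
  by (simp add: diag4_def)

lemma unit_root_carrier [simp]: "unit_root \<rho> \<kappa> \<in> carrier_mat 4 4"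
  by (cases \<rho>) simp_all

lemma letters_carrier: "w \<in> letters \<Longrightarrow> w \<in> carrier_mat 4 4"
  by (auto simp: letters_def torus_letters_def)

lemma mult_1_mat_4 [simp]:
  fixes A :: "'a::comm_ring_1 mat"
  assumes "A \<in> carrier_mat 4 4" shows "A * 1\<^sub>m 4 = A" "1\<^sub>m 4 * A = A"
  using assms by (auto intro: right_mult_one_mat left_mult_one_mat)

lemma mult_carrier_4 [simp]: "A \<in> carrier_mat 4 4 \<Longrightarrow> B \<in> carrier_mat 4 4 \<Longrightarrow> A * B \<in> carrier_mat 4 4"
  by (rule mult_carrier_mat)

lemma unit_root_conj_mat:
  assumes "\<kappa> \<noteq> 0" "B \<in> carrier_mat 4 4"
  shows "unit_root \<rho> \<kappa> * (root_mat \<rho> r * (unit_root \<rho> (inverse \<kappa>) * B)) = root_mat \<rho> (\<kappa> * r) * B"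
proof -
  have "unit_root \<rho> \<kappa> * (root_mat \<rho> r * (unit_root \<rho> (inverse \<kappa>) * B))
      = ((unit_root \<rho> \<kappa> * root_mat \<rho> r) * unit_root \<rho> (inverse \<kappa>)) * B"
    using assms by (simp add: assoc_mult_mat[of _ 4 4 _ 4 _ 4])
  also have "\<dots> = root_mat \<rho> (\<kappa> * r) * (unit_root \<rho> \<kappa> * unit_root \<rho> (inverse \<kappa>)) * B"
    using assms by (simp add: unit_root_root_mat assoc_mult_mat[of _ 4 4 _ 4 _ 4])
  also have "\<dots> = root_mat \<rho> (\<kappa> * r) * B" using assms by (simp add: unit_root_mult unit_root_1)
  finally show ?thesis .
qed

lemma unit_root_conj_mat':
  "\<kappa> \<noteq> 0 \<Longrightarrow> unit_root \<rho> \<kappa> * (root_mat \<rho> r * unit_root \<rho> (inverse \<kappa>)) = root_mat \<rho> (\<kappa> * r)"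
  using unit_root_conj_mat[of \<kappa> "1\<^sub>m 4" \<rho> r] by simp

section \<open>Groups in which the short relations hold\<close>

text \<open>An assignment of group elements to the generators of \<open>A\<^sub>4\<close> that respects all relations between words of
  length at most four. The purpose of the following sections is to show that it respects all relations.\<close>
locale short_relations =
  fixes F :: "'k::field poly fract mat \<Rightarrow> 'g::group_add"
  assumes rel: "set us \<subseteq> letters \<Longrightarrow> set vs \<subseteq> letters \<Longrightarrow> length us \<le> 4 \<Longrightarrow> length vs \<le> 4
    \<Longrightarrow> mprod us = mprod vs \<Longrightarrow> sum_list (map F us) = sum_list (map F vs)"
begin

definition e :: "root \<Rightarrow> 'k \<Rightarrow> 'g" where "e \<rho> c = F (root_mat \<rho> (scalar c))"

lemma root_mat_letter [simp]: "root_mat \<rho> (scalar c) \<in> letters"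
  by (auto simp: letters_def)

lemma torus_letter: "d \<in> torus_letters \<Longrightarrow> d \<in> letters"
  by (simp add: letters_def)

lemma unit_root_letter [simp]: "\<kappa> \<in> unit_gens \<Longrightarrow> unit_root \<rho> \<kappa> \<in> letters"
  by (intro torus_letter unit_root_in)

lemma F_torus_commutes: "d \<in> torus_letters \<Longrightarrow> d' \<in> torus_letters \<Longrightarrow> commutes (F d) (F d')"
  using rel[of "[d, d']" "[d', d]"] torus_letters_commute[of d d']
  by (simp add: commutes_def torus_letter letters_carrier)

lemma F_inverse:
  assumes "d \<in> letters" "d' \<in> letters" "d * d' = 1\<^sub>m 4" shows "F d' = - F d"
proof -
  have "F d + F d' = 0" using rel[of "[d, d']" "[]"] assms by (simp add: letters_carrier)
  then show ?thesis by (rule minus_unique[symmetric])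
qed

lemma e_add: "e \<rho> (c + d) = e \<rho> c + e \<rho> d"
proof -
  have "mprod [root_mat \<rho> (scalar (c + d))] = mprod [root_mat \<rho> (scalar c), root_mat \<rho> (scalar d)]"
    by (simp only: mprod_simps mult_1_mat_4 root_mat_carrier root_mat_add scalar_add)
  from rel[OF _ _ _ _ this] show ?thesis by (simp add: e_def)
qed

definition unit_conj :: "root \<Rightarrow> 'k poly fract \<Rightarrow> 'g \<Rightarrow> 'g" where
  "unit_conj \<rho> \<kappa> = gconj (F (unit_root \<rho> \<kappa>))"

lemma F_unit_root_inverse:
  assumes "\<kappa> \<in> unit_gens" shows "F (unit_root \<rho> (inverse \<kappa>)) = - F (unit_root \<rho> \<kappa>)"
proof (rule F_inverse)
  show "unit_root \<rho> \<kappa> * unit_root \<rho> (inverse \<kappa>) = 1\<^sub>m 4"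
    using assms by (auto simp: unit_root_mult unit_root_1)
qed (use assms in \<open>auto\<close>)

lemma unit_conj_inverse [simp]:
  assumes "\<kappa> \<in> unit_gens"
  shows "unit_conj \<rho> (inverse \<kappa>) (unit_conj \<rho> \<kappa> x) = x" "unit_conj \<rho> \<kappa> (unit_conj \<rho> (inverse \<kappa>) x) = x"
  using F_unit_root_inverse[OF assms, of \<rho>] by (simp_all add: unit_conj_def gconj_gconj)

lemma gconj_torus_commute:
  "d \<in> torus_letters \<Longrightarrow> d' \<in> torus_letters \<Longrightarrow> gconj (F d) (gconj (F d') x) = gconj (F d') (gconj (F d) x)"
  using F_torus_commutes[of d d'] by (simp add: gconj_gconj commutes_def)

text \<open>Multiplication by \<open>t - 1\<close> and by \<open>t\<close> is realised by conjugation, so that \<open>1 + (t - 1) = t\<close>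
  becomes a relation between words of length four and three.\<close>
lemma e_one_plus: "e \<rho> c + unit_conj \<rho> ss (e \<rho> c) = unit_conj \<rho> tt (e \<rho> c)"
proof -
  let ?e = "root_mat \<rho> (scalar c)"
  have "F ?e + (F (unit_root \<rho> ss) + (F ?e + F (unit_root \<rho> (inverse ss)))) =
     F (unit_root \<rho> tt) + (F ?e + F (unit_root \<rho> (inverse tt)))"
  proof -
    have 1: "root_mat \<rho> (scalar c) * root_mat \<rho> (ss * scalar c) = root_mat \<rho> (tt * scalar c)"
      unfolding root_mat_add one_plus_ss[symmetric] by (simp add: distrib_right)
    have "mprod [?e, unit_root \<rho> ss, ?e, unit_root \<rho> (inverse ss)] =
        mprod [unit_root \<rho> tt, ?e, unit_root \<rho> (inverse tt)]"
      by (simp add: unit_root_conj_mat' 1)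
    from rel[OF _ _ _ _ this] show ?thesis by (simp add: add.assoc)
  qed
  then show ?thesis unfolding e_def unit_conj_def gconj_def
    by (simp add: F_unit_root_inverse add.assoc del: add_uminus_conv_diff)
qed

end

context short_relations
begin

lemma e_comm_unit_conj: "e \<rho> c + unit_conj \<rho> tt (e \<rho> d) = unit_conj \<rho> tt (e \<rho> d) + e \<rho> c"
proof -
  let ?c = "root_mat \<rho> (scalar c)" and ?d = "root_mat \<rho> (scalar d)"
  have "?c * root_mat \<rho> (tt * scalar d) = root_mat \<rho> (tt * scalar d) * ?c"
    unfolding root_mat_add by (simp only: add.commute)
  then have "mprod [?c, unit_root \<rho> tt, ?d, unit_root \<rho> (inverse tt)] =
      mprod [unit_root \<rho> tt, ?d, unit_root \<rho> (inverse tt), ?c]"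
    by (simp add: unit_root_conj_mat unit_root_conj_mat')
  from rel[OF _ _ _ _ this] show ?thesis
    unfolding e_def unit_conj_def gconj_def
    by (simp add: F_unit_root_inverse add.assoc del: add_uminus_conv_diff)
qed

lemma laurent_module_root:
  "laurent_module (unit_conj \<rho> tt) (unit_conj \<rho> ss) (unit_conj \<rho> (inverse tt)) (unit_conj \<rho> (inverse ss)) (e \<rho>)"
proof
  show "unit_conj \<rho> tt (unit_conj \<rho> ss x) = unit_conj \<rho> ss (unit_conj \<rho> tt x)" for x
    unfolding unit_conj_def by (intro gconj_torus_commute unit_root_in) auto
qed (simp_all add: e_add e_one_plus e_comm_unit_conj, simp_all add: unit_conj_def gconj_add)

text \<open>The lift of the root subgroup to the group in which the relations hold.\<close>
definition root_el :: "root \<Rightarrow> 'k poly fract \<Rightarrow> 'g" where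
  "root_el \<rho> = laurent_module.ext (unit_conj \<rho> tt) (unit_conj \<rho> (inverse tt)) (unit_conj \<rho> (inverse ss)) (e \<rho>)"

lemma root_el_scalar: "root_el \<rho> (scalar c) = e \<rho> c"
  unfolding root_el_def by (rule laurent_module.ext_scalar[OF laurent_module_root])

lemma root_el_add: "r \<in> laurent_ring \<Longrightarrow> r' \<in> laurent_ring \<Longrightarrow> root_el \<rho> (r + r') = root_el \<rho> r + root_el \<rho> r'"
  unfolding root_el_def by (rule laurent_module.ext_add[OF laurent_module_root])

lemma root_el_unit: "\<kappa> \<in> unit_gens \<Longrightarrow> r \<in> laurent_ring \<Longrightarrow> root_el \<rho> (\<kappa> * r) = unit_conj \<rho> \<kappa> (root_el \<rho> r)"
  using laurent_module.ext_t[OF laurent_module_root, of r \<rho>]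
    laurent_module.ext_s[OF laurent_module_root, of r \<rho>]
    laurent_module.ext_inverse_t[OF laurent_module_root, of r \<rho>]
    laurent_module.ext_inverse_s[OF laurent_module_root, of r \<rho>]
  unfolding root_el_def by blast

lemma root_el_0 [simp]: "root_el \<rho> 0 = 0"
proof -
  have "e \<rho> 0 = 0" using e_add[of \<rho> 0 0] by (metis add.right_neutral add_left_cancel)
  then show ?thesis using root_el_scalar[of \<rho> 0] by simp
qed

lemma torus_letter_inverse:
  assumes "diag4 u v \<in> (torus_letters :: 'k poly fract mat set)"
  shows "u \<noteq> 0" "v \<noteq> 0" "diag4 (inverse u) (inverse v) \<in> torus_letters"
proof -
  have eq: "diag4 a b = diag4 a' b' \<longleftrightarrow> a = a' \<and> b = b'" for a b a' b' :: "'k poly fract"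
    by (simp add: diag4_def m4_eq_iff)
  from assms consider c d where "u = scalar c" "v = scalar d" "c \<noteq> 0" "d \<noteq> 0"
    | "u \<in> unit_gens" "v = 1" | "u = 1" "v \<in> unit_gens"
    unfolding torus_letters_def by (auto simp: eq)
  then show "u \<noteq> 0" "v \<noteq> 0" "diag4 (inverse u) (inverse v) \<in> torus_letters"
    by (cases; auto simp: torus_letters_def eq scalar_inverse; metis nonzero_imp_inverse_nonzero)+
qed

lemma weight_torus_letter:
  assumes "diag4 u v \<in> (torus_letters :: 'k poly fract mat set)"
  shows "(\<exists>a. a \<noteq> 0 \<and> weight \<rho> u v = scalar a) \<or> weight \<rho> u v \<in> unit_gens"
proof -
  have one: "\<exists>a. a \<noteq> 0 \<and> 1 = scalar (a :: 'k)" by (rule exI[of _ 1]) simp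
  have eq: "diag4 a b = diag4 a' b' \<longleftrightarrow> a = a' \<and> b = b'" for a b a' b' :: "'k poly fract"
    by (simp add: diag4_def m4_eq_iff)
  from assms consider c d where "u = scalar c" "v = scalar d" "c \<noteq> 0" "d \<noteq> 0"
    | "u \<in> unit_gens" "v = 1" | "u = 1" "v \<in> unit_gens"
    unfolding torus_letters_def by (auto simp: eq)
  then show ?thesis
  proof cases
    case (1 c d)
    let ?a = "case \<rho> of R12 \<Rightarrow> inverse c | R13 \<Rightarrow> inverse d | R23 \<Rightarrow> c * inverse d | R24 \<Rightarrow> c | R34 \<Rightarrow> d"
    have "weight \<rho> u v = scalar ?a"
      unfolding 1(1,2)
      by (cases \<rho>) (simp_all only: weight.simps root.case scalar_inverse[OF 1(3)] scalar_inverse[OF 1(4)] scalar_mult)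
    moreover have "?a \<noteq> 0" using 1(3,4) by (cases \<rho>) simp_all
    ultimately show ?thesis by blast
  next
    case 2
    then show ?thesis using one by (cases \<rho>) auto
  next
    case 3
    then show ?thesis using one by (cases \<rho>) auto
  qed
qed

lemma weight_nonzero: "u \<noteq> 0 \<Longrightarrow> v \<noteq> 0 \<Longrightarrow> weight \<rho> u v \<noteq> 0"
  by (cases \<rho>) auto

lemma torus_action_scalar:
  assumes d: "diag4 u v \<in> torus_letters"
  shows "gconj (F (diag4 u v)) (e \<rho> c) = root_el \<rho> (weight \<rho> u v * scalar c)"
proof -
  let ?d = "diag4 u v" and ?c = "root_mat \<rho> (scalar c)"
  note nz = torus_letter_inverse(1,2)[OF d]
  consider a where "weight \<rho> u v = scalar a" | "weight \<rho> u v \<in> unit_gens"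
    using weight_torus_letter[OF d] by blast
  then show ?thesis
  proof cases
    case (1 a)
    have "mprod [?d, ?c] = mprod [root_mat \<rho> (scalar (a * c)), ?d]"
      by (simp only: mprod_simps mult_1_mat_4 root_mat_carrier diag4_carrier diag4_root_mat[OF nz] 1 scalar_mult)
    from rel[OF _ _ _ _ this] have "F ?d + e \<rho> c = e \<rho> (a * c) + F ?d"
      using d by (simp add: torus_letter e_def)
    then have "gconj (F ?d) (e \<rho> c) = e \<rho> (a * c)"
      by (simp add: gconj_def group_norm del: add_uminus_conv_diff)
    then show ?thesis unfolding 1 scalar_mult root_el_scalar .
  next
    case 2
    let ?w = "weight \<rho> u v" and ?d' = "diag4 (inverse u) (inverse v)"
    have dd': "?d * ?d' = 1\<^sub>m 4" using nz by (simp add: diag4_mult) (simp add: diag4_def one_mat_4)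
    have "?d * (?c * ?d') = (?d * ?c) * ?d'" by (simp add: assoc_mult_mat[of _ 4 4 _ 4 _ 4])
    also have "\<dots> = root_mat \<rho> (?w * scalar c) * (?d * ?d')"
      using nz by (simp add: diag4_root_mat assoc_mult_mat[of _ 4 4 _ 4 _ 4])
    also note dd'
    finally have 1: "?d * (?c * ?d') = root_mat \<rho> (?w * scalar c)" by simp
    have w0: "?w \<noteq> 0" using nz by (rule weight_nonzero)
    have "mprod [?d, ?c, ?d'] = mprod [unit_root \<rho> ?w, ?c, unit_root \<rho> (inverse ?w)]"
      using unit_root_conj_mat'[of ?w \<rho> "scalar c"] w0 1 by simp
    moreover have "F ?d' = - F ?d"
      by (rule F_inverse[OF torus_letter[OF d] torus_letter[OF torus_letter_inverse(3)[OF d]] dd'])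
    moreover have "inverse ?w \<in> unit_gens" using 2 by auto
    ultimately have "F ?d + (F ?c + - F ?d) = F (unit_root \<rho> ?w) + (F ?c + - F (unit_root \<rho> ?w))"
      using rel[of "[?d, ?c, ?d']" "[unit_root \<rho> ?w, ?c, unit_root \<rho> (inverse ?w)]"] 2 d
        torus_letter_inverse(3)[OF d] F_unit_root_inverse[OF 2, of \<rho>]
      by (simp add: torus_letter del: add_uminus_conv_diff insert_iff)
    then have "gconj (F ?d) (e \<rho> c) = unit_conj \<rho> ?w (e \<rho> c)"
      by (simp only: gconj_def unit_conj_def e_def add.assoc)
    also have "\<dots> = root_el \<rho> (?w * scalar c)" using root_el_unit[OF 2, of "scalar c" \<rho>] by (simp add: root_el_scalar)
    finally show ?thesis .
  qed
qed

lemma unit_gens_in_laurent_ring [simp]: "\<kappa> \<in> unit_gens \<Longrightarrow> \<kappa> \<in> laurent_ring"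
  by auto

lemma weight_in_laurent_ring:
  "diag4 u v \<in> (torus_letters :: 'k poly fract mat set) \<Longrightarrow> weight \<rho> u v \<in> laurent_ring"
  by (metis weight_torus_letter to_fract_in_laurent_ring unit_gens_in_laurent_ring)

text \<open>Conjugations by lifts of diagonal matrices commute with each other, hence with the two
  conjugations from which \<open>root_el\<close> is built. This leaves the case of constants.\<close>
lemma torus_action:
  assumes d: "diag4 u v \<in> torus_letters" and "r \<in> laurent_ring"
  shows "gconj (F (diag4 u v)) (root_el \<rho> r) = root_el \<rho> (weight \<rho> u v * r)"
  using assms(2)
proof (induction rule: laurent_ring_induct)
  case (scalar c)
  show ?case using torus_action_scalar[OF d] by (simp add: root_el_scalar)
next
  case (add r r')
  then show ?case using weight_in_laurent_ring[OF d] by (simp add: root_el_add gconj_add distrib_left)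
next
  case (unit \<kappa> r)
  note w = weight_in_laurent_ring[OF d, of \<rho>]
  have "gconj (F (diag4 u v)) (unit_conj \<rho> \<kappa> (root_el \<rho> r)) = unit_conj \<rho> \<kappa> (gconj (F (diag4 u v)) (root_el \<rho> r))"
    unfolding unit_conj_def by (rule gconj_torus_commute[OF d unit_root_in[OF unit(1)]])
  also have "\<dots> = root_el \<rho> (\<kappa> * (weight \<rho> u v * r))" using unit w by (simp only: root_el_unit mult_in_laurent_ring)
  finally show ?case using unit by (simp only: root_el_unit mult.left_commute)
qed

text \<open>The element \<open>\<delta>\<close> behaves like a lift of \<open>diag(1, u, v, 1)\<close>. Sums of two letters occur here as well, since
  a letter other than a constant changes only one of the two diagonal entries.\<close>
definition acts :: "'g \<Rightarrow> 'k poly fract \<Rightarrow> 'k poly fract \<Rightarrow> bool" where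
  "acts \<delta> u v \<longleftrightarrow> (\<forall>\<rho>. \<forall>r\<in>laurent_ring. gconj \<delta> (root_el \<rho> r) = root_el \<rho> (weight \<rho> u v * r))"

lemma ex_acts:
  assumes u: "u \<in> insert 1 unit_gens" and v: "v \<in> insert 1 unit_gens" shows "\<exists>\<delta>. acts \<delta> u v"
proof -
  have diag_u: "diag4 u 1 \<in> torus_letters" and diag_v: "diag4 1 v \<in> torus_letters"
  proof -
    have "diag4 1 1 \<in> (torus_letters :: 'k poly fract mat set)"
      unfolding torus_letters_def using scalar_1 by (metis (mono_tags, lifting) UnI1 mem_Collect_eq one_neq_zero)
    then show "diag4 u 1 \<in> torus_letters" "diag4 1 v \<in> torus_letters"
      using u v by (auto simp: torus_letters_def)
  qed
  have "gconj (F (diag4 u 1) + F (diag4 1 v)) (root_el \<rho> r) = root_el \<rho> (weight \<rho> u v * r)"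
    if "r \<in> laurent_ring" for \<rho> r
  proof -
    have "gconj (F (diag4 u 1) + F (diag4 1 v)) (root_el \<rho> r) = root_el \<rho> (weight \<rho> u 1 * (weight \<rho> 1 v * r))"
      using that by (simp only: gconj_gconj[symmetric] torus_action[OF diag_u] torus_action[OF diag_v]
        mult_in_laurent_ring weight_in_laurent_ring[OF diag_v])
    then show ?thesis using weight_mult[of \<rho> u 1 1 v] by (simp add: mult.assoc)
  qed
  then show ?thesis unfolding acts_def by blast
qed

text \<open>Diagonal matrices can move either root by a generating unit while fixing the other one. Among the pairs of
  distinct roots this fails for \<open>(12, 24)\<close> and \<open>(13, 34)\<close>, whose weights are inverse to each other.\<close>
definition independent :: "root \<Rightarrow> root \<Rightarrow> bool" where
  "independent \<rho> \<sigma> \<longleftrightarrow> (\<forall>\<kappa> \<in> (unit_gens :: 'k poly fract set).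
     (\<exists>u \<in> insert 1 unit_gens. \<exists>v \<in> insert 1 unit_gens. weight \<rho> u v = \<kappa> \<and> weight \<sigma> u v = 1) \<and>
     (\<exists>u \<in> insert 1 unit_gens. \<exists>v \<in> insert 1 unit_gens. weight \<rho> u v = 1 \<and> weight \<sigma> u v = \<kappa>))"

lemma independent_acts:
  assumes "independent \<rho> \<sigma>" "\<kappa> \<in> unit_gens"
  shows "\<exists>\<delta> u v. acts \<delta> u v \<and> u \<noteq> 0 \<and> v \<noteq> 0 \<and> weight \<rho> u v = \<kappa> \<and> weight \<sigma> u v = 1"
    and "\<exists>\<delta> u v. acts \<delta> u v \<and> u \<noteq> 0 \<and> v \<noteq> 0 \<and> weight \<rho> u v = 1 \<and> weight \<sigma> u v = \<kappa>"
proof -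
  have "u \<noteq> 0" if "u \<in> insert 1 unit_gens" for u :: "'k poly fract" using that by auto
  then show "\<exists>\<delta> u v. acts \<delta> u v \<and> u \<noteq> 0 \<and> v \<noteq> 0 \<and> weight \<rho> u v = \<kappa> \<and> weight \<sigma> u v = 1"
    and "\<exists>\<delta> u v. acts \<delta> u v \<and> u \<noteq> 0 \<and> v \<noteq> 0 \<and> weight \<rho> u v = 1 \<and> weight \<sigma> u v = \<kappa>"
    using assms ex_acts unfolding independent_def by meson+
qed

lemma independentI:
  assumes "\<And>\<kappa> :: 'k poly fract. \<kappa> \<noteq> 0 \<Longrightarrow>
     (\<exists>u \<in> {1, \<kappa>, inverse \<kappa>}. \<exists>v \<in> {1, \<kappa>, inverse \<kappa>}. weight \<rho> u v = \<kappa> \<and> weight \<sigma> u v = 1) \<and>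
     (\<exists>u \<in> {1, \<kappa>, inverse \<kappa>}. \<exists>v \<in> {1, \<kappa>, inverse \<kappa>}. weight \<rho> u v = 1 \<and> weight \<sigma> u v = \<kappa>)"
  shows "independent \<rho> \<sigma>"
  unfolding independent_def
proof
  fix \<kappa> :: "'k poly fract" assume \<kappa>: "\<kappa> \<in> unit_gens"
  then have nz: "\<kappa> \<noteq> 0" and "{1, \<kappa>, inverse \<kappa>} \<subseteq> insert 1 unit_gens" by auto
  then show "(\<exists>u \<in> insert 1 unit_gens. \<exists>v \<in> insert 1 unit_gens. weight \<rho> u v = \<kappa> \<and> weight \<sigma> u v = 1) \<and>
     (\<exists>u \<in> insert 1 unit_gens. \<exists>v \<in> insert 1 unit_gens. weight \<rho> u v = 1 \<and> weight \<sigma> u v = \<kappa>)"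
    using assms[OF nz] by (meson subsetD)
qed

lemma independent_roots:
  "independent R12 R34" "independent R12 R13" "independent R23 R13" "independent R23 R24"
  "independent R34 R24" "independent R13 R24" "independent R12 R23" "independent R23 R34"
  by (rule independentI; simp)+

text \<open>Independence allows an induction on the two ring elements one after the other.\<close>
lemma roots_commute:
  assumes ind: "independent \<rho> \<sigma>" and base: "\<And>c d. commutes (e \<rho> c) (e \<sigma> d)"
    and r: "r \<in> laurent_ring" and r': "r' \<in> laurent_ring"
  shows "commutes (root_el \<rho> r) (root_el \<sigma> r')"
proof -
  have 1: "commutes (root_el \<rho> r) (e \<sigma> d)" if "r \<in> laurent_ring" for r d
    using that
  proof (induction rule: laurent_ring_induct)
    case (scalar c)
    show ?case using base by (simp add: root_el_scalar)
  next
    case (add r r')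
    then show ?case by (simp add: root_el_add commutes_add commutes_sym)
  next
    case (unit \<kappa> r)
    obtain \<delta> u v where \<delta>: "acts \<delta> u v" "u \<noteq> 0" "v \<noteq> 0" "weight \<rho> u v = \<kappa>" "weight \<sigma> u v = 1"
      using independent_acts(1)[OF ind unit(1)] by blast
    from gconj_commutes[OF unit(3), of \<delta>] show ?case
      using \<delta> unit(2) unfolding acts_def root_el_scalar[symmetric] by simp
  qed
  show ?thesis using r'
  proof (induction rule: laurent_ring_induct)
    case (scalar c)
    show ?case using 1[OF r] by (simp add: root_el_scalar)
  next
    case (add r r')
    then show ?case by (simp add: root_el_add commutes_add)
  next
    case (unit \<kappa> r')
    obtain \<delta> u v where \<delta>: "acts \<delta> u v" "u \<noteq> 0" "v \<noteq> 0" "weight \<rho> u v = 1" "weight \<sigma> u v = \<kappa>"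
      using independent_acts(2)[OF ind unit(1)] by blast
    from gconj_commutes[OF unit(3), of \<delta>] show ?case
      using \<delta> unit(2) r unfolding acts_def by simp
  qed
qed

text \<open>The same double induction. Additivity in each variable holds because the commutator commutes with
  both root subgroups.\<close>
lemma roots_commutator:
  assumes ind: "independent \<rho> \<sigma>" and \<tau>: "\<And>u v :: 'k poly fract. u \<noteq> 0 \<Longrightarrow> v \<noteq> 0 \<Longrightarrow> weight \<tau> u v = weight \<rho> u v * weight \<sigma> u v"
    and base: "\<And>c d. e \<rho> c + e \<sigma> d = e \<tau> (c * d) + e \<sigma> d + e \<rho> c"
    and \<rho>\<tau>: "\<And>r r'. r \<in> laurent_ring \<Longrightarrow> r' \<in> laurent_ring \<Longrightarrow> commutes (root_el \<rho> r) (root_el \<tau> r')"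
    and \<sigma>\<tau>: "\<And>r r'. r \<in> laurent_ring \<Longrightarrow> r' \<in> laurent_ring \<Longrightarrow> commutes (root_el \<sigma> r) (root_el \<tau> r')"
    and r: "r \<in> laurent_ring" and r': "r' \<in> laurent_ring"
  shows "root_el \<rho> r + root_el \<sigma> r' = root_el \<tau> (r * r') + root_el \<sigma> r' + root_el \<rho> r"
proof -
  have 1: "root_el \<rho> r + root_el \<sigma> (scalar d) = root_el \<tau> (r * scalar d) + root_el \<sigma> (scalar d) + root_el \<rho> r" if "r \<in> laurent_ring" for r d
    using that
  proof (induction rule: laurent_ring_induct)
    case (scalar c)
    show ?case using base by (simp only: root_el_scalar scalar_mult)
  next
    case (add r r')
    let ?s = "root_el \<sigma> (scalar d)"
    have "root_el \<rho> r + (root_el \<rho> r' + ?s) = root_el \<rho> r + root_el \<tau> (r' * scalar d) + ?s + root_el \<rho> r'"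
      using add by (simp only: add.assoc)
    also have "\<dots> = root_el \<tau> (r' * scalar d) + (root_el \<rho> r + ?s) + root_el \<rho> r'"
      using \<rho>\<tau>[of r "r' * scalar d"] add unfolding commutes_def by (simp add: add.assoc)
    also have "\<dots> = (root_el \<tau> (r' * scalar d) + root_el \<tau> (r * scalar d)) + ?s + (root_el \<rho> r + root_el \<rho> r')"
      using add by (simp only: add.assoc)
    finally have *: "root_el \<rho> r + (root_el \<rho> r' + ?s) = \<dots>" .
    have "(r + r') * scalar d = r' * scalar d + r * scalar d" by (simp add: distrib_right)
    then have "root_el \<tau> ((r + r') * scalar d) = root_el \<tau> (r' * scalar d) + root_el \<tau> (r * scalar d)"
      using add by (simp only: root_el_add mult_in_laurent_ring to_fract_in_laurent_ring)
    then show ?case using * add by (simp only: root_el_add add.assoc)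
  next
    case (unit \<kappa> r)
    obtain \<delta> u v where \<delta>: "acts \<delta> u v" "u \<noteq> 0" "v \<noteq> 0" "weight \<rho> u v = \<kappa>" "weight \<sigma> u v = 1"
      using independent_acts(1)[OF ind unit(1)] by blast
    from arg_cong[OF unit(3), of "gconj \<delta>"] show ?case
      using \<delta> unit(2) unfolding acts_def gconj_add by (simp add: \<tau> mult.assoc)
  qed
  show ?thesis using r'
  proof (induction rule: laurent_ring_induct)
    case (scalar c)
    show ?case by (rule 1[OF r])
  next
    case (add s s')
    have "root_el \<rho> r + (root_el \<sigma> s + root_el \<sigma> s') = (root_el \<rho> r + root_el \<sigma> s) + root_el \<sigma> s'"
      by (simp only: add.assoc)
    also have "\<dots> = root_el \<tau> (r * s) + root_el \<sigma> s + (root_el \<rho> r + root_el \<sigma> s')"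
      unfolding add.IH(1) by (simp only: add.assoc)
    also have "\<dots> = root_el \<tau> (r * s) + (root_el \<sigma> s + root_el \<tau> (r * s')) + root_el \<sigma> s' + root_el \<rho> r"
      unfolding add.IH(2) by (simp only: add.assoc)
    also have "\<dots> = root_el \<tau> (r * s) + root_el \<tau> (r * s') + (root_el \<sigma> s + root_el \<sigma> s') + root_el \<rho> r"
      using \<sigma>\<tau>[of s "r * s'"] add r unfolding commutes_def by (simp add: add.assoc)
    finally show ?case using add r by (simp add: root_el_add distrib_left)
  next
    case (unit \<kappa> s)
    obtain \<delta> u v where \<delta>: "acts \<delta> u v" "u \<noteq> 0" "v \<noteq> 0" "weight \<rho> u v = 1" "weight \<sigma> u v = \<kappa>"
      using independent_acts(2)[OF ind unit(1)] by blast
    from arg_cong[OF unit(3), of "gconj \<delta>"] show ?case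
      using \<delta> unit(2) r unfolding acts_def gconj_add by (simp add: \<tau> mult.left_commute)
  qed
qed

end

section \<open>The corner entry and the normal form\<close>

definition gcomm :: "'g::group_add \<Rightarrow> 'g \<Rightarrow> 'g" where
  "gcomm a b = a + b + - a + - b"

lemma commutes_left: "commutes a b \<Longrightarrow> a + (b + z) = b + (a + z)"
  unfolding commutes_def by (metis add.assoc)

lemma gcomm_eqI: "a + b = q + b + a \<Longrightarrow> gcomm a b = q"
  by (simp add: gcomm_def group_norm del: add_uminus_conv_diff)

lemma gcomm_swap: "a + b = gcomm a b + b + a"
  by (simp add: gcomm_def group_norm del: add_uminus_conv_diff)

lemma commutes_gcomm: "commutes z a \<Longrightarrow> commutes z b \<Longrightarrow> commutes z (gcomm a b)"
  by (simp add: gcomm_def commutes_add del: add_uminus_conv_diff)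

lemma gconj_gcomm: "gconj g (gcomm a b) = gcomm (gconj g a) (gconj g b)"
  by (simp add: gcomm_def gconj_add gconj_minus del: add_uminus_conv_diff)

text \<open>The Hall-Witt identity for \<open>x\<close>, \<open>y\<close>, \<open>w\<close> in the case \<open>[x, w] = 1\<close>, where \<open>m = [x, y]\<close> and \<open>n = [y, w]\<close>. Centrality of
  the corner elements will be a consequence of it, so the two outer commutators enter as mere group elements.\<close>
lemma gcomm_gcomm:
  assumes XW: "commutes x w" and XY: "x + y = m + y + x" and YW: "y + w = n + w + y"
    and MN: "commutes m n" and NW: "commutes n w"
  shows "gcomm x n = gcomm m w"
proof (rule gcomm_eqI)
  have yx: "y + x = - m + (x + y)" by (simp add: XY add.assoc)
  have "x + n + w + y = x + (y + w)" by (simp add: YW add.assoc)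
  also have "\<dots> = m + y + (w + x)" using XW by (simp add: XY commutes_def add.assoc[symmetric]) (simp add: commutes_def add.assoc)
  also have "\<dots> = m + n + w + (y + x)" by (metis YW add.assoc)
  also have "\<dots> = n + m + w + - m + x + y" using MN unfolding yx commutes_def by (simp only: add.assoc)
  finally have "x + n + w = n + m + w + - m + x" by simp
  then have "x + n + w + - w = n + m + w + - m + (x + - w)" by (simp only: add.assoc)
  moreover have "x + - w = - w + x" using XW commutes_minus unfolding commutes_def by blast
  ultimately have "x + n = n + gcomm m w + x" by (simp only: gcomm_def group_norm)
  moreover have "commutes n (gcomm m w)" using MN NW by (simp add: commutes_gcomm commutes_sym)
  ultimately show "x + n = gcomm m w + n + x" by (simp add: commutes_def)
qed

context short_relations
begin

lemma e_commutes:
  assumes "\<And>r r' :: 'k poly fract. root_mat \<rho> r * root_mat \<sigma> r' = root_mat \<sigma> r' * root_mat \<rho> r"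
  shows "commutes (e \<rho> c) (e \<sigma> d)"
proof -
  have "mprod [root_mat \<rho> (scalar c), root_mat \<sigma> (scalar d)] = mprod [root_mat \<sigma> (scalar d), root_mat \<rho> (scalar c)]"
    by (simp add: assms)
  from rel[OF _ _ _ _ this] show ?thesis by (simp add: commutes_def e_def)
qed

lemma e_commutator:
  assumes "\<And>r r' :: 'k poly fract. root_mat \<rho> r * root_mat \<sigma> r' = root_mat \<tau> (r * r') * (root_mat \<sigma> r' * root_mat \<rho> r)"
  shows "e \<rho> c + e \<sigma> d = e \<tau> (c * d) + e \<sigma> d + e \<rho> c"
proof -
  have "mprod [root_mat \<rho> (scalar c), root_mat \<sigma> (scalar d)] =
      mprod [root_mat \<tau> (scalar (c * d)), root_mat \<sigma> (scalar d), root_mat \<rho> (scalar c)]"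
    by (simp only: mprod_simps assms mult_1_mat_4 root_mat_carrier scalar_mult)
  from rel[OF _ _ _ _ this] show ?thesis by (simp add: e_def add.assoc)
qed

lemma root_el_commutes:
  assumes r: "r \<in> laurent_ring" "r' \<in> laurent_ring"
  shows "commutes (root_el R12 r) (root_el R34 r')" "commutes (root_el R12 r) (root_el R13 r')" "commutes (root_el R23 r) (root_el R13 r')"
    "commutes (root_el R23 r) (root_el R24 r')" "commutes (root_el R34 r) (root_el R24 r')" "commutes (root_el R13 r) (root_el R24 r')"
  by (rule roots_commute[OF _ _ r]; (rule independent_roots e_commutes; simp add: m4_mult m4_eq_iff add.commute)?)+

lemma root_el_12_23:
  assumes r: "r \<in> laurent_ring" "r' \<in> laurent_ring"
  shows "root_el R12 r + root_el R23 r' = root_el R13 (r * r') + root_el R23 r' + root_el R12 r"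
proof (rule roots_commutator[OF independent_roots(7) _ _ root_el_commutes(2,3) r])
  show "e R12 c + e R23 d = e R13 (c * d) + e R23 d + e R12 c" for c d
    by (rule e_commutator) (simp add: m4_mult m4_eq_iff)
  show "weight R13 u v = weight R12 u v * weight R23 u v" if "u \<noteq> 0" "v \<noteq> 0" for u v :: "'k poly fract"
    using that by simp
qed

lemma root_el_23_34:
  assumes r: "r \<in> laurent_ring" "r' \<in> laurent_ring"
  shows "root_el R23 r + root_el R34 r' = root_el R24 (r * r') + root_el R34 r' + root_el R23 r"
proof (rule roots_commutator[OF independent_roots(8) _ _ root_el_commutes(4,5) r])
  show "e R23 c + e R34 d = e R24 (c * d) + e R34 d + e R23 c" for c d
    by (rule e_commutator) (simp add: m4_mult m4_eq_iff)
  show "weight R24 u v = weight R23 u v * weight R34 u v" if "u \<noteq> 0" "v \<noteq> 0" for u v :: "'k poly fract"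
    using that by simp
qed

definition x14 :: "'k poly fract \<Rightarrow> 'g" where "x14 r = gcomm (root_el R12 r) (root_el R24 1)"

text \<open>The corner is reached through \<open>(1, 2), (2, 4)\<close> and through \<open>(1, 3), (3, 4)\<close>. Comparing both ways moves the factor
  \<open>v\<close> from one argument to the other, which replaces the missing independence of the weights.\<close>
lemma gcomm_12_24_eq_gcomm_13_34:
  assumes "u \<in> laurent_ring" "v \<in> laurent_ring" "w \<in> laurent_ring"
  shows "gcomm (root_el R12 u) (root_el R24 (v * w)) = gcomm (root_el R13 (u * v)) (root_el R34 w)"
  using assms by (intro gcomm_gcomm[of _ _ "root_el R23 v"] root_el_commutes root_el_12_23 root_el_23_34 commutes_sym[OF root_el_commutes(5)] mult_in_laurent_ring)

lemma gcomm_12_24: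
  assumes "r \<in> laurent_ring" "w \<in> laurent_ring"
  shows "gcomm (root_el R12 r) (root_el R24 w) = x14 (r * w)"
  using gcomm_12_24_eq_gcomm_13_34[of r w 1] gcomm_12_24_eq_gcomm_13_34[of "r * w" 1 1] assms
  by (simp add: x14_def)

lemma gcomm_13_34:
  assumes "r \<in> laurent_ring" "w \<in> laurent_ring"
  shows "gcomm (root_el R13 r) (root_el R34 w) = x14 (r * w)"
  using gcomm_12_24_eq_gcomm_13_34[of r 1 w] gcomm_12_24[of r w] assms by simp

lemma x14_eq: "r \<in> laurent_ring \<Longrightarrow> x14 r = gcomm (root_el R13 r) (root_el R34 1)"
  using gcomm_13_34[of r 1] by simp

text \<open>Each of the four roots commutes with both arguments in one of the two commutator
  expressions for \<open>x14\<close>.\<close>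
lemma x14_central_aux:
  assumes r: "r \<in> laurent_ring" and s: "s \<in> laurent_ring"
  shows "commutes (root_el R12 s) (x14 r)" "commutes (root_el R13 s) (x14 r)" "commutes (root_el R24 s) (x14 r)"
    "commutes (root_el R34 s) (x14 r)"
proof -
  show "commutes (root_el R12 s) (x14 r)"
    unfolding x14_eq[OF r] by (intro commutes_gcomm root_el_commutes r s one_in_laurent_ring)
  show "commutes (root_el R13 s) (x14 r)"
    unfolding x14_def by (intro commutes_gcomm root_el_commutes commutes_sym[OF root_el_commutes(2)] r s one_in_laurent_ring)
  show "commutes (root_el R24 s) (x14 r)"
    unfolding x14_eq[OF r] by (intro commutes_gcomm commutes_sym[OF root_el_commutes(5)] commutes_sym[OF root_el_commutes(6)] r s one_in_laurent_ring)
  show "commutes (root_el R34 s) (x14 r)"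
    unfolding x14_def by (intro commutes_gcomm root_el_commutes commutes_sym[OF root_el_commutes(1)] r s one_in_laurent_ring)
qed

text \<open>The root \<open>(2, 3)\<close> fixes the second argument of the commutator and changes the first one by an element of
  the root \<open>(1, 3)\<close>, which commutes with both arguments and hence with \<open>x14\<close>.\<close>
lemma x14_commutes_x23:
  assumes r: "r \<in> laurent_ring" and s: "s \<in> laurent_ring"
  shows "commutes (root_el R23 s) (x14 r)"
proof -
  let ?m = "root_el R13 (r * s)" and ?X = "root_el R12 r" and ?N = "root_el R24 1"
  have "gconj (root_el R23 s) ?X = - ?m + ?X"
  proof -
    have "root_el R23 s + ?X = - ?m + (?X + root_el R23 s)" unfolding root_el_12_23[OF r s] by (simp only: group_norm)
    then show ?thesis unfolding gconj_def by (simp only: group_norm)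
  qed
  moreover have "gconj (root_el R23 s) ?N = ?N"
    unfolding gconj_eq_iff_commutes by (intro root_el_commutes s one_in_laurent_ring)
  ultimately have "gconj (root_el R23 s) (x14 r) = gcomm (- ?m + ?X) ?N"
    unfolding x14_def gconj_gcomm by simp
  also have "\<dots> = - ?m + (?X + ?N + - ?X) + (?m + - ?N)"
    unfolding gcomm_def by (simp only: group_norm)
  also have "?m + - ?N = - ?N + ?m"
    using commutes_minus[OF root_el_commutes(6)[of "r * s" 1]] r s unfolding commutes_def by simp
  also have "- ?m + (?X + ?N + - ?X) + (- ?N + ?m) = - ?m + (x14 r + ?m)"
    unfolding x14_def gcomm_def by (simp only: group_norm)
  also have "x14 r + ?m = ?m + x14 r"
    using x14_central_aux(2)[OF r, of "r * s"] r s unfolding commutes_def by simp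
  finally show ?thesis unfolding gconj_eq_iff_commutes[symmetric] by (simp only: group_norm)
qed

lemma x14_central:
  assumes "r \<in> laurent_ring" and "s \<in> laurent_ring"
  shows "commutes (root_el \<rho> s) (x14 r)"
  using assms by (cases \<rho>) (simp_all add: x14_central_aux x14_commutes_x23)

lemma x14_add:
  assumes r: "r \<in> laurent_ring" and s: "s \<in> laurent_ring"
  shows "x14 (r + s) = x14 r + x14 s"
proof -
  let ?N = "root_el R24 1"
  have "root_el R12 s + ?N = x14 s + (?N + root_el R12 s)" using gcomm_swap[of "root_el R12 s" ?N] by (simp only: x14_def add.assoc)
  then have "root_el R12 r + (root_el R12 s + ?N) = x14 s + (root_el R12 r + ?N) + root_el R12 s"
    using commutes_left[OF x14_central[OF s r, of R12]] by (simp only: add.assoc)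
  also have "root_el R12 r + ?N = x14 r + (?N + root_el R12 r)" using gcomm_swap[of "root_el R12 r" ?N] by (simp only: x14_def add.assoc)
  finally have "root_el R12 (r + s) + ?N = x14 s + x14 r + ?N + root_el R12 (r + s)"
    using r s by (simp only: root_el_add add.assoc)
  then have "x14 (r + s) = x14 s + x14 r" unfolding x14_def[of "r + s"] by (rule gcomm_eqI)
  moreover have "commutes (x14 s) (x14 r)"
    unfolding x14_def[of r] by (intro commutes_gcomm commutes_sym[OF x14_central[OF s]] r one_in_laurent_ring)
  ultimately show ?thesis by (simp add: commutes_def)
qed

lemma torus_action_x14:
  assumes d: "diag4 u v \<in> torus_letters" and r: "r \<in> laurent_ring"
  shows "gconj (F (diag4 u v)) (x14 r) = x14 r"
proof -
  note w = weight_in_laurent_ring[OF d, of R12] weight_in_laurent_ring[OF d, of R24]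
  have "gconj (F (diag4 u v)) (x14 r) = gcomm (root_el R12 (inverse u * r)) (root_el R24 (u * 1))"
    unfolding x14_def gconj_gcomm using torus_action[OF d r, of R12] torus_action[OF d one_in_laurent_ring, of R24]
    by simp
  also have "\<dots> = x14 (inverse u * r * (u * 1))" using w r by (intro gcomm_12_24) auto
  also have "inverse u * r * (u * 1) = r" using torus_letter_inverse(1)[OF d] by simp
  finally show ?thesis .
qed

text \<open>With this order of the factors, the product of the corresponding matrices has exactly the six arguments as its
  entries above the diagonal.\<close>
definition nf where
  "nf a12 a13 a14 a23 a24 a34 = root_el R34 a34 + (root_el R24 a24 + (root_el R23 a23 + (x14 a14 + (root_el R13 a13 + root_el R12 a12))))"

lemma x34_nf:
  assumes "b \<in> laurent_ring" "a34 \<in> laurent_ring"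
  shows "root_el R34 b + nf a12 a13 a14 a23 a24 a34 = nf a12 a13 a14 a23 a24 (b + a34)"
  using assms by (simp add: nf_def root_el_add add.assoc)

lemma x24_nf:
  assumes "b \<in> laurent_ring" "a34 \<in> laurent_ring" "a24 \<in> laurent_ring"
  shows "root_el R24 b + nf a12 a13 a14 a23 a24 a34 = nf a12 a13 a14 a23 (b + a24) a34"
  using assms commutes_left[OF commutes_sym[OF root_el_commutes(5)[of a34 b]]] by (simp add: nf_def root_el_add add.assoc)

lemma x23_nf:
  assumes b: "b \<in> laurent_ring" "a34 \<in> laurent_ring" "a24 \<in> laurent_ring" "a23 \<in> laurent_ring"
  shows "root_el R23 b + nf a12 a13 a14 a23 a24 a34 = nf a12 a13 a14 (b + a23) (b * a34 + a24) a34"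
proof -
  have 1: "root_el R23 b + (root_el R34 a34 + z) = root_el R24 (b * a34) + (root_el R34 a34 + (root_el R23 b + z))" for z
    by (simp only: add.assoc[symmetric] root_el_23_34[OF b(1,2)])
  have 2: "root_el R24 (b * a34) + (root_el R34 a34 + z) = root_el R34 a34 + (root_el R24 (b * a34) + z)" for z
    by (intro commutes_left commutes_sym[OF root_el_commutes(5)] b mult_in_laurent_ring)
  have 3: "root_el R23 b + (root_el R24 a24 + z) = root_el R24 a24 + (root_el R23 b + z)" for z
    by (intro commutes_left root_el_commutes b)
  show ?thesis unfolding nf_def 1 2 3 using b by (simp add: root_el_add add.assoc)
qed

lemma x14_nf:
  assumes b: "b \<in> laurent_ring" "a34 \<in> laurent_ring" "a24 \<in> laurent_ring" "a23 \<in> laurent_ring" "a14 \<in> laurent_ring"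
  shows "x14 b + nf a12 a13 a14 a23 a24 a34 = nf a12 a13 (b + a14) a23 a24 a34"
proof -
  have 1: "x14 b + (root_el \<rho> r + z) = root_el \<rho> r + (x14 b + z)" if "r \<in> laurent_ring" for \<rho> r z
    using that by (intro commutes_left commutes_sym[OF x14_central[OF b(1)]])
  show ?thesis using b by (simp add: nf_def 1 x14_add add.assoc)
qed

lemma x13_nf:
  assumes b: "b \<in> laurent_ring" "a34 \<in> laurent_ring" "a24 \<in> laurent_ring" "a23 \<in> laurent_ring"
    "a14 \<in> laurent_ring" "a13 \<in> laurent_ring"
  shows "root_el R13 b + nf a12 a13 a14 a23 a24 a34 = nf a12 (b + a13) (b * a34 + a14) a23 a24 a34"
proof -
  have 1: "root_el R13 b + (root_el R34 a34 + z) = x14 (b * a34) + (root_el R34 a34 + (root_el R13 b + z))" for z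
    by (simp only: add.assoc[symmetric] gcomm_13_34[OF b(1,2), symmetric] gcomm_swap[of "root_el R13 b" "root_el R34 a34", symmetric])
  have 2: "root_el R13 b + (root_el R24 a24 + z) = root_el R24 a24 + (root_el R13 b + z)" for z
    by (intro commutes_left root_el_commutes b)
  have 3: "root_el R13 b + (root_el R23 a23 + z) = root_el R23 a23 + (root_el R13 b + z)" for z
    by (intro commutes_left commutes_sym[OF root_el_commutes(3)] b)
  have 4: "root_el R13 b + (x14 a14 + z) = x14 a14 + (root_el R13 b + z)" for z
    by (intro commutes_left x14_central b)
  have "root_el R13 b + nf a12 a13 a14 a23 a24 a34 = x14 (b * a34) + nf a12 (b + a13) a14 a23 a24 a34"
    unfolding nf_def 1 2 3 4 using b by (simp add: root_el_add add.assoc)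
  then show ?thesis using b by (simp add: x14_nf)
qed

lemma x12_nf:
  assumes b: "b \<in> laurent_ring" "a34 \<in> laurent_ring" "a24 \<in> laurent_ring" "a23 \<in> laurent_ring"
    "a14 \<in> laurent_ring" "a13 \<in> laurent_ring" "a12 \<in> laurent_ring"
  shows "root_el R12 b + nf a12 a13 a14 a23 a24 a34 = nf (b + a12) (b * a23 + a13) (b * a24 + a14) a23 a24 a34"
proof -
  have 1: "root_el R12 b + (root_el R34 a34 + z) = root_el R34 a34 + (root_el R12 b + z)" for z
    by (intro commutes_left root_el_commutes b)
  have 2: "root_el R12 b + (root_el R24 a24 + z) = x14 (b * a24) + (root_el R24 a24 + (root_el R12 b + z))" for z
    by (simp only: add.assoc[symmetric] gcomm_12_24[OF b(1,3), symmetric] gcomm_swap[of "root_el R12 b" "root_el R24 a24", symmetric])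
  have 3: "root_el R12 b + (root_el R23 a23 + z) = root_el R13 (b * a23) + (root_el R23 a23 + (root_el R12 b + z))" for z
    by (simp only: add.assoc[symmetric] root_el_12_23[OF b(1,4)])
  have 4: "root_el R13 (b * a23) + (root_el R23 a23 + z) = root_el R23 a23 + (root_el R13 (b * a23) + z)" for z
    by (intro commutes_left commutes_sym[OF root_el_commutes(3)] b mult_in_laurent_ring)
  have 5: "root_el R12 b + (x14 a14 + z) = x14 a14 + (root_el R12 b + z)" for z
    by (intro commutes_left x14_central b)
  have 6: "root_el R13 (b * a23) + (x14 a14 + z) = x14 a14 + (root_el R13 (b * a23) + z)" for z
    by (intro commutes_left x14_central b mult_in_laurent_ring)
  have 7: "root_el R12 b + (root_el R13 a13 + z) = root_el R13 a13 + (root_el R12 b + z)" for z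
    by (intro commutes_left root_el_commutes b)
  have 8: "root_el R34 a34 + (x14 (b * a24) + z) = x14 (b * a24) + (root_el R34 a34 + z)" for z
    by (intro commutes_left x14_central b mult_in_laurent_ring)
  have "root_el R12 b + nf a12 a13 a14 a23 a24 a34 = x14 (b * a24) + nf (b + a12) (b * a23 + a13) a14 a23 a24 a34"
    unfolding nf_def 1 2 3 4 5 6 7 8 using b by (simp add: root_el_add add.assoc)
  then show ?thesis using b by (simp add: x14_nf)
qed

lemma torus_nf:
  assumes d: "diag4 p q \<in> torus_letters"
    and a: "a12 \<in> laurent_ring" "a13 \<in> laurent_ring" "a14 \<in> laurent_ring"
      "a23 \<in> laurent_ring" "a24 \<in> laurent_ring" "a34 \<in> laurent_ring"
  shows "F (diag4 p q) + nf a12 a13 a14 a23 a24 a34 =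
    nf (inverse p * a12) (inverse q * a13) a14 (p * inverse q * a23) (p * a24) (q * a34) + F (diag4 p q)"
proof -
  have "gconj (F (diag4 p q)) (nf a12 a13 a14 a23 a24 a34) =
      nf (weight R12 p q * a12) (weight R13 p q * a13) a14 (weight R23 p q * a23) (weight R24 p q * a24) (weight R34 p q * a34)"
    unfolding nf_def using a by (simp only: gconj_add torus_action[OF d] torus_action_x14[OF d])
  then have "F (diag4 p q) + nf a12 a13 a14 a23 a24 a34 =
      nf (weight R12 p q * a12) (weight R13 p q * a13) a14 (weight R23 p q * a23) (weight R24 p q * a24) (weight R34 p q * a34) + F (diag4 p q)"
    unfolding gconj_def by (metis add.assoc add.right_neutral left_minus)
  then show ?thesis by simp
qed

end

section \<open>The diagonal part and finite presentability\<close>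

definition unit_val :: "'k::field \<Rightarrow> int \<Rightarrow> int \<Rightarrow> 'k poly fract" where
  "unit_val c a b = scalar c * tt powi a * ss powi b"

lemma powi_split: "(z::'a::field) \<noteq> 0 \<Longrightarrow> z powi a = z ^ nat a / z ^ nat (- a)"
  by (cases "a \<ge> 0") (simp_all add: power_int_def field_simps)

lemma order_split:
  fixes c :: "'k::field" assumes "c \<noteq> 0"
  shows "order 0 ([:c:] * [:0, 1:] ^ m * [:-1, 1:] ^ n) = m" "order 1 ([:c:] * [:0, 1:] ^ m * [:-1, 1:] ^ n) = n"
proof -
  have nz: "[:c:] * [:0, 1:] ^ m * [:-1, 1:] ^ n \<noteq> 0" "[:c:] * [:0, 1:] ^ m \<noteq> 0" using assms by auto
  have 0: "order z [:c:] = 0" for z using assms by (intro order_0I) simp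
  have "order 0 ([:0, 1:] ^ m :: 'k poly) = m" "order 1 ([:-1, 1:] ^ n :: 'k poly) = n"
    using order_power_n_n[of "0 :: 'k" m] order_power_n_n[of "1 :: 'k" n] by simp_all
  moreover have "order 1 ([:0, 1:] ^ m :: 'k poly) = 0" "order 0 ([:-1, 1:] ^ n :: 'k poly) = 0"
    by (auto intro!: order_0I)
  ultimately show "order 0 ([:c:] * [:0, 1:] ^ m * [:-1, 1:] ^ n) = m" "order 1 ([:c:] * [:0, 1:] ^ m * [:-1, 1:] ^ n) = n"
    by (simp_all only: order_mult[OF nz(1)] order_mult[OF nz(2)] 0)
qed

text \<open>Comparison of the orders of vanishing at \<open>0\<close> and at \<open>1\<close>.\<close>
lemma unit_val_eq_1:
  fixes c :: "'k::field"
  assumes "c \<noteq> 0" and "unit_val c a b = 1" shows "c = 1 \<and> a = 0 \<and> b = 0"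
proof -
  have "scalar c * tt ^ nat a * ss ^ nat b = tt ^ nat (- a) * ss ^ nat (- b)"
    using assms(2) unfolding unit_val_def powi_split[OF tt_nonzero] powi_split[OF ss_nonzero]
    by (simp add: field_simps)
  then have "to_fract ([:c:] * [:0, 1:] ^ nat a * [:-1, 1:] ^ nat b) =
      to_fract ([:1:] * [:0, 1:] ^ nat (- a) * [:-1, 1:] ^ nat (- b))"
    by (simp only: to_fract_mult to_fract_power scalar_1 mult_1_left)
  then have eq: "[:c:] * [:0, 1:] ^ nat a * [:-1, 1:] ^ nat b = [:1:] * [:0, 1:] ^ nat (- a) * [:-1, 1:] ^ nat (- b)"
    by (simp only: to_fract_eq_iff)
  have "nat a = nat (- a)" "nat b = nat (- b)"
    using order_split[OF assms(1), of "nat a" "nat b"] order_split[OF one_neq_zero, of "nat (- a)" "nat (- b)", where 'k = 'k]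
    unfolding eq by simp_all
  then have ab: "a = 0" "b = 0" by linarith+
  with eq show ?thesis by (simp add: one_pCons)
qed

context short_relations
begin

abbreviation g2t where "g2t \<equiv> F (diag4 tt 1)"
abbreviation g2s where "g2s \<equiv> F (diag4 ss 1)"
abbreviation g3t where "g3t \<equiv> F (diag4 1 tt)"
abbreviation g3s where "g3s \<equiv> F (diag4 1 ss)"

text \<open>The lift of the diagonal matrix with entries \<open>c t\<^sup>a (t-1)\<^sup>b\<close> and \<open>c' t\<^sup>a\<^sup>' (t-1)\<^sup>b\<^sup>'\<close>.\<close>
definition tau :: "'k \<Rightarrow> int \<Rightarrow> int \<Rightarrow> 'k \<Rightarrow> int \<Rightarrow> int \<Rightarrow> 'g" where
  "tau c a b c' a' b' = F (diag4 (scalar c) (scalar c')) + (zpow a g2t + (zpow b g2s + (zpow a' g3t + zpow b' g3s)))"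

lemma in_torus_letters:
  "c \<noteq> 0 \<Longrightarrow> c' \<noteq> 0 \<Longrightarrow> diag4 (scalar c) (scalar c') \<in> torus_letters"
  "\<kappa> \<in> unit_gens \<Longrightarrow> diag4 \<kappa> 1 \<in> torus_letters" "\<kappa> \<in> unit_gens \<Longrightarrow> diag4 1 \<kappa> \<in> torus_letters"
  unfolding torus_letters_def by blast+

lemma gens_in_torus_letters:
  "diag4 tt 1 \<in> torus_letters" "diag4 ss 1 \<in> torus_letters" "diag4 1 tt \<in> torus_letters" "diag4 1 ss \<in> torus_letters"
  by (intro in_torus_letters insertI1 insertI2)+

lemma F_diag4_inverse:
  assumes "\<kappa> \<in> {tt, ss}"
  shows "F (diag4 (inverse \<kappa>) 1) = - F (diag4 \<kappa> 1)" "F (diag4 1 (inverse \<kappa>)) = - F (diag4 1 \<kappa>)"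
proof -
  have 1: "\<kappa> \<in> unit_gens" "inverse \<kappa> \<in> unit_gens" "\<kappa> \<noteq> 0" using assms by auto
  have "diag4 \<kappa> 1 * diag4 (inverse \<kappa>) 1 = 1\<^sub>m 4" "diag4 1 \<kappa> * diag4 1 (inverse \<kappa>) = 1\<^sub>m 4"
    using 1(3) by (simp_all add: diag4_mult) (simp_all add: diag4_def one_mat_4)
  then show "F (diag4 (inverse \<kappa>) 1) = - F (diag4 \<kappa> 1)" "F (diag4 1 (inverse \<kappa>)) = - F (diag4 1 \<kappa>)"
    using F_inverse[OF torus_letter torus_letter] in_torus_letters(2,3) 1 by blast+
qed

lemma zpow_shift:
  assumes "g' = - g"
  shows "g + zpow a g = zpow (a + 1) g" "g' + zpow a g = zpow (a - 1) g"
    "g + (zpow a g + z) = zpow (a + 1) g + z" "g' + (zpow a g + z) = zpow (a - 1) g + z"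
  using assms zpow_succ zpow_pred by (auto simp: add.assoc[symmetric])

lemma torus_letter_tau:
  assumes d: "diag4 p q \<in> torus_letters" and nz: "c \<noteq> 0" "c' \<noteq> 0"
  obtains c1 a1 b1 c2 a2 b2 where "c1 \<noteq> 0" "c2 \<noteq> 0"
    "F (diag4 p q) + tau c a b c' a' b' = tau c1 a1 b1 c2 a2 b2"
    "unit_val c1 a1 b1 = p * unit_val c a b" "unit_val c2 a2 b2 = q * unit_val c' a' b'"
proof -
  have T: "diag4 (scalar c) (scalar c') \<in> torus_letters" by (rule in_torus_letters(1)[OF nz])
  have eq: "diag4 a b = diag4 a' b' \<longleftrightarrow> a = a' \<and> b = b'" for a b a' b' :: "'k poly fract"
    by (simp add: diag4_def m4_eq_iff)
  have com: "F (diag4 p q) + (F (diag4 (scalar c) (scalar c')) + z) = F (diag4 (scalar c) (scalar c')) + (F (diag4 p q) + z)" for z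
    by (intro commutes_left F_torus_commutes d T)
  have comz: "F (diag4 p q) + (zpow i (F d') + z) = zpow i (F d') + (F (diag4 p q) + z)"
    if "d' \<in> torus_letters" for i d' z
    using that by (intro commutes_left commutes_zpow F_torus_commutes d)
  note comz = gens_in_torus_letters[THEN comz]
  have p1: "(z :: 'k poly fract) powi (i + 1) = z * z powi i" "z powi (i - 1) = inverse z * z powi i" if "z \<noteq> 0" for z i
    using that by (simp_all add: power_int_add power_int_diff field_simps)
  note p1 = p1[OF tt_nonzero] p1[OF ss_nonzero]
  from d consider e e' where "p = scalar e" "q = scalar e'" "e \<noteq> 0" "e' \<noteq> 0"
    | "p \<in> unit_gens" "q = 1" | "p = 1" "q \<in> unit_gens"
    unfolding torus_letters_def by (auto simp: eq)
  then show ?thesis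
  proof cases
    case (1 e e')
    have "mprod [diag4 p q, diag4 (scalar c) (scalar c')] = mprod [diag4 (scalar (e * c)) (scalar (e' * c'))]"
      by (simp only: mprod_simps mult_1_mat_4 diag4_carrier diag4_mult 1(1,2) scalar_mult)
    from rel[OF _ _ _ _ this] have *: "F (diag4 p q) + F (diag4 (scalar c) (scalar c')) = F (diag4 (scalar (e * c)) (scalar (e' * c')))"
      using d T in_torus_letters(1)[of "e * c" "e' * c'"] nz 1 by (simp add: torus_letter)
    show ?thesis
    proof (rule that)
      show "F (diag4 p q) + tau c a b c' a' b' = tau (e * c) a b (e' * c') a' b'"
        unfolding tau_def add.assoc[symmetric] * ..
      show "unit_val (e * c) a b = p * unit_val c a b" "unit_val (e' * c') a' b' = q * unit_val c' a' b'"
        unfolding 1(1,2) unit_val_def scalar_mult[symmetric] by (simp_all only: mult.assoc)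
    qed (use 1 nz in auto)
  next
    case 2
    then have "p = tt \<or> p = ss \<or> p = inverse tt \<or> p = inverse ss" by simp
    then show ?thesis
    proof (elim disjE)
      assume p: "p = tt"
      show ?thesis by (rule that[OF nz, of "a + 1" b a' b'], unfold tau_def com)
        (simp_all add: p 2(2) zpow_shift unit_val_def p1)
    next
      assume p: "p = ss"
      show ?thesis by (rule that[OF nz, of a "b + 1" a' b'], unfold tau_def com comz(1))
        (simp_all add: p 2(2) zpow_shift unit_val_def p1)
    next
      assume p: "p = inverse tt"
      show ?thesis by (rule that[OF nz, of "a - 1" b a' b'], unfold tau_def com)
        (simp_all add: p 2(2) zpow_shift[OF F_diag4_inverse(1)] unit_val_def p1)
    next
      assume p: "p = inverse ss"
      show ?thesis by (rule that[OF nz, of a "b - 1" a' b'], unfold tau_def com comz(1))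
        (simp_all add: p 2(2) zpow_shift[OF F_diag4_inverse(1)] unit_val_def p1)
    qed
  next
    case 3
    then have "q = tt \<or> q = ss \<or> q = inverse tt \<or> q = inverse ss" by simp
    then show ?thesis
    proof (elim disjE)
      assume p: "q = tt"
      show ?thesis by (rule that[OF nz, of a b "a' + 1" b'], unfold tau_def com comz(1,2))
        (simp_all add: p 3(1) zpow_shift unit_val_def p1)
    next
      assume p: "q = ss"
      show ?thesis by (rule that[OF nz, of a b a' "b' + 1"], unfold tau_def com comz(1-3))
        (simp_all add: p 3(1) zpow_shift unit_val_def p1)
    next
      assume p: "q = inverse tt"
      show ?thesis by (rule that[OF nz, of a b "a' - 1" b'], unfold tau_def com comz(1,2))
        (simp_all add: p 3(1) zpow_shift[OF F_diag4_inverse(2)] unit_val_def p1)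
    next
      assume p: "q = inverse ss"
      show ?thesis by (rule that[OF nz, of a b a' "b' - 1"], unfold tau_def com comz(1-3))
        (simp_all add: p 3(1) zpow_shift[OF F_diag4_inverse(2)] unit_val_def p1)
    qed
  qed
qed

text \<open>A group element in normal form together with the matrix described by the same parameters. The entries of
  the matrix are scaled by the diagonal entry of their column, as the diagonal part comes last in
  the product.\<close>
inductive represents :: "'g \<Rightarrow> 'k poly fract mat \<Rightarrow> bool" where
  "\<lbrakk>c \<noteq> 0; c' \<noteq> 0; u = unit_val c a b; v = unit_val c' a' b';
    a12 \<in> laurent_ring; a13 \<in> laurent_ring; a14 \<in> laurent_ring;
    a23 \<in> laurent_ring; a24 \<in> laurent_ring; a34 \<in> laurent_ring\<rbrakk>
   \<Longrightarrow> represents (nf a12 a13 a14 a23 a24 a34 + tau c a b c' a' b')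
        (m4 u v (a12 * u) (a13 * v) a14 (a23 * v) a24 a34)"

lemma represents_letter:
  assumes w: "w \<in> letters" and "represents \<gamma> M" shows "represents (F w + \<gamma>) (w * M)"
  using assms(2)
proof cases
  case (1 c c' u a b v a' b' a12 a13 a14 a23 a24 a34)
  note a = 1(7-12)
  from w consider \<rho> k where "w = root_mat \<rho> (scalar k)" | p q where "w = diag4 p q" "diag4 p q \<in> torus_letters"
    unfolding letters_def torus_letters_def by blast
  then show ?thesis
  proof cases
    case (1 \<rho> k)
    have Fw: "F w = root_el \<rho> (scalar k)" unfolding 1 root_el_scalar e_def ..
    let ?k = "scalar k"
    note R = to_fract_in_laurent_ring[of "[:k:]"] a add_in_laurent_ring mult_in_laurent_ring
    have gen: "represents (nf b12 b13 b14 b23 b24 b34 + tau c a b c' a' b') N"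
      if "b12 \<in> laurent_ring" "b13 \<in> laurent_ring" "b14 \<in> laurent_ring"
        "b23 \<in> laurent_ring" "b24 \<in> laurent_ring" "b34 \<in> laurent_ring"
        "N = m4 u v (b12 * u) (b13 * v) b14 (b23 * v) b24 b34" for b12 b13 b14 b23 b24 b34 N
      unfolding that(7) using \<open>c \<noteq> 0\<close> \<open>c' \<noteq> 0\<close> \<open>u = _\<close> \<open>v = _\<close> that(1-6) by (rule represents.intros)
    show ?thesis
    proof (cases \<rho>)
      case R12
      show ?thesis unfolding \<open>\<gamma> = _\<close> \<open>M = _\<close> Fw add.assoc[symmetric] R12 x12_nf[OF to_fract_in_laurent_ring a(6,5,4,3,2,1)]
        by (rule gen; (intro R)?; simp add: \<open>w = _\<close> R12 m4_mult m4_eq_iff algebra_simps)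
    next
      case R13
      show ?thesis unfolding \<open>\<gamma> = _\<close> \<open>M = _\<close> Fw add.assoc[symmetric] R13 x13_nf[OF to_fract_in_laurent_ring a(6,5,4,3,2)]
        by (rule gen; (intro R)?; simp add: \<open>w = _\<close> R13 m4_mult m4_eq_iff algebra_simps)
    next
      case R23
      show ?thesis unfolding \<open>\<gamma> = _\<close> \<open>M = _\<close> Fw add.assoc[symmetric] R23 x23_nf[OF to_fract_in_laurent_ring a(6,5,4)]
        by (rule gen; (intro R)?; simp add: \<open>w = _\<close> R23 m4_mult m4_eq_iff algebra_simps)
    next
      case R24
      show ?thesis unfolding \<open>\<gamma> = _\<close> \<open>M = _\<close> Fw add.assoc[symmetric] R24 x24_nf[OF to_fract_in_laurent_ring a(6,5)]
        by (rule gen; (intro R)?; simp add: \<open>w = _\<close> R24 m4_mult m4_eq_iff algebra_simps)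
    next
      case R34
      show ?thesis unfolding \<open>\<gamma> = _\<close> \<open>M = _\<close> Fw add.assoc[symmetric] R34 x34_nf[OF to_fract_in_laurent_ring a(6)]
        by (rule gen; (intro R)?; simp add: \<open>w = _\<close> R34 m4_mult m4_eq_iff algebra_simps)
    qed
  next
    case (2 p q)
    note nz = torus_letter_inverse(1,2)[OF 2(2)]
    have W: "weight \<rho> p q \<in> laurent_ring" for \<rho> by (rule weight_in_laurent_ring[OF 2(2)])
    note W = W[of R12, simplified] W[of R13, simplified] W[of R23, simplified] W[of R24, simplified] W[of R34, simplified]
    obtain c1 a1 b1 c2 a2 b2 where t: "c1 \<noteq> 0" "c2 \<noteq> 0"
      "F (diag4 p q) + tau c a b c' a' b' = tau c1 a1 b1 c2 a2 b2"
      "unit_val c1 a1 b1 = p * unit_val c a b" "unit_val c2 a2 b2 = q * unit_val c' a' b'"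
      by (rule torus_letter_tau[OF 2(2) \<open>c \<noteq> 0\<close> \<open>c' \<noteq> 0\<close>])
    have M: "w * M = m4 (p * u) (q * v) (inverse p * a12 * (p * u)) (inverse q * a13 * (q * v)) a14
        (p * inverse q * a23 * (q * v)) (p * a24) (q * a34)"
      unfolding \<open>M = _\<close> 2 diag4_def m4_mult using nz by (simp add: m4_eq_iff)
    have g: "F w + \<gamma> = nf (inverse p * a12) (inverse q * a13) a14 (p * inverse q * a23) (p * a24) (q * a34) + tau c1 a1 b1 c2 a2 b2"
      unfolding \<open>\<gamma> = _\<close> 2(1) add.assoc[symmetric] torus_nf[OF 2(2) a] t(3)[symmetric] ..
    show ?thesis unfolding M g
      by (rule represents.intros[OF t(1,2)]) (use t \<open>u = _\<close> \<open>v = _\<close> a W in auto)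
  qed
qed

lemma normal_form_1: "nf 0 0 0 0 0 0 + tau 1 0 0 1 0 0 = 0"
proof -
  have "diag4 1 1 = (1\<^sub>m 4 :: 'k poly fract mat)" by (simp add: diag4_def one_mat_4)
  then have "F (diag4 1 1) = 0"
    using rel[of "[diag4 1 1]" "[]"] torus_letter[OF in_torus_letters(1)[of "1 :: 'k" "1 :: 'k"]] by simp
  then have "tau 1 0 0 1 0 0 = 0" by (simp add: tau_def)
  moreover have "x14 0 = 0" using x14_add[of 0 0] by (metis add.right_neutral add_left_cancel zero_in_laurent_ring)
  ultimately show ?thesis by (simp add: nf_def)
qed

lemma represents_0: "represents 0 (1\<^sub>m 4)"
proof -
  have "unit_val 1 0 0 = (1 :: 'k poly fract)" by (simp add: unit_val_def)
  then show ?thesis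
    using represents.intros[of 1 1 1 0 0 1 0 0 0 0 0 0 0 0] by (simp add: normal_form_1 one_mat_4)
qed

lemma represents_word: "set ws \<subseteq> letters \<Longrightarrow> represents (sum_list (map F ws)) (mprod ws)"
  by (induction ws) (simp_all add: represents_0 represents_letter)

text \<open>The parameters can be recovered from the matrix; for the identity matrix all of them are trivial.\<close>
lemma represents_1: "represents \<gamma> (1\<^sub>m 4) \<Longrightarrow> \<gamma> = 0"
proof (erule represents.cases)
  fix c c' u a b v a' b' a12 a13 a14 a23 a24 a34
  assume *: "c \<noteq> 0" "c' \<noteq> 0" "u = unit_val c a b" "v = unit_val c' a' b'"
    and \<gamma>: "\<gamma> = nf a12 a13 a14 a23 a24 a34 + tau c a b c' a' b'"
    and M: "1\<^sub>m 4 = m4 u v (a12 * u) (a13 * v) a14 (a23 * v) a24 a34"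
  have uv: "u = 1" "v = 1" using M by (simp_all add: one_mat_4 m4_eq_iff)
  have a: "a12 = 0" "a13 = 0" "a14 = 0" "a23 = 0" "a24 = 0" "a34 = 0"
    using M unfolding uv by (simp_all add: one_mat_4 m4_eq_iff)
  have "c = 1 \<and> a = 0 \<and> b = 0" "c' = 1 \<and> a' = 0 \<and> b' = 0"
    using unit_val_eq_1 * uv by metis+
  then show "\<gamma> = 0" unfolding \<gamma> a by (simp add: normal_form_1)
qed

text \<open>Finite presentability of \<open>A\<^sub>4\<close>: the relations of length at most four imply all others.\<close>
theorem relations_of_A4:
  assumes "set ws \<subseteq> letters" "mprod ws = 1\<^sub>m 4" shows "sum_list (map F ws) = 0"
  using represents_word[OF assms(1)] unfolding assms(2) by (rule represents_1)

end

section \<open>Coarse cocycles\<close>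

text \<open>Since additivity is only required on triangles of diameter at most \<open>r\<close>, a cocycle need not be of
  the form \<open>b y - b x\<close>. Its sums along closed paths detect those that are not filled by such triangles.\<close>
definition coarse_cocycle :: "'a set \<Rightarrow> ('a \<Rightarrow> 'a \<Rightarrow> real) \<Rightarrow> real \<Rightarrow> ('a \<Rightarrow> 'a \<Rightarrow> 'v::ab_group_add) \<Rightarrow> bool" where
  "coarse_cocycle X d r c \<longleftrightarrow>
     (\<forall>x\<in>X. \<forall>y\<in>X. \<forall>z\<in>X. d x y \<le> r \<longrightarrow> d y z \<le> r \<longrightarrow> d x z \<le> r \<longrightarrow> c x y + c y z = c x z)"

definition pseudometric_on :: "'a set \<Rightarrow> ('a \<Rightarrow> 'a \<Rightarrow> real) \<Rightarrow> bool" where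
  "pseudometric_on X d \<longleftrightarrow> (\<forall>x\<in>X. d x x = 0) \<and> (\<forall>x\<in>X. \<forall>y\<in>X. d x y = d y x)
     \<and> (\<forall>x\<in>X. \<forall>y\<in>X. \<forall>z\<in>X. d x z \<le> d x y + d y z)"

lemma coarse_cocycleD:
  "coarse_cocycle X d r c \<Longrightarrow> x \<in> X \<Longrightarrow> y \<in> X \<Longrightarrow> z \<in> X \<Longrightarrow> d x y \<le> r \<Longrightarrow> d y z \<le> r \<Longrightarrow> d x z \<le> r
    \<Longrightarrow> c x y + c y z = c x z"
  unfolding coarse_cocycle_def by blast

lemma coarse_cocycle_diag:
  "coarse_cocycle X d r c \<Longrightarrow> pseudometric_on X d \<Longrightarrow> r \<ge> 0 \<Longrightarrow> x \<in> X \<Longrightarrow> c x x = 0"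
  using coarse_cocycleD[of X d r c x x x] by (simp add: pseudometric_on_def)

text \<open>The closed path is carried to \<open>X\<close> by a quasi-inverse of \<open>f\<close>. The images of the new points are \<open>C\<close>-close to the
  old ones, so corresponding terms of the two sums differ by a telescoping term.\<close>
lemma pull_back_loop:
  fixes c :: "'b \<Rightarrow> 'b \<Rightarrow> 'v::ab_group_add"
  assumes dY: "pseudometric_on Y dY"
    and f: "f \<in> X \<rightarrow> Y" and L: "L \<ge> 1" and C: "C \<ge> 0"
    and qi: "\<And>x x'. x \<in> X \<Longrightarrow> x' \<in> X \<Longrightarrow> dX x x' / L - C \<le> dY (f x) (f x') \<and> dY (f x) (f x') \<le> L * dX x x' + C"
    and onto: "\<And>y. y \<in> Y \<Longrightarrow> \<exists>x\<in>X. dY (f x) y \<le> C"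
    and c: "coarse_cocycle Y dY r' c" and r': "L * r + C \<le> r'" "1 + 2 * C \<le> r'"
    and y: "\<And>k. y k \<in> Y" "\<And>k. k < n \<Longrightarrow> dY (y k) (y (Suc k)) \<le> 1" "y n = y 0"
  obtains x where "\<forall>k. x k \<in> X" "\<forall>k<n. dX (x k) (x (Suc k)) \<le> L * (1 + 3 * C)" "x n = x 0"
    "coarse_cocycle X dX r (\<lambda>a b. c (f a) (f b))"
    "(\<Sum>k<n. c (f (x k)) (f (x (Suc k)))) = (\<Sum>k<n. c (y k) (y (Suc k)))"
proof -
  define g where "g z = (SOME x. x \<in> X \<and> dY (f x) z \<le> C)" for z
  have g: "g z \<in> X" "dY (f (g z)) z \<le> C" if "z \<in> Y" for z
    using someI_ex[of "\<lambda>x. x \<in> X \<and> dY (f x) z \<le> C"] onto[OF that] unfolding g_def by blast+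
  define x where "x k = g (y k)" for k
  have x: "x k \<in> X" "dY (f (x k)) (y k) \<le> C" "f (x k) \<in> Y" for k
    using g[OF y(1)] f unfolding x_def by auto
  have sym: "dY a b = dY b a" if "a \<in> Y" "b \<in> Y" for a b
    using dY that unfolding pseudometric_on_def by blast
  have tri: "dY a e \<le> dY a b + dY b e" if "a \<in> Y" "b \<in> Y" "e \<in> Y" for a b e
    using dY that unfolding pseudometric_on_def by blast
  have yf: "dY (y k) (f (x k)) \<le> C" for k using x(2,3) y(1) sym by metis
  have fy: "dY (f (x k)) (y (Suc k)) \<le> 1 + C" if "k < n" for k
    using tri[of "f (x k)" "y k" "y (Suc k)"] x(2,3)[of k] y(1) y(2)[OF that] by fastforce
  have ff: "dY (f (x k)) (f (x (Suc k))) \<le> 1 + 2 * C" if "k < n" for k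
    using tri[of "f (x k)" "y (Suc k)" "f (x (Suc k))"] fy[OF that] yf[of "Suc k"] x(3) y(1) by fastforce
  show ?thesis
  proof (rule that)
    show "\<forall>k. x k \<in> X" by (simp add: x)
    show "x n = x 0" by (simp add: x_def y)
    show "\<forall>k<n. dX (x k) (x (Suc k)) \<le> L * (1 + 3 * C)"
    proof (intro allI impI)
      fix k assume "k < n"
      then have "dX (x k) (x (Suc k)) / L \<le> 1 + 3 * C"
        using qi[of "x k" "x (Suc k)"] ff[of k] x(1) by fastforce
      then show "dX (x k) (x (Suc k)) \<le> L * (1 + 3 * C)" using L by (simp add: field_simps)
    qed
    show "coarse_cocycle X dX r (\<lambda>a b. c (f a) (f b))"
      unfolding coarse_cocycle_def
    proof (intro ballI impI)
      have le: "dY (f a) (f b) \<le> r'" if "a \<in> X" "b \<in> X" "dX a b \<le> r" for a b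
      proof -
        have "dY (f a) (f b) \<le> L * dX a b + C" using qi that by blast
        also have "L * dX a b \<le> L * r" using that L by (intro mult_left_mono) auto
        finally show ?thesis using r' by linarith
      qed
      fix a b e assume "a \<in> X" "b \<in> X" "e \<in> X" "dX a b \<le> r" "dX b e \<le> r" "dX a e \<le> r"
      then show "c (f a) (f b) + c (f b) (f e) = c (f a) (f e)"
        using f le by (intro coarse_cocycleD[OF c]) auto
    qed
    have step: "c (y k) (y (Suc k)) = c (y k) (f (x k)) + c (f (x k)) (f (x (Suc k))) - c (y (Suc k)) (f (x (Suc k)))"
      if "k < n" for k
    proof -
      have 1: "c (y k) (f (x k)) + c (f (x k)) (y (Suc k)) = c (y k) (y (Suc k))"
      proof (rule coarse_cocycleD[OF c])
        show "dY (y k) (f (x k)) \<le> r'" using yf[of k] r' C by linarith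
        show "dY (f (x k)) (y (Suc k)) \<le> r'" using fy[OF that] r' C by linarith
        show "dY (y k) (y (Suc k)) \<le> r'" using y(2)[OF that] r' C by linarith
      qed (use x y in auto)
      have 2: "c (f (x k)) (y (Suc k)) + c (y (Suc k)) (f (x (Suc k))) = c (f (x k)) (f (x (Suc k)))"
      proof (rule coarse_cocycleD[OF c])
        show "dY (f (x k)) (y (Suc k)) \<le> r'" using fy[OF that] r' C by linarith
        show "dY (y (Suc k)) (f (x (Suc k))) \<le> r'" using yf[of "Suc k"] r' C by linarith
        show "dY (f (x k)) (f (x (Suc k))) \<le> r'" using ff[OF that] r' C by linarith
      qed (use x y in auto)
      show ?thesis unfolding 1[symmetric] 2[symmetric] by (simp add: algebra_simps)
    qed
    have "(\<Sum>k<n. c (y k) (y (Suc k))) = (\<Sum>k<n. c (f (x k)) (f (x (Suc k))) + (c (y k) (f (x k)) - c (y (Suc k)) (f (x (Suc k)))))"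
      by (rule sum.cong) (auto simp: step algebra_simps)
    also have "\<dots> = (\<Sum>k<n. c (f (x k)) (f (x (Suc k)))) + (\<Sum>k<n. c (y k) (f (x k)) - c (y (Suc k)) (f (x (Suc k))))"
      by (rule sum.distrib)
    also have "(\<Sum>k<n. c (y k) (f (x k)) - c (y (Suc k)) (f (x (Suc k)))) = 0"
      using sum_lessThan_telescope'[of "\<lambda>k. c (y k) (f (x k))" n] by (simp add: x_def y)
    finally show "(\<Sum>k<n. c (f (x k)) (f (x (Suc k)))) = (\<Sum>k<n. c (y k) (y (Suc k)))" by simp
  qed
qed

section \<open>Word metrics\<close>

definition gprod :: "('a, 'b) monoid_scheme \<Rightarrow> 'a list \<Rightarrow> 'a" where
  "gprod G ws = foldr (\<lambda>x y. x \<otimes>\<^bsub>G\<^esub> y) ws \<one>\<^bsub>G\<^esub>"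

lemma gprod_simps [simp]: "gprod G [] = \<one>\<^bsub>G\<^esub>" "gprod G (a # ws) = a \<otimes>\<^bsub>G\<^esub> gprod G ws"
  by (simp_all add: gprod_def)

text \<open>The set of letters that \<open>word_length\<close> admits.\<close>
definition sym_set :: "('a, 'b) monoid_scheme \<Rightarrow> 'a set \<Rightarrow> 'a set" where
  "sym_set G S = S \<union> (\<lambda>s. inv\<^bsub>G\<^esub> s) ` S"

context group
begin

lemma gprod_closed [simp]: "set ws \<subseteq> carrier G \<Longrightarrow> gprod G ws \<in> carrier G"
  by (induction ws) auto

lemma gprod_append: "set us \<subseteq> carrier G \<Longrightarrow> set vs \<subseteq> carrier G \<Longrightarrow> gprod G (us @ vs) = gprod G us \<otimes> gprod G vs"
  by (induction us) (auto simp: m_assoc)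

lemma inv_gprod: "set ws \<subseteq> carrier G \<Longrightarrow> inv (gprod G ws) = gprod G (rev (map (\<lambda>s. inv s) ws))"
proof (induction ws)
  case (Cons a ws)
  then have "set (rev (map (\<lambda>s. inv s) ws)) \<subseteq> carrier G" by auto
  with Cons show ?case by (simp add: gprod_append inv_mult_group)
qed simp

lemma sym_set_carrier: "S \<subseteq> carrier G \<Longrightarrow> sym_set G S \<subseteq> carrier G"
  by (auto simp: sym_set_def)

lemma inv_sym_set: "S \<subseteq> carrier G \<Longrightarrow> s \<in> sym_set G S \<Longrightarrow> inv s \<in> sym_set G S"
  by (auto simp: sym_set_def)

lemma word_length_alt: "word_length G S g = (LEAST n. \<exists>ws. length ws = n \<and> set ws \<subseteq> sym_set G S \<and> gprod G ws = g)"
  by (simp add: word_length_def sym_set_def gprod_def)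

lemma word_length_le: "set ws \<subseteq> sym_set G S \<Longrightarrow> gprod G ws = g \<Longrightarrow> word_length G S g \<le> length ws"
  unfolding word_length_alt by (rule Least_le) blast

lemma generate_word:
  assumes "S \<subseteq> carrier G" "g \<in> generate G S"
  shows "\<exists>ws. set ws \<subseteq> sym_set G S \<and> gprod G ws = g"
  using assms(2)
proof induction
  case one
  show ?case by (rule exI[of _ "[]"]) simp
next
  case (incl h)
  then show ?case using assms by (intro exI[of _ "[h]"]) (auto simp: sym_set_def)
next
  case (inv h)
  then show ?case using assms by (intro exI[of _ "[inv h]"]) (auto simp: sym_set_def)
next
  case (eng h1 h2)
  then obtain us vs where "set us \<subseteq> sym_set G S" "gprod G us = h1" "set vs \<subseteq> sym_set G S" "gprod G vs = h2" by blast
  then show ?case using sym_set_carrier[OF assms(1)] by (intro exI[of _ "us @ vs"]) (auto simp: gprod_append)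
qed

lemma shortest_word:
  assumes "finite_generating_set G S" "g \<in> carrier G"
  obtains ws where "set ws \<subseteq> sym_set G S" "gprod G ws = g" "length ws = word_length G S g"
proof -
  have "\<exists>n ws. length ws = n \<and> set ws \<subseteq> sym_set G S \<and> gprod G ws = g"
    using generate_word[of S g] assms unfolding finite_generating_set_def by auto
  from LeastI_ex[OF this] show ?thesis using that unfolding word_length_alt by blast
qed

lemma word_length_mult:
  assumes "finite_generating_set G S" "g \<in> carrier G" "h \<in> carrier G"
  shows "word_length G S (g \<otimes> h) \<le> word_length G S g + word_length G S h"
proof -
  obtain us where us: "set us \<subseteq> sym_set G S" "gprod G us = g" "length us = word_length G S g"
    by (rule shortest_word[OF assms(1,2)])
  obtain vs where vs: "set vs \<subseteq> sym_set G S" "gprod G vs = h" "length vs = word_length G S h"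
    by (rule shortest_word[OF assms(1,3)])
  have "S \<subseteq> carrier G" using assms(1) by (simp add: finite_generating_set_def)
  from sym_set_carrier[OF this] us vs show ?thesis
    using word_length_le[of "us @ vs" S "g \<otimes> h"] by (simp add: gprod_append)
qed

lemma word_length_inv_le:
  assumes "finite_generating_set G S" "g \<in> carrier G"
  shows "word_length G S (inv g) \<le> word_length G S g"
proof -
  obtain us where us: "set us \<subseteq> sym_set G S" "gprod G us = g" "length us = word_length G S g"
    by (rule shortest_word[OF assms(1,2)])
  have S: "S \<subseteq> carrier G" using assms(1) by (simp add: finite_generating_set_def)
  have "gprod G (rev (map (\<lambda>s. inv s) us)) = inv g"
    using inv_gprod[of us] us sym_set_carrier[OF S] by auto
  moreover have "set (rev (map (\<lambda>s. inv s) us)) \<subseteq> sym_set G S" using us inv_sym_set[OF S] by auto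
  ultimately have "word_length G S (inv g) \<le> length (rev (map (\<lambda>s. inv s) us))" by (intro word_length_le)
  then show ?thesis using us(3) by simp
qed

lemma word_length_inv:
  assumes "finite_generating_set G S" "g \<in> carrier G"
  shows "word_length G S (inv g) = word_length G S g"
  using word_length_inv_le[OF assms] word_length_inv_le[OF assms(1), of "inv g"] assms(2) by simp

lemma word_length_one [simp]: "word_length G S \<one> = 0"
  using word_length_le[of "[]" S "\<one>"] by simp

lemma pseudometric_word_dist:
  assumes S: "finite_generating_set G S"
  shows "pseudometric_on (carrier G) (word_dist G S)"
  unfolding pseudometric_on_def
proof (intro conjI ballI)
  fix x y z assume x: "x \<in> carrier G" and y: "y \<in> carrier G" and z: "z \<in> carrier G"
  have "inv x \<otimes> z = (inv x \<otimes> y) \<otimes> (inv y \<otimes> z)"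
    using x y z by (metis inv_closed m_assoc m_closed r_inv r_one)
  then show "word_dist G S x z \<le> word_dist G S x y + word_dist G S y z"
    using word_length_mult[OF S, of "inv x \<otimes> y" "inv y \<otimes> z"] x y z unfolding word_dist_def by simp
next
  fix x y assume x: "x \<in> carrier G" and y: "y \<in> carrier G"
  have "inv (inv x \<otimes> y) = inv y \<otimes> x" using x y by (simp add: inv_mult_group)
  then show "word_dist G S x y = word_dist G S y x"
    using word_length_inv[OF S, of "inv x \<otimes> y"] x y unfolding word_dist_def by simp
qed (simp add: word_dist_def)

lemma word_length_compare:
  assumes S: "finite_generating_set G S" and T: "finite_generating_set G T"
  shows "\<exists>K\<ge>1. \<forall>g\<in>carrier G. word_length G S g \<le> K * word_length G T g"
proof -
  define K where "K = Max (insert 1 (word_length G S ` sym_set G T))"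
  have fin: "finite (sym_set G T)" and Tc: "sym_set G T \<subseteq> carrier G"
    using T sym_set_carrier by (auto simp: finite_generating_set_def sym_set_def)
  have K: "word_length G S t \<le> K" if "t \<in> sym_set G T" for t
    unfolding K_def using fin that by (intro Max_ge) auto
  have "word_length G S (gprod G ws) \<le> K * length ws" if "set ws \<subseteq> sym_set G T" for ws
    using that
  proof (induction ws)
    case (Cons a ws)
    then have "word_length G S (gprod G (a # ws)) \<le> word_length G S a + word_length G S (gprod G ws)"
      using Tc by (auto intro!: word_length_mult[OF S])
    with Cons K[of a] show ?case by simp
  qed simp
  then have "\<forall>g\<in>carrier G. word_length G S g \<le> K * word_length G T g"
    by (metis shortest_word[OF T])
  moreover have "K \<ge> 1" unfolding K_def using fin by (intro Max_ge) auto
  ultimately show ?thesis by blast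
qed

lemma word_dist_compare:
  assumes S: "finite_generating_set G S" and T: "finite_generating_set G T"
  shows "\<exists>K\<ge>1. \<forall>x\<in>carrier G. \<forall>y\<in>carrier G. word_dist G S x y \<le> K * word_dist G T x y"
proof -
  obtain K where K: "K \<ge> 1" "\<And>g. g \<in> carrier G \<Longrightarrow> word_length G S g \<le> K * word_length G T g"
    using word_length_compare[OF S T] by blast
  have "word_dist G S x y \<le> real K * word_dist G T x y" if "x \<in> carrier G" "y \<in> carrier G" for x y
    using K(2)[of "inv x \<otimes> y"] that unfolding word_dist_def by (metis inv_closed m_closed of_nat_le_iff of_nat_mult)
  then show ?thesis using K(1) by (intro exI[of _ "real K"]) auto
qed

end

text \<open>Any two word metrics on a finitely generated group are bi-Lipschitz equivalent.\<close>
lemma quasi_isometric_generating_sets: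
  assumes "group G" "group H" "quasi_isometric G H"
    and S: "finite_generating_set G S" and T: "finite_generating_set H T"
  shows "quasi_isometric_spaces (carrier G) (word_dist G S) (carrier H) (word_dist H T)"
proof -
  obtain S' T' where S': "finite_generating_set G S'" and T': "finite_generating_set H T'"
    and q: "quasi_isometric_spaces (carrier G) (word_dist G S') (carrier H) (word_dist H T')"
    using assms(3) unfolding quasi_isometric_def by blast
  obtain f L C where f: "f \<in> carrier G \<rightarrow> carrier H" and L: "L \<ge> 1" and C: "C \<ge> 0"
    and qi: "\<And>x x'. x \<in> carrier G \<Longrightarrow> x' \<in> carrier G \<Longrightarrow>
      word_dist G S' x x' / L - C \<le> word_dist H T' (f x) (f x') \<and> word_dist H T' (f x) (f x') \<le> L * word_dist G S' x x' + C"
    and onto: "\<And>y. y \<in> carrier H \<Longrightarrow> \<exists>x\<in>carrier G. word_dist H T' (f x) y \<le> C"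
    using q unfolding quasi_isometric_spaces_def by blast
  obtain K1 where K1: "K1 \<ge> 1" "\<And>x y. x \<in> carrier G \<Longrightarrow> y \<in> carrier G \<Longrightarrow> word_dist G S x y \<le> K1 * word_dist G S' x y"
    using group.word_dist_compare[OF assms(1) S S'] by blast
  obtain K2 where K2: "K2 \<ge> 1" "\<And>x y. x \<in> carrier G \<Longrightarrow> y \<in> carrier G \<Longrightarrow> word_dist G S' x y \<le> K2 * word_dist G S x y"
    using group.word_dist_compare[OF assms(1) S' S] by blast
  obtain K3 where K3: "K3 \<ge> 1" "\<And>x y. x \<in> carrier H \<Longrightarrow> y \<in> carrier H \<Longrightarrow> word_dist H T x y \<le> K3 * word_dist H T' x y"
    using group.word_dist_compare[OF assms(2) T T'] by blast
  obtain K4 where K4: "K4 \<ge> 1" "\<And>x y. x \<in> carrier H \<Longrightarrow> y \<in> carrier H \<Longrightarrow> word_dist H T' x y \<le> K4 * word_dist H T x y"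
    using group.word_dist_compare[OF assms(2) T' T] by blast
  define M where "M = K1 * K4 * L + K3 * L * K2"
  define E where "E = K3 * C + C"
  have nn: "word_dist G' U a b \<ge> 0" for G' :: "('e, 'f) monoid_scheme" and U a b by (simp add: word_dist_def)
  have M: "M \<ge> K1 * K4 * L" "M \<ge> K3 * L * K2" "M \<ge> 1"
  proof -
    have "K1 * K4 * L \<ge> 1 * 1 * 1" "K3 * L * K2 \<ge> 1 * 1 * 1"
      using K1(1) K2(1) K3(1) K4(1) L by (intro mult_mono; simp)+
    then show "M \<ge> K1 * K4 * L" "M \<ge> K3 * L * K2" "M \<ge> 1" unfolding M_def by linarith+
  qed
  have E: "E \<ge> C" "E \<ge> K3 * C" "E \<ge> 0" using K3(1) C by (simp_all add: E_def)
  show ?thesis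
    unfolding quasi_isometric_spaces_def
  proof (rule bexI[OF _ f], rule exI[of _ M], rule conjI[OF M(3)], rule exI[of _ E], intro conjI ballI)
    fix x x' assume x: "x \<in> carrier G" "x' \<in> carrier G"
    then have fx: "f x \<in> carrier H" "f x' \<in> carrier H" using f by auto
    let ?a = "word_dist G S x x'" and ?a' = "word_dist G S' x x'"
    let ?b = "word_dist H T (f x) (f x')" and ?b' = "word_dist H T' (f x) (f x')"
    have "?b \<le> K3 * ?b'" by (rule K3(2)[OF fx])
    also have "\<dots> \<le> K3 * (L * ?a' + C)" using qi[OF x] K3(1) by (intro mult_left_mono) auto
    also have "\<dots> \<le> K3 * (L * (K2 * ?a) + C)" using K2(2)[OF x] K3(1) L by (intro mult_left_mono add_right_mono) auto
    also have "\<dots> = K3 * L * K2 * ?a + K3 * C" by (simp add: algebra_simps)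
    also have "\<dots> \<le> M * ?a + E" using M E nn by (intro add_mono mult_right_mono) auto
    finally show "?b \<le> M * ?a + E" .
    have "?a \<le> K1 * ?a'" by (rule K1(2)[OF x])
    also have "?a' \<le> L * (?b' + C)" using qi[OF x] L by (simp add: field_simps)
    also have "?b' \<le> K4 * ?b" by (rule K4(2)[OF fx])
    finally have "?a \<le> K1 * (L * (K4 * ?b + C))" using K1(1) L by simp
    also have "\<dots> \<le> K1 * (L * (K4 * ?b + K4 * E))"
    proof -
      have "C \<le> K4 * E" using mult_mono[OF K4(1) E(1)] C K4(1) by simp
      then show ?thesis using K1(1) L by (intro mult_left_mono add_left_mono) auto
    qed
    also have "\<dots> = K1 * K4 * L * (?b + E)" by (simp add: algebra_simps)
    also have "\<dots> \<le> M * (?b + E)" using M(1) E(3) nn by (intro mult_right_mono add_nonneg_nonneg) auto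
    finally show "?a / M - E \<le> ?b" using M(3) by (simp add: field_simps)
  next
    fix y assume y: "y \<in> carrier H"
    then obtain x where x: "x \<in> carrier G" "word_dist H T' (f x) y \<le> C" using onto by blast
    have "word_dist H T (f x) y \<le> K3 * word_dist H T' (f x) y" using f x y by (intro K3(2)) auto
    also have "\<dots> \<le> K3 * C" using x K3(1) by (intro mult_left_mono) auto
    finally show "\<exists>x\<in>carrier G. word_dist H T (f x) y \<le> E" using x E(2) by force
  qed (use M E in auto)
qed

section \<open>The group \<open>A\<^sub>4\<close> over the Laurent ring\<close>

text \<open>The linear factors \<open>t\<close> and \<open>t - 1\<close> are prime: one of them divides a product only if it divides a factor, so they
  can be cancelled one at a time.\<close>
lemma divisor_of_monomial:
  fixes f g :: "'k::field poly"
  assumes "f * g = [:0, 1:] ^ m * [:-1, 1:] ^ n"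
  obtains c i j where "c \<noteq> 0" "f = [:c:] * [:0, 1:] ^ i * [:-1, 1:] ^ j"
proof -
  have linear: "f dvd h \<or> (\<exists>f'. f = [:- a, 1:] * f' \<and> f' dvd h)" if fg: "f dvd [:- a, 1:] * h" for f h :: "'k poly" and a
  proof -
    obtain g where g: "[:- a, 1:] * h = f * g" using fg by (elim dvdE)
    have "poly (f * g) a = 0" unfolding g[symmetric] by simp
    then consider f' where "f = [:- a, 1:] * f'" | g' where "g = [:- a, 1:] * g'"
      by (auto simp: poly_eq_0_iff_dvd dvd_def)
    then show ?thesis
    proof cases
      case 1
      with g have "h = f' * g" by (simp only: mult.assoc mult_cancel_left) simp
      then show ?thesis using 1 by auto
    next
      case 2
      then have "[:- a, 1:] * h = [:- a, 1:] * (f * g')" using g by (simp only: mult.left_commute)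
      then have "h = f * g'" by (simp only: mult_cancel_left) simp
      then show ?thesis by simp
    qed
  qed
  have base: "\<exists>c j. c \<noteq> 0 \<and> f = [:c:] * [:-1, 1:] ^ j" if "f dvd [:-1, 1:] ^ n" for n and f :: "'k poly"
    using that
  proof (induction n arbitrary: f)
    case 0
    then obtain c where "f = [:c:]" "c dvd 1" by (auto simp: is_unit_poly_iff)
    then show ?case by (intro exI[of _ c] exI[of _ 0]) auto
  next
    case (Suc n)
    have "f dvd [:- 1, 1:] * [:-1, 1:] ^ n" using Suc.prems by (simp only: power_Suc)
    from linear[OF this] show ?case
    proof (elim disjE exE conjE)
      assume "f dvd [:-1, 1:] ^ n"
      then show ?case by (rule Suc.IH)
    next
      fix f' assume f': "f = [:- 1, 1:] * f'" "f' dvd [:-1, 1:] ^ n"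
      obtain c j where "c \<noteq> 0" "f' = [:c:] * [:-1, 1:] ^ j" using Suc.IH[OF f'(2)] by blast
      then show ?case using f'(1) by (intro exI[of _ c] exI[of _ "Suc j"]) (simp only: power_Suc mult.left_commute, simp)
    qed
  qed
  have "\<exists>c i j. c \<noteq> 0 \<and> f = [:c:] * [:0, 1:] ^ i * [:-1, 1:] ^ j"
    if "f dvd [:0, 1:] ^ m * [:-1, 1:] ^ n" for m and f :: "'k poly"
    using that
  proof (induction m arbitrary: f)
    case 0
    then obtain c j where "c \<noteq> 0" "f = [:c:] * [:-1, 1:] ^ j" using base[of f n] by auto
    then show ?case by (intro exI[of _ c] exI[of _ 0] exI[of _ j]) simp
  next
    case (Suc m)
    have "f dvd [:- 0, 1:] * ([:0, 1:] ^ m * [:-1, 1:] ^ n)"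
      using Suc.prems by (simp only: power_Suc mult.assoc minus_zero)
    from linear[OF this] show ?case
    proof (elim disjE exE conjE)
      assume "f dvd [:0, 1:] ^ m * [:-1, 1:] ^ n"
      then show ?case by (rule Suc.IH)
    next
      fix f' assume f': "f = [:- 0, 1:] * f'" "f' dvd [:0, 1:] ^ m * [:-1, 1:] ^ n"
      obtain c i j where "c \<noteq> 0" "f' = [:c:] * [:0, 1:] ^ i * [:-1, 1:] ^ j" using Suc.IH[OF f'(2)] by blast
      then show ?case using f'(1)
        by (intro exI[of _ c] exI[of _ "Suc i"] exI[of _ j]) (simp only: power_Suc mult.left_commute mult.assoc minus_zero, simp)
    qed
  qed
  from this[of f m] show ?thesis using that assms by (metis dvd_triv_left)
qed

definition laurent_units :: "'k::field poly fract set" where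
  "laurent_units = {u \<in> laurent_ring. u \<noteq> 0 \<and> inverse u \<in> laurent_ring}"

lemma laurent_unit_cases:
  assumes "u \<in> laurent_units"
  obtains c a b where "c \<noteq> 0" "u = unit_val c a b"
proof -
  have u: "u \<in> laurent_ring" "inverse u \<in> laurent_ring" "u \<noteq> 0" using assms by (auto simp: laurent_units_def)
  obtain f m n where f: "u = to_fract f / (tt ^ m * ss ^ n)" by (rule laurent_ringE[OF u(1)])
  obtain g m' n' where g: "inverse u = to_fract g / (tt ^ m' * ss ^ n')" by (rule laurent_ringE[OF u(2)])
  have "u * inverse u = 1" using u(3) by simp
  then have "to_fract (f * g) = to_fract ([:0, 1:] ^ (m + m') * [:-1, 1:] ^ (n + n'))"
    unfolding g unfolding f by (simp add: field_simps power_add)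
  then have "f * g = [:0, 1:] ^ (m + m') * [:-1, 1:] ^ (n + n')" by (simp only: to_fract_eq_iff)
  then obtain c i j where c: "c \<noteq> 0" "f = [:c:] * [:0, 1:] ^ i * [:-1, 1:] ^ j"
    by (rule divisor_of_monomial)
  have "u = unit_val c (int i - int m) (int j - int n)"
    unfolding f c(2) unit_val_def to_fract_mult to_fract_power by (simp add: power_int_diff field_simps)
  with c(1) show ?thesis by (rule that)
qed

lemma laurent_units_mult: "u \<in> laurent_units \<Longrightarrow> v \<in> laurent_units \<Longrightarrow> u * v \<in> laurent_units"
  by (auto simp: laurent_units_def)

lemma laurent_units_inverse: "u \<in> laurent_units \<Longrightarrow> inverse u \<in> laurent_units"
  by (auto simp: laurent_units_def)

lemma one_in_laurent_units [simp]: "1 \<in> laurent_units"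
  by (simp add: laurent_units_def)

lemma laurent_unitsD: "u \<in> laurent_units \<Longrightarrow> u \<in> laurent_ring \<and> u \<noteq> 0 \<and> inverse u \<in> laurent_ring"
  by (simp add: laurent_units_def)

lemma scalar_in_laurent_units: "c \<noteq> 0 \<Longrightarrow> scalar c \<in> laurent_units"
  by (simp add: laurent_units_def scalar_inverse)

lemma unit_gens_in_laurent_units: "\<kappa> \<in> unit_gens \<Longrightarrow> \<kappa> \<in> laurent_units"
  by (auto simp: laurent_units_def)

abbreviation AG :: "'k::field poly fract mat monoid" where "AG \<equiv> A4 laurent_ring"

lemma AG_simps [simp]: "x \<otimes>\<^bsub>AG\<^esub> y = x * y" "\<one>\<^bsub>AG\<^esub> = 1\<^sub>m 4"
  by (simp_all add: A4_def)

lemma carrier_AG: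
  "M \<in> carrier AG \<longleftrightarrow> (\<exists>u v a12 a13 a14 a23 a24 a34. M = m4 u v a12 a13 a14 a23 a24 a34 \<and>
     u \<in> laurent_units \<and> v \<in> laurent_units \<and> a12 \<in> laurent_ring \<and> a13 \<in> laurent_ring \<and> a14 \<in> laurent_ring \<and>
     a23 \<in> laurent_ring \<and> a24 \<in> laurent_ring \<and> a34 \<in> laurent_ring)" (is "_ \<longleftrightarrow> ?R")
proof
  assume M: "M \<in> carrier AG"
  then have c: "M \<in> carrier_mat 4 4" and ut: "upper_triangular M" and R: "\<And>i j. i < 4 \<Longrightarrow> j < 4 \<Longrightarrow> M $$ (i, j) \<in> laurent_ring"
    and d: "M $$ (0, 0) = 1" "M $$ (3, 3) = 1" "\<exists>u\<in>laurent_ring. M $$ (1, 1) * u = 1" "\<exists>u\<in>laurent_ring. M $$ (2, 2) * u = 1"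
    by (auto simp: A4_def)
  have z: "M $$ (i, j) = 0" if "j < i" "i < 4" for i j
    using ut c that by (auto simp: upper_triangular_def)
  have unit: "x \<in> laurent_units" if x: "x \<in> laurent_ring" "\<exists>u\<in>laurent_ring. x * u = 1" for x :: "'a poly fract"
  proof -
    obtain u where u: "u \<in> laurent_ring" "x * u = 1" using x(2) by blast
    then have "inverse x = u" "x \<noteq> 0" by (auto simp: inverse_unique)
    with u x(1) show ?thesis by (simp add: laurent_units_def)
  qed
  have "M = m4 (M $$ (1, 1)) (M $$ (2, 2)) (M $$ (0, 1)) (M $$ (0, 2)) (M $$ (0, 3)) (M $$ (1, 2)) (M $$ (1, 3)) (M $$ (2, 3))"
    (is "_ = ?M")
  proof (rule eq_matI)
    fix i j assume "i < dim_row ?M" "j < dim_col ?M"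
    then have ij: "i < 4" "j < 4" by simp_all
    then show "M $$ (i, j) = ?M $$ (i, j)"
      unfolding less_4_cases by (elim disjE; simp add: m4_entries d z del: One_nat_def)
  qed (use c in auto)
  moreover have "M $$ (1, 1) \<in> laurent_units" "M $$ (2, 2) \<in> laurent_units"
    by (rule unit[OF R d(3)]; simp) (rule unit[OF R d(4)]; simp)
  moreover have "M $$ (0, 1) \<in> laurent_ring" "M $$ (0, 2) \<in> laurent_ring" "M $$ (0, 3) \<in> laurent_ring"
    "M $$ (1, 2) \<in> laurent_ring" "M $$ (1, 3) \<in> laurent_ring" "M $$ (2, 3) \<in> laurent_ring"
    by (rule R; simp)+
  ultimately show ?R by blast
next
  assume ?R
  then obtain u v a12 a13 a14 a23 a24 a34 where M: "M = m4 u v a12 a13 a14 a23 a24 a34"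
    and *: "u \<in> laurent_units" "v \<in> laurent_units" "a12 \<in> laurent_ring" "a13 \<in> laurent_ring" "a14 \<in> laurent_ring"
     "a23 \<in> laurent_ring" "a24 \<in> laurent_ring" "a34 \<in> laurent_ring" by blast
  have 1: "M $$ (i, j) \<in> laurent_ring" if "i < 4" "j < 4" for i j
    using that laurent_unitsD[OF *(1)] laurent_unitsD[OF *(2)] * unfolding M less_4_cases
    by (elim disjE) (simp_all add: m4_entries del: One_nat_def)
  have 2: "upper_triangular M"
  proof (rule upper_triangularI)
    fix i j assume "j < i" "i < dim_row M"
    then have "(i = 1 \<and> j = 0) \<or> (i = 2 \<and> j = 0) \<or> (i = 2 \<and> j = 1) \<or> (i = 3 \<and> j = 0) \<or> (i = 3 \<and> j = 1) \<or> (i = 3 \<and> j = 2)"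
      unfolding M by auto
    then show "M $$ (i, j) = 0" unfolding M by (elim disjE conjE) (simp_all add: m4_entries del: One_nat_def)
  qed
  have 3: "\<exists>w\<in>laurent_ring. u * w = 1" "\<exists>w\<in>laurent_ring. v * w = 1"
    using laurent_unitsD[OF *(1)] laurent_unitsD[OF *(2)] by (auto intro: bexI[of _ "inverse u"] bexI[of _ "inverse v"])
  show "M \<in> carrier AG"
    using 1 2 3 unfolding A4_def by (auto simp: M m4_entries simp del: One_nat_def)
qed

lemma AG_m4:
  assumes "u \<in> laurent_units" "v \<in> laurent_units" "a12 \<in> laurent_ring" "a13 \<in> laurent_ring" "a14 \<in> laurent_ring"
     "a23 \<in> laurent_ring" "a24 \<in> laurent_ring" "a34 \<in> laurent_ring"
  shows "m4 u v a12 a13 a14 a23 a24 a34 \<in> carrier AG"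
  using assms unfolding carrier_AG by blast

lemma AG_carrier_mat: "M \<in> carrier AG \<Longrightarrow> M \<in> carrier_mat 4 4"
  by (simp add: A4_def)

lemma group_AG: "group (AG :: 'k::field poly fract mat monoid)"
proof (rule groupI)
  fix x y :: "'k poly fract mat" assume "x \<in> carrier AG" "y \<in> carrier AG"
  then show "x \<otimes>\<^bsub>AG\<^esub> y \<in> carrier AG"
    unfolding carrier_AG[of x] carrier_AG[of y]
    by (elim exE conjE) (simp add: m4_mult AG_m4 laurent_units_mult laurent_unitsD)
next
  show "\<one>\<^bsub>AG\<^esub> \<in> carrier AG" by (simp add: one_mat_4 AG_m4)
next
  fix x y z :: "'k poly fract mat" assume "x \<in> carrier AG" "y \<in> carrier AG" "z \<in> carrier AG"
  then show "x \<otimes>\<^bsub>AG\<^esub> y \<otimes>\<^bsub>AG\<^esub> z = x \<otimes>\<^bsub>AG\<^esub> (y \<otimes>\<^bsub>AG\<^esub> z)"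
    by (simp add: assoc_mult_mat[of _ 4 4 _ 4 _ 4] AG_carrier_mat)
next
  fix x :: "'k poly fract mat" assume "x \<in> carrier AG"
  then show "\<one>\<^bsub>AG\<^esub> \<otimes>\<^bsub>AG\<^esub> x = x" by (simp add: AG_carrier_mat)
next
  fix x :: "'k poly fract mat" assume "x \<in> carrier AG"
  then obtain u v a12 a13 a14 a23 a24 a34 where x: "x = m4 u v a12 a13 a14 a23 a24 a34"
    and *: "u \<in> laurent_units" "v \<in> laurent_units" "a12 \<in> laurent_ring" "a13 \<in> laurent_ring" "a14 \<in> laurent_ring"
     "a23 \<in> laurent_ring" "a24 \<in> laurent_ring" "a34 \<in> laurent_ring" unfolding carrier_AG by blast
  define b34 where "b34 = - (inverse v * a34)"
  define b23 where "b23 = - (inverse u * a23 * inverse v)"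
  define b24 where "b24 = - (inverse u * a24 + b23 * a34)"
  define b12 where "b12 = - (a12 * inverse u)"
  define b13 where "b13 = - ((a13 + b12 * a23) * inverse v)"
  define b14 where "b14 = - (a14 + b12 * a24 + b13 * a34)"
  note uv = laurent_unitsD[OF *(1)] laurent_unitsD[OF *(2)]
  have "m4 (inverse u) (inverse v) b12 b13 b14 b23 b24 b34 * x = 1\<^sub>m 4"
    unfolding x m4_mult one_mat_4 m4_eq_iff b34_def b24_def b14_def b13_def b23_def b12_def using uv by simp
  moreover have "m4 (inverse u) (inverse v) b12 b13 b14 b23 b24 b34 \<in> carrier AG"
    unfolding b34_def b24_def b14_def b13_def b23_def b12_def
    using * uv by (intro AG_m4 laurent_units_inverse uminus_in_laurent_ring add_in_laurent_ring mult_in_laurent_ring) auto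
  ultimately show "\<exists>y\<in>carrier AG. y \<otimes>\<^bsub>AG\<^esub> x = \<one>\<^bsub>AG\<^esub>" by auto
qed

interpretation AG: group "AG :: 'k::field poly fract mat monoid" by (rule group_AG)

lemma AG_inv_eqI: "x \<in> carrier AG \<Longrightarrow> y \<in> carrier AG \<Longrightarrow> y * x = 1\<^sub>m 4 \<Longrightarrow> inv\<^bsub>AG\<^esub> x = y"
  using AG.inv_equality[of y x] by simp

lemma diag4_in_AG: "u \<in> laurent_units \<Longrightarrow> v \<in> laurent_units \<Longrightarrow> diag4 u v \<in> carrier AG"
  unfolding diag4_def by (intro AG_m4) auto

lemma root_mat_in_AG: "r \<in> laurent_ring \<Longrightarrow> root_mat \<rho> r \<in> carrier AG"
  by (cases \<rho>) (simp_all add: AG_m4)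

lemma e14_in_AG: "r \<in> laurent_ring \<Longrightarrow> e14 r \<in> carrier AG"
  by (simp add: e14_def AG_m4)

lemma inv_diag4: "u \<in> laurent_units \<Longrightarrow> v \<in> laurent_units \<Longrightarrow> inv\<^bsub>AG\<^esub> (diag4 u v) = diag4 (inverse u) (inverse v)"
  by (rule AG_inv_eqI)
     (auto simp: diag4_in_AG laurent_units_inverse diag4_mult dest!: laurent_unitsD, simp add: diag4_def one_mat_4)

lemma inv_root_mat: "r \<in> laurent_ring \<Longrightarrow> inv\<^bsub>AG\<^esub> (root_mat \<rho> r) = root_mat \<rho> (- r)"
  by (rule AG_inv_eqI) (auto simp: root_mat_in_AG root_mat_add, cases \<rho>, auto simp: one_mat_4)

lemma letters_cases:
  assumes "w \<in> letters"
  obtains \<rho> c where "w = root_mat \<rho> (scalar c)"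
    | c d where "w = diag4 (scalar c) (scalar d)" "c \<noteq> 0" "d \<noteq> 0"
    | \<kappa> where "w = diag4 \<kappa> 1" "\<kappa> \<in> unit_gens" | \<kappa> where "w = diag4 1 \<kappa>" "\<kappa> \<in> unit_gens"
  using assms unfolding letters_def torus_letters_def by blast

lemma letters_in_AG: "letters \<subseteq> carrier AG"
proof
  fix w :: "'a poly fract mat" assume "w \<in> letters"
  then show "w \<in> carrier AG"
    by (cases rule: letters_cases)
       (simp_all only: root_mat_in_AG to_fract_in_laurent_ring diag4_in_AG scalar_in_laurent_units
         unit_gens_in_laurent_units one_in_laurent_units not_False_eq_True)
qed

lemma finite_letters: "finite (letters :: 'k::{field,finite} poly fract mat set)"
proof -
  have "(UNIV :: root set) = {R12, R13, R23, R24, R34}" using root.exhaust by auto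
  then have "finite (UNIV :: root set)" by (metis finite.emptyI finite.insertI)
  then have fin: "finite (UNIV :: (root \<times> 'k) set)" "finite (UNIV :: ('k \<times> 'k) set)"
    by (simp_all add: finite_prod)
  let ?R = "range (\<lambda>(\<rho>, c :: 'k). root_mat \<rho> (scalar c)) \<union> range (\<lambda>(c :: 'k, d). diag4 (scalar c) (scalar d))
     \<union> (\<lambda>\<kappa>. diag4 \<kappa> 1) ` unit_gens \<union> (\<lambda>\<kappa>. diag4 1 \<kappa>) ` unit_gens"
  have "letters \<subseteq> ?R"
  proof
    fix w :: "'k poly fract mat" assume "w \<in> letters"
    then show "w \<in> ?R"
    proof (cases rule: letters_cases)
      case (1 \<rho> c)
      then have "w = (\<lambda>(\<rho>, c :: 'k). root_mat \<rho> (scalar c)) (\<rho>, c)" by simp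
      then show ?thesis by blast
    next
      case (2 c d)
      then have "w = (\<lambda>(c :: 'k, d). diag4 (scalar c) (scalar d)) (c, d)" by simp
      then show ?thesis by blast
    qed blast+
  qed
  moreover have "finite ?R" using fin by (intro finite_UnI finite_imageI) simp_all
  ultimately show ?thesis by (rule finite_subset)
qed

lemma inv_letters:
  assumes "w \<in> letters" shows "inv\<^bsub>AG\<^esub> w \<in> letters"
proof -
  from assms show ?thesis
  proof (cases rule: letters_cases)
    case (1 \<rho> c)
    then have "inv\<^bsub>AG\<^esub> w = root_mat \<rho> (scalar (- c))" by (simp only: inv_root_mat[OF to_fract_in_laurent_ring] scalar_minus)
    then show ?thesis unfolding letters_def by blast
  next
    case (2 c d)
    then have "inv\<^bsub>AG\<^esub> w = diag4 (scalar (inverse c)) (scalar (inverse d))"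
      by (simp only: inv_diag4[OF scalar_in_laurent_units scalar_in_laurent_units] scalar_inverse not_False_eq_True)
    moreover have "inverse c \<noteq> 0" "inverse d \<noteq> 0" using 2 by auto
    ultimately show ?thesis unfolding letters_def torus_letters_def by blast
  next
    case (3 \<kappa>)
    then have "inv\<^bsub>AG\<^esub> w = diag4 (inverse \<kappa>) 1" by (simp add: inv_diag4[OF unit_gens_in_laurent_units])
    moreover have "inverse \<kappa> \<in> unit_gens" using 3 by auto
    ultimately show ?thesis unfolding letters_def torus_letters_def by blast
  next
    case (4 \<kappa>)
    then have "inv\<^bsub>AG\<^esub> w = diag4 1 (inverse \<kappa>)" by (simp add: inv_diag4[OF _ unit_gens_in_laurent_units])
    moreover have "inverse \<kappa> \<in> unit_gens" using 4 by auto
    ultimately show ?thesis unfolding letters_def torus_letters_def by blast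
  qed
qed

lemma sym_set_letters: "sym_set AG letters = letters"
  using inv_letters by (auto simp: sym_set_def)

lemma gprod_AG: "gprod AG ws = mprod ws"
  by (induction ws) simp_all

text \<open>Conjugation by diagonal letters produces all elements of a root subgroup from constants, and
  commutators produce the corner entries.\<close>
lemma generate_letters: "generate AG letters = carrier (AG :: 'k::field poly fract mat monoid)"
proof
  let ?H = "generate AG (letters :: 'k poly fract mat set)"
  show "?H \<subseteq> carrier AG" by (rule AG.generate_incl[OF letters_in_AG])
  have mult: "x * y \<in> ?H" if "x \<in> ?H" "y \<in> ?H" for x y using generate.eng[OF that] by simp
  have letter: "x \<in> ?H" if "x \<in> letters" for x using that by (rule generate.incl)
  have unit2: "diag4 \<kappa> 1 \<in> ?H" "diag4 1 \<kappa> \<in> ?H" if "\<kappa> \<in> unit_gens" for \<kappa>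
  proof -
    have "diag4 \<kappa> 1 \<in> letters" "diag4 1 \<kappa> \<in> letters"
      using that unfolding letters_def torus_letters_def by blast+
    then show "diag4 \<kappa> 1 \<in> ?H" "diag4 1 \<kappa> \<in> ?H" by (simp_all only: letter)
  qed
  have scal: "diag4 (scalar c) (scalar d) \<in> ?H" if "c \<noteq> 0" "d \<noteq> 0" for c d
    using that by (intro letter) (unfold letters_def torus_letters_def, blast)
  have pow2: "diag4 (\<kappa> powi i) 1 \<in> ?H" and pow3: "diag4 1 (\<kappa> powi i) \<in> ?H" if "\<kappa> = tt \<or> \<kappa> = ss" for \<kappa> i
  proof -
    have u: "\<kappa> \<noteq> 0" "\<kappa> \<in> unit_gens" "inverse \<kappa> \<in> unit_gens" using that by auto
    have "diag4 (\<kappa> powi i) 1 \<in> ?H \<and> diag4 1 (\<kappa> powi i) \<in> ?H"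
    proof (induction i rule: int_induct[of _ 0])
      case base
      show ?case using scal[of 1 1] by simp
    next
      case (step1 i)
      then show ?case using mult[OF unit2(1)[OF u(2)], of "diag4 (\<kappa> powi i) 1"] mult[OF unit2(2)[OF u(2)], of "diag4 1 (\<kappa> powi i)"] u(1)
        by (simp add: diag4_mult power_int_add mult.commute)
    next
      case (step2 i)
      then show ?case using mult[OF unit2(1)[OF u(3)], of "diag4 (\<kappa> powi i) 1"] mult[OF unit2(2)[OF u(3)], of "diag4 1 (\<kappa> powi i)"] u(1)
        by (simp add: diag4_mult power_int_diff divide_inverse mult.commute)
    qed
    then show "diag4 (\<kappa> powi i) 1 \<in> ?H" "diag4 1 (\<kappa> powi i) \<in> ?H" by auto
  qed
  have diag: "diag4 u v \<in> ?H" if uv: "u \<in> laurent_units" "v \<in> laurent_units" for u v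
  proof -
    obtain c a b where u: "c \<noteq> 0" "u = unit_val c a b" by (rule laurent_unit_cases[OF uv(1)])
    obtain c' a' b' where v: "c' \<noteq> 0" "v = unit_val c' a' b'" by (rule laurent_unit_cases[OF uv(2)])
    have "diag4 u v = diag4 (scalar c) (scalar c') * (diag4 (tt powi a) 1 * (diag4 (ss powi b) 1 *
        (diag4 1 (tt powi a') * diag4 1 (ss powi b'))))"
      unfolding u v unit_val_def diag4_mult by (simp add: mult.assoc)
    also have "\<dots> \<in> ?H" using u v by (intro mult scal pow2 pow3) auto
    finally show ?thesis .
  qed
  have root: "root_mat \<rho> r \<in> ?H" if "r \<in> laurent_ring" for \<rho> r
    using that
  proof (induction rule: laurent_ring_induct)
    case (scalar c)
    show ?case by (rule letter) (unfold letters_def, blast)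
  next
    case (add x y)
    then show ?case unfolding root_mat_add[symmetric] by (intro mult)
  next
    case (unit \<kappa> x)
    have \<kappa>: "\<kappa> \<noteq> 0" "inverse \<kappa> \<in> unit_gens" using unit(1) by auto
    have "unit_root \<rho> \<kappa> \<in> letters" "unit_root \<rho> (inverse \<kappa>) \<in> letters"
      using unit_root_in[OF unit(1)] unit_root_in[OF \<kappa>(2)] by (simp_all add: letters_def)
    then have "unit_root \<rho> \<kappa> \<in> ?H" "unit_root \<rho> (inverse \<kappa>) \<in> ?H" by (simp_all only: letter)
    then show ?case using mult unit unit_root_conj_mat'[OF \<kappa>(1), of \<rho> x] by metis
  qed
  have e14: "e14 r \<in> ?H" if "r \<in> laurent_ring" for r
  proof -
    have "e14 r = root_mat R12 r * (root_mat R24 1 * (root_mat R12 (- r) * root_mat R24 (- 1)))"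
      by (simp add: e14_def m4_mult m4_eq_iff)
    also have "\<dots> \<in> ?H" using that by (intro mult root) auto
    finally show ?thesis .
  qed
  show "carrier AG \<subseteq> ?H"
  proof
    fix M :: "'k poly fract mat" assume "M \<in> carrier AG"
    then obtain u v a12 a13 a14 a23 a24 a34 where M: "M = m4 u v a12 a13 a14 a23 a24 a34"
    and *: "u \<in> laurent_units" "v \<in> laurent_units" "a12 \<in> laurent_ring" "a13 \<in> laurent_ring" "a14 \<in> laurent_ring"
     "a23 \<in> laurent_ring" "a24 \<in> laurent_ring" "a34 \<in> laurent_ring" unfolding carrier_AG by blast
    note uv = laurent_unitsD[OF *(1)] laurent_unitsD[OF *(2)]
    have "M = root_mat R34 a34 * (root_mat R24 a24 * (root_mat R23 (a23 * inverse v) * (e14 a14 *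
        (root_mat R13 (a13 * inverse v) * (root_mat R12 (a12 * inverse u) * diag4 u v)))))"
      unfolding M using uv by (simp add: e14_def diag4_def m4_mult m4_eq_iff)
    also have "\<dots> \<in> ?H" using * uv by (intro mult root e14 diag) auto
    finally show "M \<in> ?H" .
  qed
qed

lemma finite_generating_set_letters:
  "finite_generating_set AG (letters :: 'k::{field,finite} poly fract mat set)"
  unfolding finite_generating_set_def using finite_letters letters_in_AG generate_letters by blast

section \<open>Central subgroups\<close>

definition central_part :: "nat set \<Rightarrow> 'k::field poly fract mat set" where
  "central_part N = {e14 (to_fract f) | f. \<forall>n. coeff f n \<noteq> 0 \<longrightarrow> n \<in> N}"

lemma e14_mult: "e14 r * e14 r' = e14 (r + r')"
  by (simp add: e14_def m4_mult add.commute)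

lemma e14_0: "e14 0 = 1\<^sub>m 4"
  by (simp add: e14_def one_mat_4)

lemma e14_eq_iff [simp]: "e14 r = e14 r' \<longleftrightarrow> r = r'"
  by (simp add: e14_def m4_eq_iff)

lemma inv_e14: "r \<in> laurent_ring \<Longrightarrow> inv\<^bsub>AG\<^esub> (e14 r) = e14 (- r)"
  by (rule AG_inv_eqI) (simp_all add: e14_in_AG e14_mult e14_0)

lemma e14_central: "M \<in> carrier AG \<Longrightarrow> e14 r * M = M * e14 r"
  unfolding carrier_AG by (auto simp: e14_def m4_mult m4_eq_iff)

lemma subgroup_central_part: "subgroup (central_part N :: 'k::field poly fract mat set) AG"
proof (rule AG.subgroupI)
  show "central_part N \<subseteq> (carrier AG :: 'k poly fract mat set)" by (auto simp: central_part_def e14_in_AG)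
  have "e14 (to_fract (0 :: 'k poly)) \<in> central_part N" unfolding central_part_def by (rule CollectI, rule exI[of _ 0]) simp
  then show "central_part N \<noteq> ({} :: 'k poly fract mat set)" by blast
next
  fix a :: "'k poly fract mat" assume "a \<in> central_part N"
  then obtain f where f: "a = e14 (to_fract f)" "\<forall>n. coeff f n \<noteq> 0 \<longrightarrow> n \<in> N" unfolding central_part_def by blast
  have "inv\<^bsub>AG\<^esub> a = e14 (to_fract (- f))" by (simp add: f inv_e14)
  then show "inv\<^bsub>AG\<^esub> a \<in> central_part N" unfolding central_part_def using f(2) by (intro CollectI exI[of _ "- f"]) simp
next
  fix a b :: "'k poly fract mat" assume "a \<in> central_part N" "b \<in> central_part N"
  then obtain f g where f: "a = e14 (to_fract f)" "\<forall>n. coeff f n \<noteq> 0 \<longrightarrow> n \<in> N"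
    and g: "b = e14 (to_fract g)" "\<forall>n. coeff g n \<noteq> 0 \<longrightarrow> n \<in> N" unfolding central_part_def by blast
  have "a \<otimes>\<^bsub>AG\<^esub> b = e14 (to_fract (f + g))" by (simp add: f g e14_mult)
  moreover have "\<forall>n. coeff (f + g) n \<noteq> 0 \<longrightarrow> n \<in> N" using f g by (metis add_0 coeff_add)
  ultimately show "a \<otimes>\<^bsub>AG\<^esub> b \<in> central_part N" unfolding central_part_def by blast
qed

lemma central_part_central: "central_part N \<subseteq> group_center AG"
  by (auto simp: central_part_def group_center_def e14_in_AG e14_central)

lemma mprod_in_AG: "set ws \<subseteq> letters \<Longrightarrow> mprod ws \<in> carrier AG"
  using AG.gprod_closed[of ws] letters_in_AG unfolding gprod_AG by blast

section \<open>The group of all permutations of a type\<close>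

text \<open>Permutations are composed from left to right, so that a sum of permutations along a word moves
  a point letter by letter.\<close>
typedef 'a perm = "{f :: 'a \<Rightarrow> 'a. bij f}"
  by (rule exI[of _ id]) simp

setup_lifting type_definition_perm

instantiation perm :: (type) group_add
begin
lift_definition zero_perm :: "'a perm" is id by simp
lift_definition plus_perm :: "'a perm \<Rightarrow> 'a perm \<Rightarrow> 'a perm" is "\<lambda>f g. g \<circ> f" by (simp add: bij_comp)
lift_definition uminus_perm :: "'a perm \<Rightarrow> 'a perm" is "\<lambda>f. inv_into UNIV f" by (simp add: bij_imp_bij_inv)
lift_definition minus_perm :: "'a perm \<Rightarrow> 'a perm \<Rightarrow> 'a perm" is "\<lambda>f g. inv_into UNIV g \<circ> f" by (simp add: bij_comp bij_imp_bij_inv)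
instance
  by standard (transfer; auto simp: fun_eq_iff bij_is_surj surj_f_inv_f)+
end

section \<open>Quotients by central subgroups\<close>

text \<open>The generating set is closed under inverses, so that words in \<open>S\<close> suffice.\<close>
locale central_quotient = group G for G (structure) +
  fixes Z S :: "'a set"
  assumes Z_subgroup: "subgroup Z G" and Z_central: "Z \<subseteq> group_center G"
    and S: "finite_generating_set G S" and inv_S: "\<And>s. s \<in> S \<Longrightarrow> inv s \<in> S"
begin

abbreviation H where "H \<equiv> G Mod Z"
definition \<pi> where "\<pi> g = Z #> g"
abbreviation X where "X \<equiv> carrier H"
abbreviation dist_H where "dist_H \<equiv> word_dist H (\<pi> ` S)"
abbreviation len where "len \<equiv> word_length G S"

lemma S_carrier: "S \<subseteq> carrier G"
  using S by (simp add: finite_generating_set_def)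

lemma Z_carrier: "z \<in> Z \<Longrightarrow> z \<in> carrier G"
  using subgroup.mem_carrier[OF Z_subgroup] .

lemma Z_commutes: "z \<in> Z \<Longrightarrow> g \<in> carrier G \<Longrightarrow> z \<otimes> g = g \<otimes> z"
  using Z_central by (auto simp: group_center_def)

lemma Z_normal: "Z \<lhd> G"
proof (rule normalI[OF Z_subgroup])
  show "\<forall>x\<in>carrier G. Z #> x = x <# Z"
    unfolding r_coset_def l_coset_def
    by (rule ballI, rule SUP_cong[OF refl]) (simp add: Z_commutes)
qed

sublocale quot: group_hom G H \<pi>
  unfolding group_hom_def group_hom_axioms_def \<pi>_def
  using group_axioms normal.factorgroup_is_group[OF Z_normal] normal.r_coset_hom_Mod[OF Z_normal] by blast

lemma \<pi>_surj: "\<pi> ` carrier G = X"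
  by (auto simp: \<pi>_def carrier_FactGroup)

lemma \<pi>_eq_one_iff: "g \<in> carrier G \<Longrightarrow> \<pi> g = \<one>\<^bsub>H\<^esub> \<longleftrightarrow> g \<in> Z"
  unfolding \<pi>_def one_FactGroup
  using coset_join1[OF _ _ Z_subgroup] coset_join2[OF _ Z_subgroup] subgroup.subset[OF Z_subgroup] by blast

lemma finite_generating_set_quotient: "finite_generating_set H (\<pi> ` S)"
  using S \<pi>_surj quot.generate_img[OF S_carrier] S_carrier
  unfolding finite_generating_set_def by auto

lemma sym_set_S: "sym_set G S = S"
  using inv_S by (auto simp: sym_set_def)

lemma sym_set_quotient: "sym_set H (\<pi> ` S) = \<pi> ` S"
proof -
  have "inv\<^bsub>H\<^esub> (\<pi> s) = \<pi> (inv s)" if "s \<in> S" for s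
    using that S_carrier quot.hom_inv by auto
  then show ?thesis using inv_S by (auto simp: sym_set_def)
qed

lemma gprod_in: "set ws \<subseteq> S \<Longrightarrow> gprod G ws \<in> carrier G"
  using S_carrier by (intro gprod_closed) auto

lemma gprod_quotient: "set ws \<subseteq> S \<Longrightarrow> gprod H (map \<pi> ws) = \<pi> (gprod G ws)"
proof (induction ws)
  case Nil
  show ?case unfolding list.map gprod_simps by (rule quot.hom_one[symmetric])
next
  case (Cons a ws)
  have "a \<in> carrier G" "gprod G ws \<in> carrier G" using Cons.prems S_carrier gprod_in by auto
  from quot.hom_mult[OF this] show ?case using Cons by (simp del: mult_FactGroup)
qed

definition act (infixl "\<cdot>" 70) where "x \<cdot> g = x \<otimes>\<^bsub>H\<^esub> \<pi> g"

lemma act_closed [simp]: "x \<in> X \<Longrightarrow> g \<in> carrier G \<Longrightarrow> x \<cdot> g \<in> X"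
  unfolding act_def by (intro quot.H.m_closed quot.hom_closed)

lemma act_mult: "x \<in> X \<Longrightarrow> g \<in> carrier G \<Longrightarrow> h \<in> carrier G \<Longrightarrow> x \<cdot> (g \<otimes> h) = x \<cdot> g \<cdot> h"
  unfolding act_def by (simp only: quot.hom_mult quot.H.m_assoc quot.hom_closed)

lemma act_one [simp]: "x \<in> X \<Longrightarrow> x \<cdot> \<one> = x"
  unfolding act_def by (simp only: quot.hom_one quot.H.r_one)

lemma act_fixes_iff:
  assumes "x \<in> X" "g \<in> carrier G" shows "x \<cdot> g = x \<longleftrightarrow> g \<in> Z"
  using quot.H.l_cancel_one[OF assms(1) quot.hom_closed[OF assms(2)]] \<pi>_eq_one_iff[OF assms(2)]
  unfolding act_def by (simp only:)

lemma act_Z: "x \<in> X \<Longrightarrow> z \<in> Z \<Longrightarrow> x \<cdot> z = x"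
  using act_fixes_iff Z_carrier by blast

lemma act_inv: "x \<in> X \<Longrightarrow> g \<in> carrier G \<Longrightarrow> x \<cdot> g \<cdot> inv g = x" "x \<in> X \<Longrightarrow> g \<in> carrier G \<Longrightarrow> x \<cdot> inv g \<cdot> g = x"
  by (simp_all add: act_mult[symmetric])

lemma dist_act: "x \<in> X \<Longrightarrow> set ws \<subseteq> S \<Longrightarrow> dist_H x (x \<cdot> gprod G ws) \<le> length ws"
proof -
  assume x: "x \<in> X" and ws: "set ws \<subseteq> S"
  have "inv\<^bsub>H\<^esub> x \<otimes>\<^bsub>H\<^esub> (x \<cdot> gprod G ws) = gprod H (map \<pi> ws)"
    unfolding act_def gprod_quotient[OF ws] using quot.hom_closed[OF gprod_in[OF ws]] x
    by (simp only: quot.H.inv_solve_left' quot.H.m_closed)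
  moreover have "set (map \<pi> ws) \<subseteq> sym_set H (\<pi> ` S)" unfolding sym_set_quotient using ws by auto
  ultimately have "word_length H (\<pi> ` S) (inv\<^bsub>H\<^esub> x \<otimes>\<^bsub>H\<^esub> (x \<cdot> gprod G ws)) \<le> length (map \<pi> ws)"
    by (intro quot.H.word_length_le) simp_all
  then show ?thesis unfolding word_dist_def by simp
qed

lemma dist_word:
  assumes x: "x \<in> X" and y: "y \<in> X"
  obtains ws where "set ws \<subseteq> S" "x \<cdot> gprod G ws = y" "real (length ws) = dist_H x y"
proof -
  have "inv\<^bsub>H\<^esub> x \<otimes>\<^bsub>H\<^esub> y \<in> X" using x y by (intro quot.H.m_closed quot.H.inv_closed)
  then obtain vs where vs: "set vs \<subseteq> \<pi> ` S" "gprod H vs = inv\<^bsub>H\<^esub> x \<otimes>\<^bsub>H\<^esub> y"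
    "length vs = word_length H (\<pi> ` S) (inv\<^bsub>H\<^esub> x \<otimes>\<^bsub>H\<^esub> y)"
    using quot.H.shortest_word[OF finite_generating_set_quotient] sym_set_quotient by metis
  have "vs \<in> lists (\<pi> ` S)" using vs(1) by auto
  then obtain ws where ws: "set ws \<subseteq> S" "vs = map \<pi> ws"
    unfolding lists_image by auto
  have "x \<cdot> gprod G ws = x \<otimes>\<^bsub>H\<^esub> (inv\<^bsub>H\<^esub> x \<otimes>\<^bsub>H\<^esub> y)"
    unfolding act_def gprod_quotient[OF ws(1), symmetric] ws(2)[symmetric] vs(2) ..
  also have "\<dots> = y" 
    using x y by (simp only: quot.H.m_assoc[symmetric] quot.H.r_inv quot.H.l_one quot.H.inv_closed)
  finally show ?thesis using that[OF ws(1)] vs(3) unfolding word_dist_def ws(2) by simp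
qed

lemma pseudometric: "pseudometric_on X dist_H"
  by (rule quot.H.pseudometric_word_dist[OF finite_generating_set_quotient])

text \<open>The sum of \<open>c\<close> along the path in \<open>G / Z\<close> that starts at \<open>x\<close> and is labelled by the word.\<close>
primrec integral :: "('a set \<Rightarrow> 'a set \<Rightarrow> 'v::ab_group_add) \<Rightarrow> 'a set \<Rightarrow> 'a list \<Rightarrow> 'v" where
  "integral c x [] = 0"
| "integral c x (s # ws) = c x (x \<cdot> s) + integral c (x \<cdot> s) ws"

lemma integral_append:
  "x \<in> X \<Longrightarrow> set us \<subseteq> S \<Longrightarrow> integral c x (us @ vs) = integral c x us + integral c (x \<cdot> gprod G us) vs"
proof (induction us arbitrary: x)
  case (Cons s us)
  have s: "s \<in> carrier G" "gprod G us \<in> carrier G" using Cons.prems S_carrier gprod_in by auto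
  then have "integral c (x \<cdot> s) (us @ vs) = integral c (x \<cdot> s) us + integral c (x \<cdot> s \<cdot> gprod G us) vs"
    using Cons by simp
  then show ?case using act_mult[OF Cons.prems(1) s] by (simp add: add.assoc)
qed simp

lemma integral_short:
  assumes c: "coarse_cocycle X dist_H r c"
  shows "x \<in> X \<Longrightarrow> set ws \<subseteq> S \<Longrightarrow> real (length ws) \<le> r \<Longrightarrow> integral c x ws = c x (x \<cdot> gprod G ws)"
proof (induction ws arbitrary: x)
  case Nil
  then show ?case using coarse_cocycle_diag[OF c pseudometric] by simp
next
  case (Cons s ws)
  have s: "s \<in> carrier G" "gprod G ws \<in> carrier G" using Cons.prems S_carrier gprod_in by auto
  have "c x (x \<cdot> s) + c (x \<cdot> s) (x \<cdot> s \<cdot> gprod G ws) = c x (x \<cdot> s \<cdot> gprod G ws)"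
  proof (rule coarse_cocycleD[OF c])
    show "dist_H x (x \<cdot> s) \<le> r" using dist_act[of x "[s]"] Cons.prems s by simp
    show "dist_H (x \<cdot> s) (x \<cdot> s \<cdot> gprod G ws) \<le> r" using dist_act[of "x \<cdot> s" ws] Cons.prems s by simp
    show "dist_H x (x \<cdot> s \<cdot> gprod G ws) \<le> r"
      using dist_act[of x "s # ws"] Cons.prems s by (simp add: act_mult)
  qed (use Cons.prems s in auto)
  moreover have "integral c (x \<cdot> s) ws = c (x \<cdot> s) (x \<cdot> s \<cdot> gprod G ws)"
    using Cons s by simp
  ultimately show ?case using act_mult[OF Cons.prems(1) s] by simp
qed

lemma integral_sum:
  "integral c x ws = (\<Sum>k<length ws. c (x \<cdot> gprod G (take k ws)) (x \<cdot> gprod G (take (Suc k) ws)))"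
  if "x \<in> X" "set ws \<subseteq> S"
  using that
proof (induction ws arbitrary: x)
  case (Cons s ws)
  have s: "s \<in> carrier G" using Cons.prems S_carrier by auto
  have t: "gprod G (take k ws) \<in> carrier G" for k
    using Cons.prems(2) set_take_subset[of k ws] by (intro gprod_in) auto
  have "(\<Sum>k<length (s # ws). c (x \<cdot> gprod G (take k (s # ws))) (x \<cdot> gprod G (take (Suc k) (s # ws))))
     = c x (x \<cdot> s) + (\<Sum>k<length ws. c (x \<cdot> s \<cdot> gprod G (take k ws)) (x \<cdot> s \<cdot> gprod G (take (Suc k) ws)))"
    using Cons.prems s by (simp only: list.size add_0_right add_Suc_right sum.lessThan_Suc_shift take_Suc_Cons gprod_simps)
      (simp add: act_mult t)
  then show ?case using Cons s by simp
qed simp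

text \<open>A letter moves a point of \<open>G / Z\<close> and records the value of the cocycle on the edge. Equations between sums of
  these permutations are equations between sums of \<open>c\<close> along paths; in this form they can be derived from
  a presentation of \<open>G\<close>.\<close>
definition holonomy :: "('a set \<Rightarrow> 'a set \<Rightarrow> 'v::ab_group_add) \<Rightarrow> 'a \<Rightarrow> ('a set \<times> 'v) perm" where
  "holonomy c s = Abs_perm (\<lambda>(x, a). if x \<in> X then (x \<cdot> s, a + c x (x \<cdot> s)) else (x, a))"

lemma Rep_holonomy:
  fixes c :: "'a set \<Rightarrow> 'a set \<Rightarrow> 'v::ab_group_add"
  assumes c: "coarse_cocycle X dist_H r c" and r: "r \<ge> 1" and s: "s \<in> S"
  shows "Rep_perm (holonomy c s) (x, a) = (if x \<in> X then (x \<cdot> s, a + c x (x \<cdot> s)) else (x, a))"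
proof -
  let ?f = "\<lambda>s (x, a). if x \<in> X then (x \<cdot> s, a + c x (x \<cdot> s)) else (x, a :: 'v)"
  have inv: "?f (inv s) (?f s p) = p" if s: "s \<in> S" for s p
  proof (cases p)
    case (Pair x a)
    show ?thesis
    proof (cases "x \<in> X")
      case True
      have sc: "s \<in> carrier G" using s S_carrier by auto
      have "c x (x \<cdot> s) + c (x \<cdot> s) (x \<cdot> s \<cdot> inv s) = c x (x \<cdot> s \<cdot> inv s)"
        using dist_act[OF True, of "[s]"] dist_act[of "x \<cdot> s" "[inv s]"] True s sc inv_S[OF s] r
          pseudometric
        by (intro coarse_cocycleD[OF c]) (auto simp: act_inv pseudometric_on_def)
      also have "\<dots> = 0" using coarse_cocycle_diag[OF c pseudometric] True sc r by (simp add: act_inv)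
      finally show ?thesis using True sc by (simp add: Pair act_inv add.assoc)
    qed (simp add: Pair)
  qed
  have "bij (?f s)"
  proof (rule o_bij)
    show "?f (inv s) \<circ> ?f s = id" by (rule ext) (simp only: o_apply inv[OF s] id_apply)
    have "inv (inv s) = s" using S_carrier s by auto
    then show "?f s \<circ> ?f (inv s) = id" 
      using inv[OF inv_S[OF s]] by (intro ext) (simp only: o_apply id_apply)
  qed
  then show ?thesis unfolding holonomy_def by (subst Abs_perm_inverse) auto
qed

lemma Rep_sum_holonomy:
  fixes c :: "'a set \<Rightarrow> 'a set \<Rightarrow> 'v::ab_group_add"
  assumes c: "coarse_cocycle X dist_H r c" and r: "r \<ge> 1"
  shows "set ws \<subseteq> S \<Longrightarrow> Rep_perm (sum_list (map (holonomy c) ws)) (x, a) =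
    (if x \<in> X then (x \<cdot> gprod G ws, a + integral c x ws) else (x, a))"
proof (induction ws arbitrary: x a)
  case Nil
  then show ?case by (simp add: zero_perm.rep_eq)
next
  case (Cons s ws)
  have s: "s \<in> S" "s \<in> carrier G" "gprod G ws \<in> carrier G" using Cons.prems S_carrier gprod_in by auto
  show ?case using Cons s by (simp add: plus_perm.rep_eq Rep_holonomy[OF c r] act_mult add.assoc)
qed

text \<open>A short path stays in the region in which \<open>c\<close> is additive, hence its sum depends only on the endpoints.\<close>
lemma holonomy_relations:
  fixes c :: "'a set \<Rightarrow> 'a set \<Rightarrow> 'v::ab_group_add"
  assumes c: "coarse_cocycle X dist_H r c" and r: "r \<ge> 1"
    and us: "set us \<subseteq> S" "real (length us) \<le> r" and vs: "set vs \<subseteq> S" "real (length vs) \<le> r"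
    and eq: "gprod G us = gprod G vs"
  shows "sum_list (map (holonomy c) us) = sum_list (map (holonomy c) vs)"
proof -
  have "Rep_perm (sum_list (map (holonomy c) us)) (x, a) = Rep_perm (sum_list (map (holonomy c) vs)) (x, a)" for x a
    unfolding Rep_sum_holonomy[OF c r us(1)] Rep_sum_holonomy[OF c r vs(1)]
    using integral_short[OF c _ us] integral_short[OF c _ vs] eq by simp
  then show ?thesis by (intro Rep_perm_inject[THEN iffD1] ext) auto
qed

definition coset_rep :: "'a set \<Rightarrow> 'a" where "coset_rep x = (SOME g. g \<in> carrier G \<and> \<pi> g = x)"

lemma coset_rep: assumes "x \<in> X" shows "coset_rep x \<in> carrier G \<and> \<pi> (coset_rep x) = x"
proof -
  have "x \<in> \<pi> ` carrier G" using assms by (simp only: \<pi>_surj)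
  then have "\<exists>g. g \<in> carrier G \<and> \<pi> g = x" by (elim imageE) auto
  then show ?thesis unfolding coset_rep_def by (rule someI_ex)
qed

text \<open>Measures how far the chosen representatives of \<open>x\<close> and \<open>x \<cdot> g\<close> are from differing by \<open>g\<close>.\<close>
definition defect :: "'a set \<Rightarrow> 'a \<Rightarrow> 'a" where
  "defect x g = coset_rep x \<otimes> g \<otimes> inv (coset_rep (x \<cdot> g))"

lemma defect_in_Z: "x \<in> X \<Longrightarrow> g \<in> carrier G \<Longrightarrow> defect x g \<in> Z"
proof -
  assume x: "x \<in> X" and g: "g \<in> carrier G"
  note l = coset_rep[OF x] coset_rep[OF act_closed[OF x g]]
  have "\<pi> (defect x g) = x \<otimes>\<^bsub>H\<^esub> \<pi> g \<otimes>\<^bsub>H\<^esub> inv\<^bsub>H\<^esub> (x \<cdot> g)"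
    unfolding defect_def using l g by (simp only: quot.hom_mult quot.hom_inv m_closed inv_closed)
  also have "\<dots> = \<one>\<^bsub>H\<^esub>"
    unfolding act_def[symmetric] using x g by (intro quot.H.r_inv act_closed)
  finally show ?thesis using l g by (subst \<pi>_eq_one_iff[symmetric]) (auto simp: defect_def)
qed

lemma defect_mult:
  assumes x: "x \<in> X" and g: "g \<in> carrier G" and h: "h \<in> carrier G"
  shows "defect x (g \<otimes> h) = defect x g \<otimes> defect (x \<cdot> g) h"
proof -
  let ?a = "coset_rep x" and ?b = "coset_rep (x \<cdot> g)" and ?d = "coset_rep (x \<cdot> g \<cdot> h)"
  have l: "?a \<in> carrier G" "?b \<in> carrier G" "?d \<in> carrier G" using coset_rep x g h by auto
  have "?a \<otimes> g \<otimes> inv ?b \<otimes> (?b \<otimes> h \<otimes> inv ?d) = ?a \<otimes> g \<otimes> (inv ?b \<otimes> (?b \<otimes> (h \<otimes> inv ?d)))"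
    using l g h by (simp add: m_assoc)
  also have "inv ?b \<otimes> (?b \<otimes> (h \<otimes> inv ?d)) = h \<otimes> inv ?d"
    using l h by (simp add: m_assoc[symmetric])
  finally show ?thesis unfolding defect_def act_mult[OF x g h] using l g h by (simp add: m_assoc)
qed

lemma defect_Z:
  assumes x: "x \<in> X" and z: "z \<in> Z" shows "defect x z = z"
proof -
  have "coset_rep x \<otimes> z = z \<otimes> coset_rep x" using Z_commutes[OF z] coset_rep[OF x] by simp
  then show ?thesis unfolding defect_def act_Z[OF x z] using coset_rep[OF x] Z_carrier[OF z] by (simp add: m_assoc)
qed

text \<open>The value on \<open>(x, y)\<close> is \<open>\<chi>\<close> of the defect of some \<open>g\<close> of length at most \<open>r\<close> that leads from \<open>x\<close> to \<open>y\<close>. Different choices of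
  \<open>g\<close>, and the two ways around a triangle of diameter \<open>r\<close>, differ by an element of \<open>Z\<close> of length at most \<open>3r\<close>, on which \<open>\<chi>\<close>
  vanishes. Along a word the defects multiply, and for a word with product in \<open>Z\<close> they
  multiply to this product.\<close>
lemma integral_nontrivial:
  fixes \<chi> :: "'a \<Rightarrow> 'v::ab_group_add"
  assumes r: "r \<ge> 1" and add: "\<And>y z. y \<in> Z \<Longrightarrow> z \<in> Z \<Longrightarrow> \<chi> (y \<otimes> z) = \<chi> y + \<chi> z"
    and short: "\<And>z. z \<in> Z \<Longrightarrow> real (len z) \<le> 3 * r \<Longrightarrow> \<chi> z = 0"
  obtains c where "coarse_cocycle X dist_H r c"
    "\<And>x ws. x \<in> X \<Longrightarrow> set ws \<subseteq> S \<Longrightarrow> gprod G ws \<in> Z \<Longrightarrow> integral c x ws = \<chi> (gprod G ws)"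
proof -
  define \<gamma> where "\<gamma> x y = (SOME g. g \<in> carrier G \<and> real (len g) \<le> r \<and> x \<cdot> g = y)" for x y
  define c where "c x y = \<chi> (defect x (\<gamma> x y))" for x y
  have \<gamma>: "\<gamma> x y \<in> carrier G \<and> real (len (\<gamma> x y)) \<le> r \<and> x \<cdot> \<gamma> x y = y"
    if xy: "x \<in> X" "y \<in> X" "dist_H x y \<le> r" for x y
  proof -
    obtain ws where ws: "set ws \<subseteq> S" "x \<cdot> gprod G ws = y" "real (length ws) = dist_H x y"
      by (rule dist_word[OF xy(1,2)])
    have "len (gprod G ws) \<le> length ws" using ws(1) by (intro word_length_le) (simp_all add: sym_set_S)
    then have "gprod G ws \<in> carrier G \<and> real (len (gprod G ws)) \<le> r \<and> x \<cdot> gprod G ws = y"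
      using ws xy(3) gprod_in[OF ws(1)] by linarith
    then show ?thesis unfolding \<gamma>_def by (rule someI)
  qed
  have c_eq: "c x (x \<cdot> g) = \<chi> (defect x g)"
    if x: "x \<in> X" and g: "g \<in> carrier G" and d: "dist_H x (x \<cdot> g) \<le> r" and len: "real (len g) \<le> 2 * r" for x g
  proof -
    let ?h = "\<gamma> x (x \<cdot> g)"
    have h: "?h \<in> carrier G" "real (len ?h) \<le> r" "x \<cdot> ?h = x \<cdot> g" using \<gamma>[OF x _ d] x g by auto
    define z where "z = g \<otimes> inv ?h"
    have zc: "z \<in> carrier G" unfolding z_def using g h by simp
    have "x \<cdot> z = x \<cdot> g \<cdot> inv ?h" unfolding z_def using x g h by (intro act_mult) auto
    also have "\<dots> = x \<cdot> ?h \<cdot> inv ?h" by (simp only: h(3))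
    also have "\<dots> = x" by (rule act_inv(1)[OF x h(1)])
    finally have z: "z \<in> Z" using act_fixes_iff[OF x zc] by simp
    have "len z \<le> len g + len ?h"
      unfolding z_def using word_length_mult[OF S g, of "inv ?h"] word_length_inv[OF S h(1)] h(1) by simp
    then have "real (len z) \<le> 3 * r" using len h(2) by linarith
    then have "\<chi> z = 0" by (rule short[OF z])
    have "g = z \<otimes> ?h" unfolding z_def using g h(1) by (simp add: m_assoc)
    then have "defect x g = defect x (z \<otimes> ?h)" by simp
    also have "\<dots> = z \<otimes> defect x ?h" unfolding defect_mult[OF x zc h(1)] defect_Z[OF x z] act_Z[OF x z] ..
    finally show ?thesis unfolding c_def using add[OF z defect_in_Z[OF x h(1)]] \<open>\<chi> z = 0\<close> by simp
  qed
  have "coarse_cocycle X dist_H r c"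
    unfolding coarse_cocycle_def
  proof (intro ballI impI)
    fix x y z assume X: "x \<in> X" "y \<in> X" "z \<in> X" and d: "dist_H x y \<le> r" "dist_H y z \<le> r" "dist_H x z \<le> r"
    let ?g = "\<gamma> x y" and ?h = "\<gamma> y z"
    have g: "?g \<in> carrier G" "real (len ?g) \<le> r" "x \<cdot> ?g = y" using \<gamma>[OF X(1,2) d(1)] by auto
    have h: "?h \<in> carrier G" "real (len ?h) \<le> r" "y \<cdot> ?h = z" using \<gamma>[OF X(2,3) d(2)] by auto
    have gh: "x \<cdot> (?g \<otimes> ?h) = z" using act_mult[OF X(1) g(1) h(1)] g h by simp
    have "real (len (?g \<otimes> ?h)) \<le> 2 * r" using word_length_mult[OF S g(1) h(1)] g(2) h(2) by linarith
    then have "c x z = \<chi> (defect x (?g \<otimes> ?h))" using c_eq[OF X(1), of "?g \<otimes> ?h"] g h gh d(3) by simp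
    also have "\<dots> = \<chi> (defect x ?g) + \<chi> (defect y ?h)"
      unfolding defect_mult[OF X(1) g(1) h(1)] g(3) by (intro add defect_in_Z X g h)
    finally show "c x y + c y z = c x z" unfolding c_def[of x y] c_def[of y z] by simp
  qed
  moreover have "integral c x ws = \<chi> (defect x (gprod G ws))" if "x \<in> X" "set ws \<subseteq> S" for x ws
    using that
  proof (induction ws arbitrary: x)
    case Nil
    have one: "\<one> \<in> Z" by (rule subgroup.one_closed[OF Z_subgroup])
    then have "\<chi> \<one> = 0" using add[OF one one] by simp
    then show ?case using defect_Z[OF Nil(1) one] by simp
  next
    case (Cons s ws)
    have s: "s \<in> S" "s \<in> carrier G" "gprod G ws \<in> carrier G" using Cons.prems S_carrier gprod_in by auto
    have "len s \<le> 1" using word_length_le[of "[s]" S s] s by (simp add: sym_set_S)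
    then have "c x (x \<cdot> s) = \<chi> (defect x s)"
      using dist_act[of x "[s]"] Cons.prems(1) s r by (intro c_eq) auto
    then show ?case using Cons s by (simp add: defect_mult add[symmetric] defect_in_Z)
  qed
  ultimately show ?thesis using that defect_Z by simp
qed

end

section \<open>Filling closed paths\<close>

lemma (in central_quotient) act_append:
  assumes "x \<in> X" "set us \<subseteq> S" "set vs \<subseteq> S"
  shows "x \<cdot> gprod G (us @ vs) = x \<cdot> gprod G us \<cdot> gprod G vs"
proof -
  have "gprod G (us @ vs) = gprod G us \<otimes> gprod G vs"
    using assms S_carrier by (intro gprod_append) auto
  then show ?thesis using act_mult[OF assms(1) gprod_in gprod_in] assms by simp
qed

lemma (in central_quotient) loop_word:
  assumes c: "coarse_cocycle X dist_H r c" and \<rho>: "\<rho> \<le> r"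
    and y: "\<And>k. y k \<in> X" "\<And>k. k < n \<Longrightarrow> dist_H (y k) (y (Suc k)) \<le> \<rho>"
  shows "\<exists>ws. set ws \<subseteq> S \<and> real (length ws) \<le> real n * \<rho> \<and> y 0 \<cdot> gprod G ws = y n
    \<and> integral c (y 0) ws = (\<Sum>k<n. c (y k) (y (Suc k)))"
  using y(2)
proof (induction n)
  case 0
  show ?case using y(1) by (intro exI[of _ "[]"]) simp
next
  case (Suc n)
  then obtain ws where ws: "set ws \<subseteq> S" "real (length ws) \<le> real n * \<rho>" "y 0 \<cdot> gprod G ws = y n"
    "integral c (y 0) ws = (\<Sum>k<n. c (y k) (y (Suc k)))" by auto
  obtain us where us: "set us \<subseteq> S" "y n \<cdot> gprod G us = y (Suc n)" "real (length us) = dist_H (y n) (y (Suc n))"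
    by (rule dist_word[OF y(1) y(1)])
  have len: "real (length us) \<le> \<rho>" using us(3) Suc.prems[of n] by simp
  have "y 0 \<cdot> gprod G (ws @ us) = y 0 \<cdot> gprod G ws \<cdot> gprod G us"
    by (rule act_append[OF y(1) ws(1) us(1)])
  moreover have "integral c (y 0) (ws @ us) = integral c (y 0) ws + c (y n) (y (Suc n))"
    unfolding integral_append[OF y(1) ws(1)] ws(3)
    using integral_short[OF c y(1) us(1), of n] len \<rho> us(2) by simp
  ultimately show ?case
    using ws us len by (intro exI[of _ "ws @ us"]) (simp add: algebra_simps)
qed

global_interpretation Q: central_quotient "AG :: 'k::{field,finite} poly fract mat monoid" "central_part N" letters
  for N
  unfolding central_quotient_def central_quotient_axioms_def
  by (intro conjI allI impI group_AG subgroup_central_part central_part_central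
      finite_generating_set_letters inv_letters)

abbreviation AG_len :: "'k::{field,finite} poly fract mat \<Rightarrow> nat" where "AG_len \<equiv> word_length AG letters"

abbreviation e14_poly :: "'k::{field,finite} poly \<Rightarrow> 'k poly fract mat" where "e14_poly f \<equiv> e14 (to_fract f)"

lemma mprod_append:
  assumes "set us \<subseteq> letters" "set vs \<subseteq> letters" shows "mprod (us @ vs) = mprod us * mprod vs"
  using AG.gprod_append[OF subset_trans[OF assms(1) letters_in_AG] subset_trans[OF assms(2) letters_in_AG]]
  unfolding gprod_AG by simp

lemma (in short_relations) sum_list_cong_mprod:
  assumes us: "set us \<subseteq> letters" and vs: "set vs \<subseteq> letters" and eq: "mprod us = mprod vs"
  shows "sum_list (map F us) = sum_list (map F vs)"
proof -
  define ws where "ws = rev (map (\<lambda>s. inv\<^bsub>AG\<^esub> s) vs)"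
  have ws: "set ws \<subseteq> letters" using vs inv_letters by (auto simp: ws_def)
  have "mprod ws = inv\<^bsub>AG\<^esub> (mprod vs)"
    using AG.inv_gprod[OF subset_trans[OF vs letters_in_AG]] unfolding gprod_AG ws_def by simp
  then have "mprod (vs @ ws) = mprod vs \<otimes>\<^bsub>AG\<^esub> inv\<^bsub>AG\<^esub> (mprod vs)"
    by (simp add: mprod_append[OF vs ws])
  also have "\<dots> = 1\<^sub>m 4" using AG.r_inv[OF mprod_in_AG[OF vs]] by simp
  finally have 1: "mprod (vs @ ws) = 1\<^sub>m 4" .
  moreover have "mprod (us @ ws) = mprod (vs @ ws)"
    by (simp add: mprod_append us vs ws eq)
  ultimately have "sum_list (map F (us @ ws)) = 0" "sum_list (map F (vs @ ws)) = 0"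
    using us vs ws by (intro relations_of_A4; simp)+
  then have "sum_list (map F us) + sum_list (map F ws) = sum_list (map F vs) + sum_list (map F ws)" by simp
  then show ?thesis by (simp only: add_right_cancel)
qed

text \<open>The holonomies of the letters satisfy the short relations, hence all relations of \<open>A\<^sub>4\<close>.\<close>
lemma integral_cong:
  fixes c :: "'k::{field,finite} poly fract mat set \<Rightarrow> 'k poly fract mat set \<Rightarrow> 'v::ab_group_add"
  assumes c: "coarse_cocycle (Q.X N) (Q.dist_H N) r c" and r: "r \<ge> 4" and x: "x \<in> Q.X N"
    and us: "set us \<subseteq> letters" and vs: "set vs \<subseteq> letters" and eq: "mprod us = mprod vs"
  shows "Q.integral N c x us = Q.integral N c x vs"
proof -
  have r1: "r \<ge> 1" using r by simp
  interpret short_relations "Q.holonomy N c"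
  proof
    fix us vs :: "'k poly fract mat list"
    assume "set us \<subseteq> letters" "set vs \<subseteq> letters" "length us \<le> 4" "length vs \<le> 4" "mprod us = mprod vs"
    then show "sum_list (map (Q.holonomy N c) us) = sum_list (map (Q.holonomy N c) vs)"
      using r by (intro Q.holonomy_relations[OF c r1]) (simp_all add: gprod_AG)
  qed
  have "Rep_perm (sum_list (map (Q.holonomy N c) us)) (x, 0) = Rep_perm (sum_list (map (Q.holonomy N c) vs)) (x, 0)"
    by (simp only: sum_list_cong_mprod[OF us vs eq])
  then show ?thesis unfolding Q.Rep_sum_holonomy[OF c r1 us] Q.Rep_sum_holonomy[OF c r1 vs] using x by simp
qed

lemma letters_word:
  fixes g :: "'k::{field,finite} poly fract mat"
  assumes "g \<in> carrier AG" obtains ws where "set ws \<subseteq> letters" "mprod ws = g" "length ws = AG_len g"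
  using AG.shortest_word[OF finite_generating_set_letters assms] unfolding sym_set_letters gprod_AG by blast

lemma e14_poly_in_AG [simp]: "e14_poly f \<in> carrier AG"
  by (simp add: e14_in_AG)

lemma e14_poly_in_central_part: "e14_poly f \<in> central_part N \<longleftrightarrow> (\<forall>n. coeff f n \<noteq> 0 \<longrightarrow> n \<in> N)"
  by (auto simp: central_part_def)

text \<open>The word may be replaced by a concatenation of shortest words for the monomials of \<open>f\<close>. Each of these is
  a closed path that is short enough for \<open>c\<close> to be additive along it.\<close>
lemma integral_central:
  fixes c :: "'k::{field,finite} poly fract mat set \<Rightarrow> 'k poly fract mat set \<Rightarrow> 'v::ab_group_add"
  assumes c: "coarse_cocycle (Q.X N) (Q.dist_H N) r c" and r: "r \<ge> 4" and x: "x \<in> Q.X N"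
    and M: "\<And>j (a :: 'k). j \<in> N \<Longrightarrow> j \<le> M \<Longrightarrow> real (AG_len (e14_poly (monom a j))) \<le> r"
    and f: "\<And>n. coeff f n \<noteq> 0 \<Longrightarrow> n \<in> N" "degree f \<le> M"
    and ws: "set ws \<subseteq> letters" "mprod ws = e14_poly f"
  shows "Q.integral N c x ws = 0"
proof -
  have "\<exists>vs. set vs \<subseteq> letters \<and> mprod vs = e14_poly (\<Sum>i<j. monom (coeff f i) i) \<and> Q.integral N c x vs = 0"
    if "j \<le> Suc M" for j
    using that
  proof (induction j)
    case 0
    show ?case by (intro exI[of _ "[]"]) (simp add: e14_0)
  next
    case (Suc j)
    then obtain vs where vs: "set vs \<subseteq> letters" "mprod vs = e14_poly (\<Sum>i<j. monom (coeff f i) i)" "Q.integral N c x vs = 0"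
      by auto
    show ?case
    proof (cases "coeff f j = 0")
      case True
      then show ?thesis using vs by (intro exI[of _ vs]) simp
    next
      case False
      have j: "j \<in> N" using f(1)[OF False] .
      obtain us where us: "set us \<subseteq> letters" "mprod us = e14_poly (monom (coeff f j) j)" "length us = AG_len (e14_poly (monom (coeff f j) j))"
        by (rule letters_word[OF e14_poly_in_AG])
      have central: "mprod vs \<in> central_part N" "mprod us \<in> central_part N"
        unfolding vs(2) us(2) e14_poly_in_central_part using f(1) j
        by (auto simp: coeff_sum coeff_monom split: if_splits)
      have "Q.integral N c x us = c x (Q.act N x (gprod AG us))"
        using us Suc.prems M[OF j, of "coeff f j"] by (intro Q.integral_short[OF c x]) auto
      also have "\<dots> = 0"
        using Q.act_Z[OF x central(2)] coarse_cocycle_diag[OF c Q.pseudometric _ x] r by (simp add: gprod_AG)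
      finally have "Q.integral N c x us = 0" .
      then have "Q.integral N c x (vs @ us) = 0"
        using vs(3) Q.act_Z[OF x central(1)] by (simp add: Q.integral_append[OF x vs(1)] gprod_AG)
      moreover have "mprod (vs @ us) = mprod vs * mprod us"
        by (rule mprod_append[OF vs(1) us(1)])
      then have "mprod (vs @ us) = e14_poly (\<Sum>i<Suc j. monom (coeff f i) i)"
        unfolding vs(2) us(2) e14_mult by simp
      ultimately show ?thesis using vs(1) us(1) by (intro exI[of _ "vs @ us"]) simp
    qed
  qed
  from this[of "Suc M"] obtain vs where vs: "set vs \<subseteq> letters" "mprod vs = e14_poly (\<Sum>i<Suc M. monom (coeff f i) i)"
    "Q.integral N c x vs = 0" by auto
  have "(\<Sum>i<Suc M. monom (coeff f i) i) = f"
    using poly_as_sum_of_monoms'[OF f(2)] by (simp add: lessThan_Suc_atMost)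
  then have "mprod ws = mprod vs" using vs(2) ws(2) by simp
  then show ?thesis using integral_cong[OF c r x ws(1) vs(1)] vs(3) by simp
qed

text \<open>Here \<open>M\<close> is a bound for the degrees of those central elements that can occur as lifts of the closed path.\<close>
lemma loop_sum_eq_0:
  fixes c :: "'k::{field,finite} poly fract mat set \<Rightarrow> 'k poly fract mat set \<Rightarrow> 'v::ab_group_add"
  assumes c: "coarse_cocycle (Q.X N) (Q.dist_H N) r c" and r: "r \<ge> 4" and \<rho>: "\<rho> \<le> r"
    and M: "\<And>j (a :: 'k). j \<in> N \<Longrightarrow> j \<le> M \<Longrightarrow> real (AG_len (e14_poly (monom a j))) \<le> r"
    and deg: "\<And>f :: 'k poly. (\<And>n. coeff f n \<noteq> 0 \<Longrightarrow> n \<in> N) \<Longrightarrow> real (AG_len (e14_poly f)) \<le> real n * \<rho> \<Longrightarrow> degree f \<le> M"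
    and y: "\<And>k. y k \<in> Q.X N" "\<And>k. k < n \<Longrightarrow> Q.dist_H N (y k) (y (Suc k)) \<le> \<rho>" "y n = y 0"
  shows "(\<Sum>k<n. c (y k) (y (Suc k))) = 0"
proof -
  obtain ws where ws: "set ws \<subseteq> letters" "real (length ws) \<le> real n * \<rho>" "Q.act N (y 0) (mprod ws) = y 0"
    "Q.integral N c (y 0) ws = (\<Sum>k<n. c (y k) (y (Suc k)))"
    using Q.loop_word[where y = y and n = n, OF c \<rho> y(1,2)] y(3) unfolding gprod_AG by auto
  have "mprod ws \<in> central_part N"
    using Q.act_fixes_iff[OF y(1) mprod_in_AG[OF ws(1)]] ws(3) by blast
  then obtain f where f: "mprod ws = e14_poly f" "\<And>n. coeff f n \<noteq> 0 \<Longrightarrow> n \<in> N" unfolding central_part_def by blast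
  have "AG_len (e14_poly f) \<le> length ws" using f(1) ws(1) by (intro AG.word_length_le) (simp_all add: sym_set_letters gprod_AG)
  then have "degree f \<le> M" using ws(2) by (intro deg f(2)) auto
  from integral_central[OF c r y(1) M f(2) this ws(1) f(1)] show ?thesis using ws(4) by simp
qed

text \<open>The closed path is that of a shortest word for \<open>e14 (t\<^sup>q)\<close>, and the cocycle comes from the coefficient at \<open>t\<^sup>q\<close>.\<close>
lemma ex_nontrivial_cocycle:
  fixes q :: nat and N :: "nat set"
  assumes q: "q \<in> N" and r: "r \<ge> 1"
    and short: "\<And>f :: 'k::{field,finite} poly. (\<And>n. coeff f n \<noteq> 0 \<Longrightarrow> n \<in> N) \<Longrightarrow> real (AG_len (e14_poly f)) \<le> 3 * r \<Longrightarrow> coeff f q = 0"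
  obtains c :: "'k::{field,finite} poly fract mat set \<Rightarrow> 'k poly fract mat set \<Rightarrow> 'k"
    and y :: "nat \<Rightarrow> 'k poly fract mat set" and n
  where "n = AG_len (e14_poly (monom (1 :: 'k::{field,finite}) q))" "coarse_cocycle (Q.X N) (Q.dist_H N) r c" "\<forall>k. y k \<in> Q.X N"
    "\<forall>k<n. Q.dist_H N (y k) (y (Suc k)) \<le> 1" "y n = y 0" "(\<Sum>k<n. c (y k) (y (Suc k))) = 1"
proof -
  define \<chi> :: "'k poly fract mat \<Rightarrow> 'k" where "\<chi> g = coeff (THE f. e14_poly f = g) q" for g
  have \<chi>: "\<chi> (e14_poly f) = coeff f q" for f by (simp add: \<chi>_def)
  obtain c where c: "coarse_cocycle (Q.X N) (Q.dist_H N) r c"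
    "\<And>x ws. x \<in> Q.X N \<Longrightarrow> set ws \<subseteq> letters \<Longrightarrow> gprod AG ws \<in> central_part N \<Longrightarrow> Q.integral N c x ws = \<chi> (gprod AG ws)"
  proof (rule Q.integral_nontrivial[of r N \<chi>])
    show "\<chi> (y \<otimes>\<^bsub>AG\<^esub> w) = \<chi> y + \<chi> w" if yw: "y \<in> central_part N" "w \<in> central_part N" for y w
    proof -
      obtain f g where "y = e14_poly f" "w = e14_poly g" using yw unfolding central_part_def by blast
      then have "y \<otimes>\<^bsub>AG\<^esub> w = e14_poly (f + g)" by (simp add: e14_mult)
      then have "\<chi> (y \<otimes>\<^bsub>AG\<^esub> w) = coeff (f + g) q" by (simp only: \<chi>)
      moreover have "\<chi> y = coeff f q" "\<chi> w = coeff g q"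
        by (simp_all only: \<open>y = e14_poly f\<close> \<open>w = e14_poly g\<close> \<chi>)
      ultimately show ?thesis by (simp only: coeff_add)
    qed
    show "\<chi> w = 0" if w: "w \<in> central_part N" "real (AG_len w) \<le> 3 * r" for w
    proof -
      obtain f where "w = e14_poly f" "\<And>n. coeff f n \<noteq> 0 \<Longrightarrow> n \<in> N" using w unfolding central_part_def by blast
      then show ?thesis using short[of f] w(2) \<chi> by simp
    qed
  qed (use r in auto)
  obtain ws where ws: "set ws \<subseteq> letters" "mprod ws = e14_poly (monom (1 :: 'k) q)" "length ws = AG_len (e14_poly (monom (1 :: 'k) q))"
    by (rule letters_word[OF e14_poly_in_AG])
  define x :: "'k poly fract mat set" where "x = \<one>\<^bsub>Q.H N\<^esub>"
  have x: "x \<in> Q.X N" unfolding x_def by (rule group.is_monoid[OF Q.quot.H.group_axioms, THEN monoid.one_closed])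
  define y where "y k = Q.act N x (mprod (take k ws))" for k
  have t: "set (take k ws) \<subseteq> letters" for k using set_take_subset[of k ws] ws(1) by blast
  have central: "mprod ws \<in> central_part N"
    unfolding ws(2) e14_poly_in_central_part using q by (auto split: if_splits)
  show ?thesis
  proof (rule that[OF refl])
    show "coarse_cocycle (Q.X N) (Q.dist_H N) r c" by (rule c)
    show "\<forall>k. y k \<in> Q.X N" unfolding y_def by (intro allI Q.act_closed x mprod_in_AG t)
    show "\<forall>k<AG_len (e14_poly (monom (1 :: 'k) q)). Q.dist_H N (y k) (y (Suc k)) \<le> 1"
    proof (intro allI impI)
      fix k assume k: "k < AG_len (e14_poly (monom (1 :: 'k) q))"
      have k': "k < length ws" using k ws(3) by simp
      then have s: "ws ! k \<in> letters" using ws(1) nth_mem by blast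
      have "y (Suc k) = Q.act N (y k) (gprod AG [ws ! k])"
        unfolding y_def take_Suc_conv_app_nth[OF k'] gprod_AG[symmetric]
        using s by (intro Q.act_append x t) simp
      then show "Q.dist_H N (y k) (y (Suc k)) \<le> 1" using Q.dist_act[of "y k" N "[ws ! k]"] s Q.act_closed[OF x mprod_in_AG[OF t]]
        unfolding y_def by simp
    qed
    show "y (AG_len (e14_poly (monom (1 :: 'k) q))) = y 0"
      unfolding y_def ws(3)[symmetric] using Q.act_Z[OF x central] Q.act_one[OF x] by simp
    have "(\<Sum>k<length ws. c (y k) (y (Suc k))) = Q.integral N c x ws"
      unfolding y_def by (rule Q.integral_sum[OF x ws(1), unfolded gprod_AG, symmetric])
    also have "\<dots> = 1" using c(2)[OF x ws(1)] central unfolding gprod_AG by (simp add: ws(2) \<chi>)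
    finally show "(\<Sum>k<AG_len (e14_poly (monom (1 :: 'k) q)). c (y k) (y (Suc k))) = 1" using ws(3) by simp
  qed
qed

text \<open>Balls are finite, so central elements of bounded length have bounded degree. The next exponent is chosen
  beyond the degrees that occur in a ball whose radius is a growing multiple of the lengths of
  the monomials up to the current exponent.\<close>
lemma ex_lacunary_degrees:
  obtains m l :: "nat \<Rightarrow> nat" where "strict_mono m"
    "\<And>i j (a :: 'k::{field,finite}). j \<le> m i \<Longrightarrow> AG_len (e14_poly (monom a j)) \<le> l i"
    "\<And>i (f :: 'k poly). AG_len (e14_poly f) \<le> Suc i * Suc (l i) \<Longrightarrow> degree f < m (Suc i)"
proof -
  define L where "L n = Max ((\<lambda>(a :: 'k, j). AG_len (e14_poly (monom a j))) ` (UNIV \<times> {..n}))" for n :: nat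
  have L: "AG_len (e14_poly (monom a j)) \<le> L n" if "j \<le> n" for n j and a :: 'k
    unfolding L_def by (rule Max_ge) (use that in \<open>auto intro!: image_eqI[of _ _ "(a, j)"]\<close>)
  define B where "B R = {f :: 'k poly. AG_len (e14_poly f) \<le> R}" for R
  have fin: "finite (B R)" for R
  proof -
    have "e14_poly ` B R \<subseteq> mprod ` {ws. set ws \<subseteq> letters \<and> length ws \<le> R}"
    proof
      fix g assume "g \<in> e14_poly ` B R"
      then have "AG_len g \<le> R" "g \<in> carrier AG" by (auto simp: B_def)
      then show "g \<in> mprod ` {ws. set ws \<subseteq> letters \<and> length ws \<le> R}"
        using letters_word[of g] by (metis (mono_tags, lifting) image_eqI mem_Collect_eq)
    qed
    moreover have "finite {ws. set ws \<subseteq> (letters :: 'k poly fract mat set) \<and> length ws \<le> R}"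
      using finite_lists_length_le[OF finite_letters] .
    ultimately have "finite (e14_poly ` B R)" by (meson finite_imageI finite_subset)
    moreover have "inj_on (e14_poly :: 'k poly \<Rightarrow> _) (B R)" by (rule inj_onI) simp
    ultimately show ?thesis by (rule finite_imageD)
  qed
  define D where "D R = Max (insert 0 (degree ` B R))" for R
  have D: "degree f \<le> D R" if "AG_len (e14_poly f) \<le> R" for f :: "'k poly" and R
  proof -
    have "f \<in> B R" using that by (simp add: B_def)
    then show ?thesis unfolding D_def using fin by (intro Max_ge finite.insertI finite_imageI insertI2 imageI)
  qed
  define m where "m = rec_nat 0 (\<lambda>i x. Suc (max x (D (Suc i * Suc (L x)))))"
  have m: "m (Suc i) = Suc (max (m i) (D (Suc i * Suc (L (m i)))))" for i by (simp add: m_def)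
  show ?thesis
  proof (rule that[of m "\<lambda>i. L (m i)"])
    show "strict_mono m" unfolding strict_mono_Suc_iff m by auto
    show "AG_len (e14_poly (monom a j)) \<le> L (m i)" if "j \<le> m i" for i j and a :: 'k by (rule L[OF that])
    show "degree f < m (Suc i)" if "AG_len (e14_poly f) \<le> Suc i * Suc (L (m i))" for i and f :: "'k poly"
      using D[OF that] unfolding m by simp
  qed
qed

lemma quasi_isometric_spacesE:
  assumes "quasi_isometric_spaces X dX Y dY"
  obtains f L C where "f \<in> X \<rightarrow> Y" "L \<ge> 1" "C \<ge> 0"
    "\<forall>x\<in>X. \<forall>x'\<in>X. dX x x' / L - C \<le> dY (f x) (f x') \<and> dY (f x) (f x') \<le> L * dX x x' + C"
    "\<forall>y\<in>Y. \<exists>x\<in>X. dY (f x) y \<le> C"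
  using assms unfolding quasi_isometric_spaces_def by blast

text \<open>Let \<open>k + 1\<close> belong to \<open>J\<close> but not to \<open>I\<close>. In the quotient for \<open>J\<close> the closed path of \<open>e14 (t\<^sup>q)\<close>, \<open>q = m (k + 1)\<close>, has nonzero sum for
  some cocycle at scale \<open>(k + 1) (l k + 1) / 3\<close>. Its image in the quotient for \<open>I\<close> has length at most a constant times \<open>l (k + 1)\<close>,
  so it lifts to a central element of degree below \<open>m (k + 2)\<close>, hence of degree at most \<open>m k\<close> because the exponent
  \<open>m (k + 1)\<close> is not available. Its monomials have length at most \<open>l k\<close>, which is
  small compared with the scale of the cocycle when \<open>k\<close> is large, and the sum is zero.\<close>
theorem not_quasi_isometric:
  fixes m l :: "nat \<Rightarrow> nat"
  assumes m: "strict_mono m"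
    and l: "\<And>i j (a :: 'k::{field,finite}). j \<le> m i \<Longrightarrow> AG_len (e14_poly (monom a j)) \<le> l i"
    and D: "\<And>i (f :: 'k poly). AG_len (e14_poly f) \<le> Suc i * Suc (l i) \<Longrightarrow> degree f < m (Suc i)"
    and inf: "infinite (J - I)"
  shows "\<not> quasi_isometric (AG Mod central_part (m ` I) :: 'k poly fract mat set monoid)
    (AG Mod central_part (m ` J) :: 'k poly fract mat set monoid)"
proof
  let ?X = "Q.X (m ` I) :: 'k poly fract mat set set" and ?Y = "Q.X (m ` J) :: 'k poly fract mat set set"
  let ?dX = "Q.dist_H (m ` I) :: 'k poly fract mat set \<Rightarrow> _" and ?dY = "Q.dist_H (m ` J) :: 'k poly fract mat set \<Rightarrow> _"
  assume "quasi_isometric (Q.H (m ` I) :: 'k poly fract mat set monoid) (Q.H (m ` J) :: 'k poly fract mat set monoid)"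
  then have qis: "quasi_isometric_spaces ?X ?dX ?Y ?dY"
    by (rule quasi_isometric_generating_sets[OF Q.quot.H.group_axioms Q.quot.H.group_axioms _
      Q.finite_generating_set_quotient Q.finite_generating_set_quotient])
  obtain f L C where f: "f \<in> ?X \<rightarrow> ?Y" and L: "L \<ge> 1" and C: "C \<ge> 0"
    and qi: "\<forall>x\<in>?X. \<forall>x'\<in>?X. ?dX x x' / L - C \<le> ?dY (f x) (f x') \<and> ?dY (f x) (f x') \<le> L * ?dX x x' + C"
    and onto: "\<forall>y\<in>?Y. \<exists>x\<in>?X. ?dY (f x) y \<le> C"
    by (rule quasi_isometric_spacesE[OF qis])
  define \<rho> where "\<rho> = L * (1 + 3 * C)"
  have \<rho>: "\<rho> \<ge> 1 + 3 * C" unfolding \<rho>_def using mult_right_mono[OF L, of "1 + 3 * C"] C by simp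
  \<comment> \<open>\<open>K\<close> absorbs all constants of the quasi-isometry; \<open>k\<close> has to beat it so that the scale \<open>r'\<close> in the
    target exceeds the scale needed to transport cocycles to scale \<open>r\<close> in the source.\<close>
  define K where "K = L * (4 + \<rho>) + C + L"
  obtain k where k: "Suc k \<in> J - I" "real k \<ge> 3 * K"
  proof -
    obtain b :: nat where b: "real b \<ge> 3 * K" using real_arch_simple by blast
    obtain n where n: "n \<in> J - I" "n > b" using inf unfolding infinite_nat_iff_unbounded by blast
    then obtain k where "n = Suc k" by (cases n) auto
    then show ?thesis using that[of k] n b by simp
  qed
  define q where "q = m (Suc k)"
  define r where "r = 4 + \<rho> + real (l k)"
  define r' where "r' = real (Suc k * Suc (l k)) / 3"
  have K: "K \<ge> L" "K \<ge> L * (4 + \<rho>) + C" "K \<ge> \<rho>" "K \<ge> 1 + 2 * C"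
  proof -
    have p: "L * (4 + \<rho>) \<ge> 4 + \<rho>" using mult_right_mono[OF L, of "4 + \<rho>"] \<rho> C by simp
    show "K \<ge> L" "K \<ge> L * (4 + \<rho>) + C" "K \<ge> \<rho>" "K \<ge> 1 + 2 * C" unfolding K_def using p L C \<rho> by linarith+
  qed
  have r': "K * (1 + real (l k)) \<le> r'"
  proof -
    have "3 * K * (1 + real (l k)) \<le> real (Suc k) * real (Suc (l k))"
      using k(2) by (intro mult_mono) auto
    then have "3 * (K * (1 + real (l k))) \<le> real (Suc k * Suc (l k))" by (simp only: of_nat_mult mult.assoc)
    then show ?thesis unfolding r'_def by linarith
  qed
  have "K * 1 \<le> K * (1 + real (l k))" using K(1) L by (intro mult_left_mono) auto
  then have Kr': "K \<le> r'" using r' by simp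
  have scale: "L * r + C \<le> r'"
  proof -
    have "L * r + C = L * (4 + \<rho>) + C + L * real (l k)" unfolding r_def by (simp add: algebra_simps)
    also have "\<dots> \<le> K + K * real (l k)" using K(1,2) by (intro add_mono mult_right_mono) auto
    also have "\<dots> \<le> r'" using r' by (simp add: algebra_simps)
    finally show ?thesis .
  qed
  have qJ: "q \<in> m ` J" using k(1) by (auto simp: q_def)
  have short: "coeff g q = 0" if "\<And>n. coeff g n \<noteq> 0 \<Longrightarrow> n \<in> m ` J" "real (AG_len (e14_poly g)) \<le> 3 * r'" for g :: "'k poly"
  proof -
    have "AG_len (e14_poly g) \<le> Suc k * Suc (l k)" using that(2) unfolding r'_def by linarith
    from D[OF this] show ?thesis unfolding q_def by (rule coeff_eq_0)
  qed
  have r'1: "r' \<ge> 1" using Kr' K(4) C by linarith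
  obtain c :: "'k poly fract mat set \<Rightarrow> 'k poly fract mat set \<Rightarrow> 'k" and y n
    where n: "n = AG_len (e14_poly (monom (1 :: 'k) q))"
      and c: "coarse_cocycle ?Y ?dY r' c" "\<forall>k. y k \<in> ?Y" "\<forall>k<n. ?dY (y k) (y (Suc k)) \<le> 1"
      "y n = y 0" "(\<Sum>k<n. c (y k) (y (Suc k))) = 1"
    by (rule ex_nontrivial_cocycle[OF qJ r'1 short])
  have "1 + 2 * C \<le> r'" using Kr' K(4) by linarith
  obtain x where x: "\<forall>k. x k \<in> ?X" "\<forall>k<n. ?dX (x k) (x (Suc k)) \<le> L * (1 + 3 * C)" "x n = x 0"
    "coarse_cocycle ?X ?dX r (\<lambda>a b. c (f a) (f b))"
    "(\<Sum>k<n. c (f (x k)) (f (x (Suc k)))) = (\<Sum>k<n. c (y k) (y (Suc k)))"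
    by (rule pull_back_loop[OF Q.pseudometric f L C qi[rule_format] onto[rule_format] c(1) scale
        \<open>1 + 2 * C \<le> r'\<close> c(2)[rule_format] c(3)[rule_format] c(4)])
  have "(\<Sum>k<n. c (f (x k)) (f (x (Suc k)))) = 0"
  proof (rule loop_sum_eq_0[OF x(4) _ _ _ _ x(1)[rule_format] x(2)[rule_format, folded \<rho>_def] x(3)])
    show "r \<ge> 4" "\<rho> \<le> r" unfolding r_def using \<rho> C by simp_all
    show "real (AG_len (e14_poly (monom a j))) \<le> r" if "j \<in> m ` I" "j \<le> m k" for j and a :: 'k
      using l[OF that(2), of a] unfolding r_def using \<rho> C by simp
    show "degree g \<le> m k" if g: "\<And>n. coeff g n \<noteq> 0 \<Longrightarrow> n \<in> m ` I" "real (AG_len (e14_poly g)) \<le> real n * \<rho>" for g :: "'k poly"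
    proof (cases "g = 0")
      case False
      have "n \<le> l (Suc k)" unfolding n by (rule l) (simp add: q_def)
      then have "real n * \<rho> \<le> real (Suc (l (Suc k))) * real (Suc (Suc k))"
        using k(2) K(3) \<rho> C by (intro mult_mono) auto
      with g(2) have "real (AG_len (e14_poly g)) \<le> real (Suc (Suc k) * Suc (l (Suc k)))"
        unfolding of_nat_mult by (metis mult.commute order.trans)
      then have "AG_len (e14_poly g) \<le> Suc (Suc k) * Suc (l (Suc k))" by (simp only: of_nat_le_iff)
      from D[OF this] have "degree g < m (Suc (Suc k))" .
      moreover obtain i where i: "i \<in> I" "degree g = m i" using g(1)[of "degree g"] False by auto
      ultimately have "i < Suc (Suc k)" "i \<noteq> Suc k" using m k(1) by (auto simp: strict_mono_less)
      then have "i \<le> k" by simp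
      then show ?thesis using i(2) m by (simp add: strict_mono_less_eq)
    qed simp
  qed
  then show False using c(5) x(5) by simp
qed

section \<open>Solvability and nilpotency\<close>

text \<open>For \<open>n \<ge> 1\<close> these are the unipotent matrices whose first \<open>n - 1\<close> superdiagonals vanish, that is, the lower central
  series of the unipotent part; the whole group is put in front of it.\<close>
definition filtration :: "nat \<Rightarrow> 'k::field poly fract mat set" where
  "filtration n = {M \<in> carrier AG.
     (n \<ge> 1 \<longrightarrow> M $$ (1, 1) = 1 \<and> M $$ (2, 2) = 1) \<and>
     (n \<ge> 2 \<longrightarrow> M $$ (0, 1) = 0 \<and> M $$ (1, 2) = 0 \<and> M $$ (2, 3) = 0) \<and>
     (n \<ge> 3 \<longrightarrow> M $$ (0, 2) = 0 \<and> M $$ (1, 3) = 0) \<and> (n \<ge> 4 \<longrightarrow> M $$ (0, 3) = 0)}"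

lemma m4_in_filtration:
  "m4 u v a12 a13 a14 a23 a24 a34 \<in> filtration n \<longleftrightarrow> m4 u v a12 a13 a14 a23 a24 a34 \<in> carrier AG \<and>
     (n \<ge> 1 \<longrightarrow> u = 1 \<and> v = 1) \<and> (n \<ge> 2 \<longrightarrow> a12 = 0 \<and> a23 = 0 \<and> a34 = 0) \<and>
     (n \<ge> 3 \<longrightarrow> a13 = 0 \<and> a24 = 0) \<and> (n \<ge> 4 \<longrightarrow> a14 = 0)"
  by (simp add: filtration_def m4_entries del: One_nat_def)

lemma filtration_carrier: "M \<in> filtration n \<Longrightarrow> M \<in> carrier AG"
  by (simp add: filtration_def)

lemma filtration_antimono: "m \<le> n \<Longrightarrow> filtration n \<subseteq> filtration m"
  by (auto simp: filtration_def)

lemma m4_cases: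
  assumes "M \<in> carrier AG" obtains u v a12 a13 a14 a23 a24 a34 where
    "M = m4 u v a12 a13 a14 a23 a24 a34" "u \<noteq> 0" "v \<noteq> 0"
  using assms unfolding carrier_AG laurent_units_def by blast

lemma filtration_mult:
  assumes "x \<in> filtration n" "y \<in> filtration n" shows "x * y \<in> filtration n"
proof -
  have x: "x \<in> carrier AG" and y: "y \<in> carrier AG" using assms filtration_carrier by blast+
  have "x * y \<in> carrier AG" using AG.m_closed[OF x y] by simp
  with assms show ?thesis
    by (rule_tac m4_cases[OF x]; rule_tac m4_cases[OF y]) (auto simp: m4_in_filtration m4_mult)
qed

lemma filtration_solve:
  assumes w: "w \<in> carrier AG" and x: "x \<in> filtration n" and y: "y \<in> filtration n" and eq: "w * x = y"
  shows "w \<in> filtration n"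
proof -
  have x': "x \<in> carrier AG" using x filtration_carrier by blast
  obtain u v a12 a13 a14 a23 a24 a34 where W: "w = m4 u v a12 a13 a14 a23 a24 a34" by (rule m4_cases[OF w])
  obtain u' v' b12 b13 b14 b23 b24 b34 where X: "x = m4 u' v' b12 b13 b14 b23 b24 b34" "u' \<noteq> 0" "v' \<noteq> 0" by (rule m4_cases[OF x'])
  show ?thesis using w x y unfolding eq[symmetric] unfolding W X(1) m4_mult m4_in_filtration
    using X(2,3) by (auto simp: m4_in_filtration)
qed

lemma subgroup_filtration: "subgroup (filtration n) (AG :: 'k::field poly fract mat monoid)"
proof (rule AG.subgroupI)
  show "filtration n \<subseteq> (carrier AG :: 'k poly fract mat set)" using filtration_carrier by blast
  have one: "1\<^sub>m 4 \<in> (filtration n :: 'k poly fract mat set)"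
    unfolding one_mat_4 m4_in_filtration by (simp add: AG_m4)
  then show "filtration n \<noteq> ({} :: 'k poly fract mat set)" by blast
  fix x y :: "'k poly fract mat" assume x: "x \<in> filtration n"
  have "inv\<^bsub>AG\<^esub> x * x = 1\<^sub>m 4" using AG.l_inv[OF filtration_carrier[OF x]] by simp
  then show "inv\<^bsub>AG\<^esub> x \<in> filtration n"
    using filtration_solve[OF AG.inv_closed[OF filtration_carrier[OF x]] x one] by blast
  assume "y \<in> filtration n"
  with x show "x \<otimes>\<^bsub>AG\<^esub> y \<in> filtration n" by (simp add: filtration_mult)
qed

lemma filtration_4: "filtration 4 = {1\<^sub>m 4}"
proof -
  have "M = 1\<^sub>m 4" if M: "M \<in> filtration 4" for M :: "'a poly fract mat"
  proof -
    obtain u v a12 a13 a14 a23 a24 a34 where "M = m4 u v a12 a13 a14 a23 a24 a34"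
      by (rule m4_cases[OF filtration_carrier[OF M]])
    with M show ?thesis by (simp add: m4_in_filtration one_mat_4)
  qed
  moreover have "1\<^sub>m 4 \<in> (filtration 4 :: 'a poly fract mat set)"
    using subgroup.one_closed[OF subgroup_filtration] by simp
  ultimately show ?thesis by blast
qed

abbreviation (input) comm_AG :: "'k::field poly fract mat \<Rightarrow> 'k poly fract mat \<Rightarrow> 'k poly fract mat" where
  "comm_AG x y \<equiv> x \<otimes>\<^bsub>AG\<^esub> y \<otimes>\<^bsub>AG\<^esub> inv\<^bsub>AG\<^esub> x \<otimes>\<^bsub>AG\<^esub> inv\<^bsub>AG\<^esub> y"

text \<open>The commutator \<open>w\<close> enters through the equation \<open>w y x = x y\<close>, so that inverse matrices need not be
  computed.\<close>
lemma filtration_commutator_aux: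
  fixes w x y :: "'k::field poly fract mat"
  assumes w: "w \<in> carrier AG" and x: "x \<in> filtration n" and y: "y \<in> filtration (min n 1)"
    and eq: "w * (y * x) = x * y" and n: "n \<le> 3"
  shows "w \<in> filtration (Suc n)"
proof -
  obtain u v a12 a13 a14 a23 a24 a34 where X: "x = m4 u v a12 a13 a14 a23 a24 a34" "u \<noteq> 0" "v \<noteq> 0"
    by (rule m4_cases[OF filtration_carrier[OF x]])
  obtain u' v' b12 b13 b14 b23 b24 b34 where Y: "y = m4 u' v' b12 b13 b14 b23 b24 b34" "u' \<noteq> 0" "v' \<noteq> 0"
    by (rule m4_cases[OF filtration_carrier[OF y]])
  obtain p q c12 c13 c14 c23 c24 c34 where W: "w = m4 p q c12 c13 c14 c23 c24 c34"
    by (rule m4_cases[OF w])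
  note e = eq[unfolded X(1) Y(1) W m4_mult m4_eq_iff]
  have pq: "p = 1" "q = 1"
    using e X(2,3) Y(2,3) by auto
  consider "n = 0" | "n = 1" | "n = 2" | "n = 3" using n by linarith
  then show ?thesis
  proof cases
    case 1
    then show ?thesis using w pq unfolding W m4_in_filtration by simp
  next
    case 2
    then have "u = 1" "v = 1" "u' = 1" "v' = 1" using x y unfolding X(1) Y(1) m4_in_filtration by auto
    then show ?thesis using w pq e unfolding 2 W m4_in_filtration by (auto simp: algebra_simps)
  next
    case 3
    then have "u = 1" "v = 1" "u' = 1" "v' = 1" "a12 = 0" "a23 = 0" "a34 = 0"
      using x y unfolding X(1) Y(1) m4_in_filtration by auto
    then show ?thesis using w pq e unfolding 3 W m4_in_filtration by (auto simp: algebra_simps)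
  next
    case 4
    then have "u = 1" "v = 1" "u' = 1" "v' = 1" "a12 = 0" "a23 = 0" "a34 = 0" "a13 = 0" "a24 = 0"
      using x y unfolding X(1) Y(1) m4_in_filtration by auto
    then show ?thesis using w pq e unfolding 4 W m4_in_filtration by (auto simp: algebra_simps)
  qed
qed

lemma (in group) commutator_mult:
  assumes "x \<in> carrier G" "y \<in> carrier G"
  shows "x \<otimes> y \<otimes> inv x \<otimes> inv y \<otimes> (y \<otimes> x) = x \<otimes> y"
proof -
  have "inv y \<otimes> (y \<otimes> x) = x" using assms by (simp add: m_assoc[symmetric])
  then show ?thesis using assms by (simp add: m_assoc)
qed

lemma filtration_commutator:
  assumes x: "x \<in> filtration n" and y: "y \<in> filtration (min n 1)" and n: "n \<le> 3"
  shows "comm_AG x y \<in> filtration (Suc n)"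
proof (rule filtration_commutator_aux[OF _ x y _ n])
  have xy: "x \<in> carrier AG" "y \<in> carrier AG" using x y filtration_carrier by blast+
  then show "comm_AG x y \<in> carrier AG" by (intro AG.m_closed AG.inv_closed)
  have "comm_AG x y \<otimes>\<^bsub>AG\<^esub> (y \<otimes>\<^bsub>AG\<^esub> x) = x \<otimes>\<^bsub>AG\<^esub> y"
    by (rule AG.commutator_mult[OF xy])
  then show "comm_AG x y * (y * x) = x * y" by simp
qed

lemma lower_central_subset:
  assumes K: "group K" and 0: "carrier K \<subseteq> U 0" and sub: "\<And>n. subgroup (U n) K"
    and comm: "\<And>n x y. n < c \<Longrightarrow> x \<in> U n \<Longrightarrow> y \<in> carrier K \<Longrightarrow>
      x \<otimes>\<^bsub>K\<^esub> y \<otimes>\<^bsub>K\<^esub> inv\<^bsub>K\<^esub> x \<otimes>\<^bsub>K\<^esub> inv\<^bsub>K\<^esub> y \<in> U (Suc n)"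
  shows "n \<le> c \<Longrightarrow> lower_central K n \<subseteq> U n"
proof (induction n)
  case (Suc n)
  have "{x \<otimes>\<^bsub>K\<^esub> y \<otimes>\<^bsub>K\<^esub> inv\<^bsub>K\<^esub> x \<otimes>\<^bsub>K\<^esub> inv\<^bsub>K\<^esub> y | x y. x \<in> lower_central K n \<and> y \<in> carrier K} \<subseteq> U (Suc n)"
    using Suc comm[of n] by auto
  then show ?case unfolding lower_central.simps by (rule group.generate_subgroup_incl[OF K _ sub])
qed (use 0 in auto)

context
  fixes N :: "nat set"
begin

abbreviation layer :: "nat \<Rightarrow> 'k::{field,finite} poly fract mat set set" where
  "layer n \<equiv> Q.\<pi> N ` filtration n"

lemma subgroup_layer: "subgroup (layer n :: 'k::{field,finite} poly fract mat set set) (Q.H N)"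
  by (rule Q.quot.subgroup_img_is_subgroup[OF subgroup_filtration])

lemma layer_0: "layer 0 = carrier (Q.H N)"
  by (simp add: Q.\<pi>_surj[symmetric] filtration_def)

lemma layer_4: "layer 4 = {\<one>\<^bsub>Q.H N\<^esub>}"
  unfolding filtration_4 using Q.quot.hom_one[unfolded AG_simps] by blast

lemma layer_commutator:
  assumes x: "x \<in> layer n" and y: "y \<in> layer (min n 1)" and n: "n \<le> 3"
  shows "x \<otimes>\<^bsub>Q.H N\<^esub> y \<otimes>\<^bsub>Q.H N\<^esub> inv\<^bsub>Q.H N\<^esub> x \<otimes>\<^bsub>Q.H N\<^esub> inv\<^bsub>Q.H N\<^esub> y \<in> layer (Suc n)"
proof -
  obtain a b where a: "a \<in> filtration n" "x = Q.\<pi> N a" and b: "b \<in> filtration (min n 1)" "y = Q.\<pi> N b"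
    using x y by blast
  have ab: "a \<in> carrier AG" "b \<in> carrier AG" using a b filtration_carrier by blast+
  have "Q.\<pi> N (comm_AG a b) \<in> layer (Suc n)" by (rule imageI[OF filtration_commutator[OF a(1) b(1) n]])
  then show ?thesis unfolding a(2) b(2)
    using ab by (simp only: Q.quot.hom_mult Q.quot.hom_inv AG.m_closed AG.inv_closed)
qed

lemma normal_layer_1: "(layer 1 :: 'k::{field,finite} poly fract mat set set) \<lhd> Q.H N"
proof -
  have "(filtration 1 :: 'k poly fract mat set) \<lhd> AG"
    unfolding AG.normal_inv_iff
  proof (intro conjI subgroup_filtration ballI)
    fix g h :: "'k poly fract mat" assume g: "g \<in> carrier AG" and h: "h \<in> filtration 1"
    have h': "h \<in> carrier AG" using h filtration_carrier by blast
    let ?w = "g \<otimes>\<^bsub>AG\<^esub> h \<otimes>\<^bsub>AG\<^esub> inv\<^bsub>AG\<^esub> g"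
    have w: "?w \<in> carrier AG" using g h' by (intro AG.m_closed AG.inv_closed)
    have "?w \<otimes>\<^bsub>AG\<^esub> g = g \<otimes>\<^bsub>AG\<^esub> h"
      using g h' by (simp only: AG.m_assoc AG.m_closed AG.inv_closed AG.l_inv AG.r_one)
    then have eq: "?w * g = g * h" by simp
    obtain u v a12 a13 a14 a23 a24 a34 where G: "g = m4 u v a12 a13 a14 a23 a24 a34" "u \<noteq> 0" "v \<noteq> 0"
      by (rule m4_cases[OF g])
    obtain u' v' b12 b13 b14 b23 b24 b34 where Hh: "h = m4 u' v' b12 b13 b14 b23 b24 b34" by (rule m4_cases[OF h'])
    obtain p q c12 c13 c14 c23 c24 c34 where W: "?w = m4 p q c12 c13 c14 c23 c24 c34" by (rule m4_cases[OF w])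
    have "u' = 1" "v' = 1" using h unfolding Hh m4_in_filtration by auto
    moreover have "p * u = u * u'" "q * v = v * v'" using eq unfolding W unfolding G Hh m4_mult m4_eq_iff by auto
    ultimately have "p = 1" "q = 1" using G(2,3) by auto
    then show "?w \<in> filtration 1" using w unfolding W m4_in_filtration by simp
  qed
  then show ?thesis
    using normal.surj_hom_normal_subgroup[OF _ Q.quot.group_hom_axioms Q.\<pi>_surj] by blast
qed

lemma solvable_quotient: "solvable (Q.H N :: 'k::{field,finite} poly fract mat set monoid)"
proof -
  let ?H = "Q.H N :: 'k poly fract mat set monoid"
  have sub: "(derived ?H ^^ n) (carrier ?H) \<subseteq> layer n" if "n \<le> 4" for n
    using that
  proof (induction n)
    case 0
    show ?case by (simp only: funpow_0 layer_0 subset_refl)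
  next
    case (Suc n)
    let ?K = "(derived ?H ^^ n) (carrier ?H)"
    have K: "?K \<subseteq> layer n" using Suc by simp
    have "layer n \<subseteq> (layer (min n 1) :: 'k poly fract mat set set)"
      by (intro image_mono filtration_antimono) simp
    then have K': "?K \<subseteq> layer (min n 1)" using K by (rule subset_trans[rotated])
    have "derived_set ?H ?K \<subseteq> layer (Suc n)"
    proof
      fix w assume "w \<in> derived_set ?H ?K"
      then obtain h1 h2 where h: "h1 \<in> ?K" "h2 \<in> ?K"
        and w: "w = h1 \<otimes>\<^bsub>?H\<^esub> h2 \<otimes>\<^bsub>?H\<^esub> inv\<^bsub>?H\<^esub> h1 \<otimes>\<^bsub>?H\<^esub> inv\<^bsub>?H\<^esub> h2"
        by (elim UN_E singletonE)
      have "n \<le> 3" using Suc.prems by simp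
      then show "w \<in> layer (Suc n)" unfolding w
        by (rule layer_commutator[OF subsetD[OF K h(1)] subsetD[OF K' h(2)]])
    qed
    then show ?case
      unfolding derived_def funpow.simps o_apply by (rule Q.quot.H.generate_subgroup_incl[OF _ subgroup_layer])
  qed
  have "\<one>\<^bsub>?H\<^esub> \<in> (derived ?H ^^ 4) (carrier ?H)"
    using subgroup.one_closed[OF Q.quot.H.exp_of_derived_is_subgroup[OF Q.quot.H.subgroup_self]] .
  then have "(derived ?H ^^ 4) (carrier ?H) = {\<one>\<^bsub>?H\<^esub>}"
    using sub[of 4] unfolding layer_4 by blast
  then show ?thesis unfolding Q.quot.H.solvable_iff_trivial_derived_seq by blast
qed

lemma nilpotent_by_abelian_quotient:
  "nilpotent_by_abelian 3 (Q.H N :: 'k::{field,finite} poly fract mat set monoid)"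
proof -
  let ?H = "Q.H N :: 'k poly fract mat set monoid"
  let ?L = "layer 1 :: 'k poly fract mat set set"
  let ?K = "?H\<lparr>carrier := ?L\<rparr>"
  have K: "group ?K" by (rule Q.quot.H.subgroup_imp_group[OF subgroup_layer])
  have inv: "inv\<^bsub>?K\<^esub> x = inv\<^bsub>?H\<^esub> x" if "x \<in> ?L" for x
    by (rule Q.quot.H.m_inv_consistent[OF subgroup_layer that])
  have layer_sub: "(layer (Suc n) :: 'k poly fract mat set set) \<subseteq> ?L" for n by (intro image_mono filtration_antimono) simp
  have "lower_central ?K 3 \<subseteq> layer (Suc 3)"
  proof (rule lower_central_subset[OF K, where c = 3])
    show "carrier ?K \<subseteq> layer (Suc 0)" by simp
    show "subgroup (layer (Suc n)) ?K" for n
      by (rule Q.quot.H.subgroup_incl[OF subgroup_layer subgroup_layer layer_sub])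
    fix n :: nat and x y :: "'k poly fract mat set"
    assume n: "n < 3" and x: "x \<in> layer (Suc n)" and y: "y \<in> carrier ?K"
    have xy: "x \<in> ?L" "y \<in> ?L" using x y layer_sub by auto
    have "x \<otimes>\<^bsub>?H\<^esub> y \<otimes>\<^bsub>?H\<^esub> inv\<^bsub>?H\<^esub> x \<otimes>\<^bsub>?H\<^esub> inv\<^bsub>?H\<^esub> y \<in> layer (Suc (Suc n))"
      using layer_commutator[OF x, of y] n xy(2) by simp
    then show "x \<otimes>\<^bsub>?K\<^esub> y \<otimes>\<^bsub>?K\<^esub> inv\<^bsub>?K\<^esub> x \<otimes>\<^bsub>?K\<^esub> inv\<^bsub>?K\<^esub> y \<in> layer (Suc (Suc n))"
      by (simp only: inv[OF xy(1)] inv[OF xy(2)] monoid.simps partial_object.simps) simp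
  qed simp
  moreover have "\<one>\<^bsub>?K\<^esub> \<in> lower_central ?K 3" by (simp only: numeral_3_eq_3 lower_central.simps generate.one)
  ultimately have "lower_central ?K 3 = {\<one>\<^bsub>?K\<^esub>}" using layer_4 by auto
  then have nil: "nilpotent_class_le 3 ?K" using K by (simp add: nilpotent_class_le_def)
  have "comm_group (?H Mod ?L)"
  proof (rule group.group_comm_groupI[OF normal.factorgroup_is_group[OF normal_layer_1]])
    fix A B assume "A \<in> carrier (?H Mod ?L)" "B \<in> carrier (?H Mod ?L)"
    then obtain x y where x: "x \<in> carrier ?H" "A = ?L #>\<^bsub>?H\<^esub> x" and y: "y \<in> carrier ?H" "B = ?L #>\<^bsub>?H\<^esub> y"
      by (auto simp: carrier_FactGroup)
    let ?c = "x \<otimes>\<^bsub>?H\<^esub> y \<otimes>\<^bsub>?H\<^esub> inv\<^bsub>?H\<^esub> x \<otimes>\<^bsub>?H\<^esub> inv\<^bsub>?H\<^esub> y"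
    have c: "?c \<in> ?L" using layer_commutator[of x 0 y] x(1) y(1) by (simp add: layer_0 del: mult_FactGroup)
    have "?c \<otimes>\<^bsub>?H\<^esub> (y \<otimes>\<^bsub>?H\<^esub> x) = x \<otimes>\<^bsub>?H\<^esub> y"
      by (rule Q.quot.H.commutator_mult[OF x(1) y(1)])
    then have "x \<otimes>\<^bsub>?H\<^esub> y \<in> ?L #>\<^bsub>?H\<^esub> (y \<otimes>\<^bsub>?H\<^esub> x)" using c unfolding r_coset_def by force
    then have "?L #>\<^bsub>?H\<^esub> (y \<otimes>\<^bsub>?H\<^esub> x) = ?L #>\<^bsub>?H\<^esub> (x \<otimes>\<^bsub>?H\<^esub> y)"
      by (rule Q.quot.H.repr_independence[OF _ Q.quot.H.m_closed[OF y(1) x(1)] subgroup_layer])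
    then show "A \<otimes>\<^bsub>?H Mod ?L\<^esub> B = B \<otimes>\<^bsub>?H Mod ?L\<^esub> A"
      unfolding x(2) y(2) mult_FactGroup[of ?H ?L]
      using normal.rcos_sum[OF normal_layer_1 x(1) y(1)] normal.rcos_sum[OF normal_layer_1 y(1) x(1)] by simp
  qed
  then show ?thesis unfolding nilpotent_by_abelian_def using normal_layer_1 nil by blast
qed

end

section \<open>Continuum many groups\<close>

text \<open>The codes of all dyadic approximations of a real number. Two different numbers have only finitely
  many approximations in common.\<close>
definition approximations :: "real \<Rightarrow> nat set" where
  "approximations x = range (\<lambda>n. to_nat (n, \<lfloor>x * 2 ^ n\<rfloor>))"

lemma infinite_approximations_Diff:
  assumes "x \<noteq> y" shows "infinite (approximations x - approximations y)"
proof -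
  obtain n0 :: nat where n0: "1 / \<bar>x - y\<bar> < 2 ^ n0" using real_arch_pow[of 2 "1 / \<bar>x - y\<bar>"] by auto
  have ne: "\<lfloor>x * 2 ^ n\<rfloor> \<noteq> \<lfloor>y * 2 ^ n\<rfloor>" if "n \<ge> n0" for n
  proof
    assume "\<lfloor>x * 2 ^ n\<rfloor> = \<lfloor>y * 2 ^ n\<rfloor>"
    then have "\<bar>x * 2 ^ n - y * 2 ^ n\<bar> < 1" by linarith
    then have "\<bar>x - y\<bar> * 2 ^ n < 1" by (simp add: left_diff_distrib[symmetric] abs_mult)
    moreover have "1 < \<bar>x - y\<bar> * 2 ^ n"
    proof -
      have "1 / \<bar>x - y\<bar> < 2 ^ n" using n0 power_increasing[OF that, of "2 :: real"] by linarith
      then show ?thesis using assms by (simp add: field_simps)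
    qed
    ultimately show False by simp
  qed
  let ?g = "\<lambda>n. to_nat (n, \<lfloor>x * 2 ^ n\<rfloor>)"
  have "?g ` {n0..} \<subseteq> approximations x - approximations y"
    unfolding approximations_def using ne by auto
  moreover have "infinite (?g ` {n0..})"
    using infinite_Ici[of n0] by (subst finite_image_iff) (auto intro!: inj_onI)
  ultimately show ?thesis by (meson finite_subset)
qed

lemma quasi_isometric_refl:
  assumes "group G" "finitely_generated G" shows "quasi_isometric G G"
proof -
  obtain S where S: "finite_generating_set G S" using assms(2) unfolding finitely_generated_def by blast
  have self: "word_dist G S y y = 0" if "y \<in> carrier G" for y
    using group.pseudometric_word_dist[OF assms(1) S] that unfolding pseudometric_on_def by blast
  then have "\<exists>x\<in>carrier G. word_dist G S x y \<le> 0" if "y \<in> carrier G" for y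
    using that by (intro bexI[of _ y]) simp_all
  then have "quasi_isometric_spaces (carrier G) (word_dist G S) (carrier G) (word_dist G S)"
    unfolding quasi_isometric_spaces_def
    by (intro bexI[of _ "\<lambda>x. x"] exI[of _ "1 :: real"]) (auto intro!: exI[of _ "0 :: real"])
  then show ?thesis unfolding quasi_isometric_def using S by blast
qed

theorem corollary1p8:
  fixes p :: nat
  assumes "prime p" and "CARD('k::{field,finite}) = p"
  shows "\<exists>\<G> :: 'k poly fract mat set monoid set.
           \<G> \<approx> (UNIV :: real set)
         \<and> (\<forall>G\<in>\<G>. group G \<and> finitely_generated G \<and> solvable G \<and> nilpotent_by_abelian 3 G
              \<and> (\<exists>Z. subgroup Z (A4 laurent_ring) \<and> Z \<subseteq> group_center (A4 laurent_ring)
                     \<and> G = A4 laurent_ring Mod Z))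
         \<and> pairwise (\<lambda>G H. \<not> quasi_isometric G H) \<G>"
proof -
  obtain m l :: "nat \<Rightarrow> nat" where m: "strict_mono m"
    and l: "\<And>i j (a :: 'k). j \<le> m i \<Longrightarrow> AG_len (e14_poly (monom a j)) \<le> l i"
    and D: "\<And>i (f :: 'k poly). AG_len (e14_poly f) \<le> Suc i * Suc (l i) \<Longrightarrow> degree f < m (Suc i)"
    using ex_lacunary_degrees[where 'k = 'k] by blast
  define G where "G x = (AG Mod central_part (m ` approximations x) :: 'k poly fract mat set monoid)" for x
  have not_qi: "\<not> quasi_isometric (G x) (G y)" if "x \<noteq> y" for x y
    unfolding G_def using infinite_approximations_Diff[of y x] that
    by (intro not_quasi_isometric[OF m l D]) auto
  have grp: "group (G x)" for x unfolding G_def by (rule Q.quot.H.group_axioms)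
  have fg: "finitely_generated (G x)" for x
    unfolding G_def finitely_generated_def using Q.finite_generating_set_quotient by blast
  have "inj G"
  proof (rule injI, rule ccontr)
    fix x y assume eq: "G x = G y" "x \<noteq> y"
    have "quasi_isometric (G x) (G x)" by (rule quasi_isometric_refl[OF grp fg])
    then show False using not_qi[OF eq(2)] eq(1) by simp
  qed
  then have card: "range G \<approx> (UNIV :: real set)" by (rule inj_on_image_eqpoll_self)
  have central: "\<exists>Z. subgroup Z (A4 laurent_ring) \<and> Z \<subseteq> group_center (A4 laurent_ring) \<and> G x = A4 laurent_ring Mod Z" for x
    unfolding G_def using subgroup_central_part central_part_central by blast
  have solv: "solvable (G x)" and nilp: "nilpotent_by_abelian 3 (G x)" for x
    unfolding G_def by (rule solvable_quotient, rule nilpotent_by_abelian_quotient)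
  show ?thesis
  proof (intro exI[of _ "range G"] conjI ballI)
    show "pairwise (\<lambda>G H. \<not> quasi_isometric G H) (range G)"
    proof (rule pairwiseI)
      fix A B assume "A \<in> range G" "B \<in> range G" "A \<noteq> B"
      then obtain x y where "A = G x" "B = G y" "x \<noteq> y" by (elim rangeE) auto
      then show "\<not> quasi_isometric A B" using not_qi by simp
    qed
  qed (use card grp fg solv nilp central in \<open>auto elim!: rangeE\<close>)
qed

end
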